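(* The Weber kernel group $\Gamma_1$ equals $\Gamma(2)$, and $\mathcal{W}_1\cong X(2)$.
   Context: Write $\zeta_k=e^{2\pi i/k}$. Let $\eta$ be the Dedekind eta function and $$\mathfrak{f}(\tau)=\zeta_{48}^{-1}\frac{\eta\left(\frac{\tau+1}{2}\right)}{\eta(\tau)},\quad \mathfrak{f}_1(\tau)=\frac{\eta\left(\frac{\tau}{2}\right)}{\eta(\tau)},\quad \mathfrak{f}_2(\tau)=\sqrt2\,\frac{\eta(2\tau)}{\eta(\tau)},$$ $(\mathfrak{u}_0,\mathfrak{u}_1,\mathfrak{u}_2)=(\mathfrak{f},\zeta_{16}\mathfrak{f}_1,\zeta_{16}^{-1}\mathfrak{f}_2)$. For $n\mid 24$, the Weber kernel group $\Gamma_n\subset\mathrm{PSL}_2(\mathbb{Z})$ is the group of all $g$ with $\mathfrak{u}_i^{24/n}\circ g=\mathfrak{u}_i^{24/n}$ for $i=0,1,2$. The Weber curve $\mathcal{W}_n$ is the image in $\mathbb{P}^3$ of $(\mathfrak{u}_0^{24/n}:\mathfrak{u}_1^{24/n}:\mathfrak{u}_2^{24/n}:1)$, and it is identified (as smooth projective model / function field) with the modular curve $X(\Gamma_n)$; for $n=1$ it has equations $X_0+X_1+X_2=48X_3$, $X_0X_1X_2=4096X_3^3$. Here $\Gamma(N)$ denotes the image in $\mathrm{PSL}_2(\mathbb{Z})$ of the principal congruence subgroup of level $N$, and $X(N)$ is the associated modular curve. *)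

theory Defs
  imports
    "HOL-Complex_Analysis.Complex_Analysis"
    "HOL-Algebra.QuotRing"
    "HOL-Number_Theory.Cong"
begin

section \<open>The Weber functions\<close>

abbreviation upper_half_plane :: "complex set" where
  "upper_half_plane \<equiv> {\<tau>. Im \<tau> > 0}"

definition zeta_root :: "nat \<Rightarrow> complex" where
  "zeta_root k = exp (2 * of_real pi * \<i> / of_nat k)"

definition dedekind_eta :: "complex \<Rightarrow> complex" where
  "dedekind_eta \<tau> =
     exp (2 * of_real pi * \<i> * \<tau> / 24) * (\<Prod>n. 1 - exp (2 * of_real pi * \<i> * \<tau>) ^ Suc n)"

definition weber_f :: "complex \<Rightarrow> complex" where
  "weber_f \<tau> = inverse (zeta_root 48) * (dedekind_eta ((\<tau> + 1) / 2) / dedekind_eta \<tau>)"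

definition weber_f1 :: "complex \<Rightarrow> complex" where
  "weber_f1 \<tau> = dedekind_eta (\<tau> / 2) / dedekind_eta \<tau>"

definition weber_f2 :: "complex \<Rightarrow> complex" where
  "weber_f2 \<tau> = of_real (sqrt 2) * (dedekind_eta (2 * \<tau>) / dedekind_eta \<tau>)"

definition weber_u0 :: "complex \<Rightarrow> complex" where
  "weber_u0 \<tau> = weber_f \<tau>"

definition weber_u1 :: "complex \<Rightarrow> complex" where
  "weber_u1 \<tau> = zeta_root 16 * weber_f1 \<tau>"

definition weber_u2 :: "complex \<Rightarrow> complex" where
  "weber_u2 \<tau> = inverse (zeta_root 16) * weber_f2 \<tau>"


section \<open>The modular group and its subgroups\<close>

definition SL2Z :: "(int ^ 2 ^ 2) monoid" where
  "SL2Z = \<lparr>carrier = {A. det A = 1}, mult = (**), one = mat 1\<rparr>"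

text \<open>Elements of \<open>PSL2Z\<close> are cosets, i.e. two-element sets of matrices \<open>{A, - A}\<close>.\<close>

definition PSL2Z :: "(int ^ 2 ^ 2) set monoid" where
  "PSL2Z = SL2Z Mod {mat 1, - mat 1}"

definition moebius :: "int ^ 2 ^ 2 \<Rightarrow> complex \<Rightarrow> complex" where
  "moebius A \<tau> =
     (of_int (A $ 1 $ 1) * \<tau> + of_int (A $ 1 $ 2)) / (of_int (A $ 2 $ 1) * \<tau> + of_int (A $ 2 $ 2))"

definition principal_congruence :: "nat \<Rightarrow> (int ^ 2 ^ 2) set set" where
  "principal_congruence N =
     (\<lambda>A. {mat 1, - mat 1} #>\<^bsub>SL2Z\<^esub> A) `
       {A \<in> carrier SL2Z. \<forall>i j. [A $ i $ j = mat 1 $ i $ j] (mod int N)}"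

text \<open>The two representatives of an element of \<open>PSL2Z\<close> act in the same way on the upper half
  plane, so quantifying over all representatives is harmless. The definition is meant for
  \<open>n dvd 24\<close>.\<close>

definition weber_kernel :: "nat \<Rightarrow> (int ^ 2 ^ 2) set set" where
  "weber_kernel n =
     {g \<in> carrier PSL2Z. \<forall>u \<in> {weber_u0, weber_u1, weber_u2}. \<forall>A \<in> g. \<forall>\<tau> \<in> upper_half_plane.
        u (moebius A \<tau>) ^ (24 div n) = u \<tau> ^ (24 div n)}"


section \<open>The function field of a modular curve\<close>

text \<open>A meromorphic function on the upper half plane is represented by the function on \<open>complex\<close>
  in which all removable singularities are removed and which is 0 at the poles and outside the
  upper half plane. Equality of meromorphic functions is then equality in HOL, and sums and
  products have to be normalised.\<close>

definition normalise_mero :: "(complex \<Rightarrow> complex) \<Rightarrow> complex \<Rightarrow> complex" where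
  "normalise_mero f = (\<lambda>\<tau>. if \<tau> \<in> upper_half_plane then remove_sings f \<tau> else 0)"

text \<open>Every cusp is of the form \<open>A \<infinity>\<close> with \<open>A\<close> in \<open>SL2Z\<close>, and \<open>exp (2 \<pi> \<i> \<tau> / h)\<close>
  is a local parameter at \<open>\<infinity>\<close> when \<open>h\<close> is the width of the cusp; being meromorphic at the cusp
  does not depend on which period \<open>h\<close> of \<open>f \<circ> moebius A\<close> is used.\<close>

definition meromorphic_at_cusps :: "(complex \<Rightarrow> complex) \<Rightarrow> bool" where
  "meromorphic_at_cusps f \<longleftrightarrow>
     (\<forall>A \<in> carrier SL2Z. \<exists>h::nat. h > 0 \<and> (\<exists>F. F meromorphic_on {0} \<and>
        (\<exists>y>0. \<forall>\<tau>. Im \<tau> > y \<longrightarrow>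
           f (moebius A \<tau>) = F (exp (2 * of_real pi * \<i> * \<tau> / of_nat h)))))"

text \<open>The function field of the modular curve \<open>X(\<Gamma>)\<close>: the modular functions for \<open>\<Gamma>\<close>.\<close>

definition modular_function_field ::
    "(int ^ 2 ^ 2) set set \<Rightarrow> (complex \<Rightarrow> complex) ring" where
  "modular_function_field \<Gamma> =
     \<lparr>carrier = {f. f nicely_meromorphic_on upper_half_plane \<and>
                    (\<forall>\<tau>. \<tau> \<notin> upper_half_plane \<longrightarrow> f \<tau> = 0) \<and>
                    (\<forall>g \<in> \<Gamma>. \<forall>A \<in> g. \<forall>\<tau> \<in> upper_half_plane. f (moebius A \<tau>) = f \<tau>) \<and>
                    meromorphic_at_cusps f},
      mult = (\<lambda>f g. normalise_mero (\<lambda>\<tau>. f \<tau> * g \<tau>)),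
      one = normalise_mero (\<lambda>_. 1),
      zero = (\<lambda>_. 0),
      add = (\<lambda>f g. normalise_mero (\<lambda>\<tau>. f \<tau> + g \<tau>))\<rparr>"


section \<open>Curves in projective 3-space and their function fields\<close>

definition proj_point :: "complex ^ 4 \<Rightarrow> (complex ^ 4) set" where
  "proj_point x = {c *s x | c. c \<noteq> 0}"

definition projective_space3 :: "(complex ^ 4) set set" where
  "projective_space3 = proj_point ` {x. x \<noteq> 0}"

text \<open>Homogeneous polynomials of degree \<open>d\<close> in four variables. As \<open>complex\<close> is infinite they can
  be identified with the functions they define. In the definition, \<open>m\<close> runs over the exponent
  vectors of the monomials of degree \<open>d\<close>.\<close>

definition homogeneous_poly :: "nat \<Rightarrow> (complex ^ 4 \<Rightarrow> complex) \<Rightarrow> bool" where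
  "homogeneous_poly d p \<longleftrightarrow>
     (\<exists>c. p = (\<lambda>x. \<Sum>m | (\<Sum>i\<in>UNIV. m i) = d. c m * (\<Prod>i\<in>UNIV. (x $ i) ^ m i)))"

definition zariski_closure :: "(complex ^ 4) set set \<Rightarrow> (complex ^ 4) set set" where
  "zariski_closure S =
     {P \<in> projective_space3. \<forall>d p. homogeneous_poly d p \<longrightarrow>
        (\<forall>Q \<in> S. \<forall>x \<in> Q. p x = 0) \<longrightarrow> (\<forall>x \<in> P. p x = 0)}"

text \<open>The function field of an irreducible closed set \<open>V\<close> of projective 3-space: quotients \<open>p / q\<close>
  of homogeneous polynomials of the same degree, \<open>q\<close> not vanishing identically on \<open>V\<close>,
  up to equality on \<open>V\<close>.\<close>

definition fractions ::
    "(complex ^ 4) set set \<Rightarrow> ((complex ^ 4 \<Rightarrow> complex) \<times> (complex ^ 4 \<Rightarrow> complex)) set" where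
  "fractions V =
     {(p, q). \<exists>d. homogeneous_poly d p \<and> homogeneous_poly d q \<and> (\<exists>P \<in> V. \<exists>x \<in> P. q x \<noteq> 0)}"

definition fraction_rel ::
    "(complex ^ 4) set set \<Rightarrow> ((complex ^ 4 \<Rightarrow> complex) \<times> (complex ^ 4 \<Rightarrow> complex)) rel" where
  "fraction_rel V =
     {((p, q), (p', q')). (p, q) \<in> fractions V \<and> (p', q') \<in> fractions V \<and>
        (\<forall>P \<in> V. \<forall>x \<in> P. p x * q' x = p' x * q x)}"

definition rat_fun ::
    "(complex ^ 4) set set \<Rightarrow> (complex ^ 4 \<Rightarrow> complex) \<Rightarrow> (complex ^ 4 \<Rightarrow> complex) \<Rightarrow>
     ((complex ^ 4 \<Rightarrow> complex) \<times> (complex ^ 4 \<Rightarrow> complex)) set" where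
  "rat_fun V p q = fraction_rel V `` {(p, q)}"

definition function_field ::
    "(complex ^ 4) set set \<Rightarrow> ((complex ^ 4 \<Rightarrow> complex) \<times> (complex ^ 4 \<Rightarrow> complex)) set ring" where
  "function_field V =
     \<lparr>carrier = fractions V // fraction_rel V,
      mult = (\<lambda>R S. \<Union>(p, q) \<in> R. \<Union>(p', q') \<in> S.
                rat_fun V (\<lambda>x. p x * p' x) (\<lambda>x. q x * q' x)),
      one = rat_fun V (\<lambda>_. 1) (\<lambda>_. 1),
      zero = rat_fun V (\<lambda>_. 0) (\<lambda>_. 1),
      add = (\<lambda>R S. \<Union>(p, q) \<in> R. \<Union>(p', q') \<in> S.
                rat_fun V (\<lambda>x. p x * q' x + p' x * q x) (\<lambda>x. q x * q' x))\<rparr>"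


section \<open>The Weber curves\<close>

definition weber_map :: "nat \<Rightarrow> complex \<Rightarrow> complex ^ 4" where
  "weber_map n \<tau> =
     vector [weber_u0 \<tau> ^ (24 div n), weber_u1 \<tau> ^ (24 div n), weber_u2 \<tau> ^ (24 div n), 1]"

text \<open>The closure adds to the image of the upper half plane the finitely many images of the cusps,
  where some of the coordinates have poles.\<close>

definition weber_curve :: "nat \<Rightarrow> (complex ^ 4) set set" where
  "weber_curve n = zariski_closure ((\<lambda>\<tau>. proj_point (weber_map n \<tau>)) ` upper_half_plane)"

text \<open>\<open>weber_curve n\<close> is isomorphic to the modular curve \<open>X(\<Gamma>)\<close>, in the sense of smooth projective
  models (\<open>weber_curve 1\<close> itself has a node at \<open>(16 : 16 : 16 : 1)\<close>): the function fields are
  isomorphic over the complex numbers. The isomorphism is required to be the one induced by the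
  parametrisation, that is, composition with \<open>weber_map n\<close>.\<close>

definition weber_curve_iso :: "nat \<Rightarrow> (int ^ 2 ^ 2) set set \<Rightarrow> bool" where
  "weber_curve_iso n \<Gamma> \<longleftrightarrow>
     (\<exists>\<phi> \<in> ring_iso (function_field (weber_curve n)) (modular_function_field \<Gamma>).
        (\<forall>c. \<phi> (rat_fun (weber_curve n) (\<lambda>_. c) (\<lambda>_. 1)) = normalise_mero (\<lambda>_. c)) \<and>
        (\<forall>(p, q) \<in> fractions (weber_curve n).
           \<phi> (rat_fun (weber_curve n) p q) =
             normalise_mero (\<lambda>\<tau>. p (weber_map n \<tau>) / q (weber_map n \<tau>))))"

end

theory Submission
  imports Defs
begin

text \<open>Put \<open>q = exp (\<pi> \<i> \<tau>)\<close>. The eighth powers of the three Weber functions are products over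
  \<open>1 \<plusminus> q ^ (2 n + 1)\<close>, that is, zero values of theta products. Two such products, one for \<open>\<tau>\<close>
  and one for \<open>- 1 / \<tau>\<close>, are quasi-periodic entire functions with the same multipliers and
  the same simple zeros, so they are proportional by Liouville's theorem; the unknown factor cancels
  in quotients, and up to cube roots of unity \<open>SL2Z\<close> permutes the eighth powers through the
  parities of the matrix entries. As the three 24th powers are distinct, the kernel is the group of
  matrices that are trivial modulo 2.

  The sum of the three eighth powers vanishes at all cusps, hence everywhere, by the maximum principle.
  So their quotients are expressed by the modular function \<open>lam\<close>, which itself is a rational function
  on the Weber curve. A modular function for \<open>\<Gamma>(2)\<close> times a suitable polynomial in \<open>lam\<close> is
  holomorphic and bounded by a power of \<open>1 + \<bar>lam\<bar>\<close>, hence a polynomial in \<open>lam\<close>. This gives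
  surjectivity of the map of function fields; injectivity holds because the curve is the Zariski
  closure of the image of the parametrisation.\<close>

section \<open>Infinite products\<close>

text \<open>Eighth powers are the convenient level: up to sign and an elementary exponential they
  are fourth powers of theta values at half periods, and \<open>zeta_root 16\<close> contributes
  just the signs that turn Jacobi's identity into a vanishing sum in which no function is
  distinguished. The transformation law of eta with its square root is bypassed: the constant
  relating the two theta products is never evaluated, and the common factor k that remains satisfies
  k^3 = 1 because the product of the three eighth powers is 16. This factor disappears in 24th
  powers, in quotients such as \<open>lam\<close>, and in the cube of the sum. The compact Riemann
  surface X(2) does not occur. Instead of counting zeros and poles, the proof uses norm estimates on
  finitely many translates of the strip |Re| \<le> 1/2, Im \<ge> 1/2. Poles inside the half plane
  are cleared by factors \<open>lam\<close> - const, and poles at the cusps, where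
  \<open>lam\<close> tends to 0, 1 or infinity, by powers of \<open>lam\<close> (1 -
  \<open>lam\<close>).\<close>

lemma holomorphic_on_prodinf:
  fixes a :: "nat \<Rightarrow> complex \<Rightarrow> complex"
  assumes "open S" and hol: "\<And>n. a n holomorphic_on S"
    and bd: "\<And>z. z \<in> S \<Longrightarrow> \<exists>d>0. cball z d \<subseteq> S \<and>
        (\<exists>M. summable M \<and> (\<forall>n. \<forall>w\<in>cball z d. norm (a n w) \<le> M n))"
  shows "(\<lambda>z. \<Prod>n. 1 + a n z) holomorphic_on S"
proof (rule holomorphic_uniform_sequence[where f = "\<lambda>N z. \<Prod>n<N. 1 + a n z"])
  fix z assume "z \<in> S"
  then obtain d M where d: "d > 0" "cball z d \<subseteq> S" "summable M"
    and M: "\<And>n w. w \<in> cball z d \<Longrightarrow> norm (a n w) \<le> M n"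
    using bd by metis
  \<comment> \<open>The Weierstrass M-test on the closed ball yields a uniform limit
    \<open>l\<close>, which is then matched pointwise with the infinite product.\<close>
  have "uniformly_convergent_on (cball z d) (\<lambda>N w. \<Prod>n<N. 1 + a n w)"
  proof (rule uniformly_convergent_on_prod)
    show "uniformly_convergent_on (cball z d) (\<lambda>N w. \<Sum>n<N. norm (a n w))"
      by (rule Weierstrass_m_test'[OF _ d(3)]) (use M in auto)
    show "continuous_on (cball z d) (a n)" for n
      using hol d(2) holomorphic_on_imp_continuous_on continuous_on_subset by blast
  qed auto
  then obtain l where l: "uniform_limit (cball z d) (\<lambda>N w. \<Prod>n<N. 1 + a n w) l sequentially"
    by (auto simp: uniformly_convergent_on_def)
  have "l w = (\<Prod>n. 1 + a n w)" if w: "w \<in> cball z d" for w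
  proof -
    have "summable (\<lambda>n. norm (1 + a n w - 1))"
      by (rule summable_comparison_test[OF _ d(3)]) (use M w in auto)
    then have "convergent_prod (\<lambda>n. 1 + a n w)"
      using abs_convergent_prod_conv_summable abs_convergent_prod_imp_convergent_prod by metis
    then have "(\<lambda>N. \<Prod>n<N. 1 + a n w) \<longlonglongrightarrow> (\<Prod>n. 1 + a n w)"
      using convergent_prod_LIMSEQ LIMSEQ_lessThan_iff_atMost by blast
    moreover have "(\<lambda>N. \<Prod>n<N. 1 + a n w) \<longlonglongrightarrow> l w"
      using tendsto_uniform_limitI[OF l w] .
    ultimately show ?thesis using LIMSEQ_unique by blast
  qed
  then have "uniform_limit (cball z d) (\<lambda>N w. \<Prod>n<N. 1 + a n w) (\<lambda>w. \<Prod>n. 1 + a n w) sequentially"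
    using l by (subst uniform_limit_cong'[where g = "\<lambda>N w. \<Prod>n<N. 1 + a n w" and i = l]) auto
  then show "\<exists>d>0. cball z d \<subseteq> S \<and>
      uniform_limit (cball z d) (\<lambda>N w. \<Prod>n<N. 1 + a n w) (\<lambda>w. \<Prod>n. 1 + a n w) sequentially"
    using d by blast
qed (use assms in \<open>auto intro!: holomorphic_intros\<close>)

section \<open>The infinite q-Pochhammer symbol (-x; p)\<close>

definition qpoch :: "complex \<Rightarrow> complex \<Rightarrow> complex" where
  "qpoch p x = (\<Prod>n. 1 + x * p ^ n)"

lemma convergent_prod_qpoch:
  assumes "norm p < 1"
  shows "convergent_prod (\<lambda>n. 1 + x * p ^ n :: complex)"
proof -
  have "summable (\<lambda>n. norm (1 + x * p ^ n - 1))"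
    using assms by (auto simp: norm_mult norm_power intro!: summable_mult)
  then show ?thesis
    using abs_convergent_prod_conv_summable abs_convergent_prod_imp_convergent_prod by metis
qed

lemma qpoch_LIMSEQ:
  assumes "norm p < 1"
  shows "(\<lambda>N. \<Prod>n<N. 1 + x * p ^ n) \<longlonglongrightarrow> qpoch p x"
  using convergent_prod_LIMSEQ[OF convergent_prod_qpoch[OF assms]] LIMSEQ_lessThan_iff_atMost
  unfolding qpoch_def by blast

lemma qpoch_0 [simp]: "qpoch p 0 = 1"
  by (simp add: qpoch_def)

lemma qpoch_nonzero:
  assumes "norm p < 1" "\<And>n. 1 + x * p ^ n \<noteq> 0"
  shows "qpoch p x \<noteq> 0"
  unfolding qpoch_def using prodinf_nonzero[OF convergent_prod_qpoch[OF assms(1)]] assms(2) by blast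

lemma qpoch_nonzero':
  assumes "norm p < 1" "norm x < 1"
  shows "qpoch p x \<noteq> 0"
proof (rule qpoch_nonzero)
  fix n
  have "norm (x * p ^ n) \<le> norm x"
    using assms by (auto simp: norm_mult norm_power intro!: mult_left_le power_le_one)
  then have "norm (x * p ^ n) < 1" using assms by linarith
  then show "1 + x * p ^ n \<noteq> 0"
    by (metis add.inverse_unique less_irrefl norm_minus_cancel norm_one)
qed (use assms in auto)

lemma qpoch_rec:
  assumes "norm p < 1"
  shows "qpoch p x = (1 + x) * qpoch p (p * x)"
proof -
  have "(\<lambda>N. \<Prod>n<Suc N. 1 + x * p ^ n) \<longlonglongrightarrow> qpoch p x"
    using qpoch_LIMSEQ[OF assms] LIMSEQ_Suc by blast
  moreover have "(\<Prod>n<Suc N. 1 + x * p ^ n) = (1 + x) * (\<Prod>n<N. 1 + p * x * p ^ n)" for N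
    by (subst prod.lessThan_Suc_shift) (auto simp: mult_ac)
  moreover have "(\<lambda>N. (1 + x) * (\<Prod>n<N. 1 + p * x * p ^ n)) \<longlonglongrightarrow> (1 + x) * qpoch p (p * x)"
    by (intro tendsto_intros qpoch_LIMSEQ assms)
  ultimately show ?thesis using LIMSEQ_unique by simp
qed

lemma norm_power2_less_1: "norm (p::complex) < 1 \<Longrightarrow> norm (p\<^sup>2) < 1"
  by (simp add: norm_power power_less_one_iff abs_square_less_1)

text \<open>Even and odd n are separated along the partial products of even length.\<close>

lemma qpoch_split:
  assumes "norm p < 1"
  shows "qpoch p x = qpoch (p\<^sup>2) x * qpoch (p\<^sup>2) (x * p)"
proof -
  have "(\<lambda>N. \<Prod>n<2*N. 1 + x * p ^ n) \<longlonglongrightarrow> qpoch p x"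
    using LIMSEQ_subseq_LIMSEQ[OF qpoch_LIMSEQ[OF assms], of "\<lambda>n. 2 * n"]
    by (auto simp: strict_mono_def o_def)
  moreover have "(\<Prod>n<2*N. 1 + x * p ^ n) = (\<Prod>n<N. 1 + x * (p\<^sup>2) ^ n) * (\<Prod>n<N. 1 + x * p * (p\<^sup>2) ^ n)" for N
  proof (induction N)
    case (Suc N)
    have "(\<Prod>n<2 * Suc N. 1 + x * p ^ n) =
        (\<Prod>n<2 * N. 1 + x * p ^ n) * ((1 + x * p ^ (2 * N)) * (1 + x * p ^ Suc (2 * N)))"
      by (simp add: mult_ac)
    moreover have "p ^ (2 * N) = (p\<^sup>2) ^ N" by (rule power_mult)
    ultimately show ?case
      using Suc by (simp add: algebra_simps)
  qed simp
  moreover have "(\<lambda>N. (\<Prod>n<N. 1 + x * (p\<^sup>2) ^ n) * (\<Prod>n<N. 1 + x * p * (p\<^sup>2) ^ n))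
      \<longlonglongrightarrow> qpoch (p\<^sup>2) x * qpoch (p\<^sup>2) (x * p)"
    by (intro tendsto_intros qpoch_LIMSEQ norm_power2_less_1 assms)
  ultimately show ?thesis using LIMSEQ_unique by simp
qed

lemma qpoch_mult_minus:
  assumes "norm p < 1"
  shows "qpoch p x * qpoch p (- x) = qpoch (p\<^sup>2) (- (x\<^sup>2))"
proof -
  have "qpoch p x * qpoch p (- x) = (\<Prod>n. (1 + x * p ^ n) * (1 + (- x) * p ^ n))"
    unfolding qpoch_def by (intro prodinf_mult convergent_prod_qpoch assms)
  also have "\<dots> = qpoch (p\<^sup>2) (- (x\<^sup>2))"
    unfolding qpoch_def
    by (intro prodinf_cong)
       (simp add: algebra_simps power2_eq_square power_mult_distrib)
  finally show ?thesis .
qed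

lemma holomorphic_on_qpoch:
  assumes "norm p < 1"
  shows "qpoch p holomorphic_on S"
proof -
  have "(\<lambda>x. \<Prod>n. 1 + x * p ^ n) holomorphic_on UNIV"
  proof (rule holomorphic_on_prodinf)
    fix z :: complex
    have "\<forall>w\<in>cball z 1. norm (w * p ^ n) \<le> (norm z + 1) * norm p ^ n" for n
      by (auto simp: norm_mult norm_power dist_norm intro!: mult_right_mono)
         (smt (verit) norm_minus_commute norm_triangle_ineq2)
    moreover have "summable (\<lambda>n. (norm z + 1) * norm p ^ n)"
      using assms by (auto intro!: summable_mult)
    ultimately show "\<exists>d>0. cball z d \<subseteq> UNIV \<and>
        (\<exists>M. summable M \<and> (\<forall>n. \<forall>w\<in>cball z d. norm (w * p ^ n) \<le> M n))"
      by (intro exI[of _ 1] conjI exI[of _ "\<lambda>n. (norm z + 1) * norm p ^ n"]) simp_all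
  qed (auto intro!: holomorphic_intros)
  then show ?thesis unfolding qpoch_def using holomorphic_on_subset by blast
qed

section \<open>The odd product (q; q^2), the Euler product (x; x) and Euler's identities\<close>

definition odd_prod :: "complex \<Rightarrow> complex" where
  "odd_prod q = qpoch (q\<^sup>2) (- q)"

lemma odd_prod_0 [simp]: "odd_prod 0 = 1"
  by (simp add: odd_prod_def)

lemma odd_prod_nonzero: "norm q < 1 \<Longrightarrow> odd_prod q \<noteq> 0"
  unfolding odd_prod_def by (rule qpoch_nonzero') (auto intro: norm_power2_less_1)

lemma odd_prod_mult_minus:
  assumes "norm q < 1"
  shows "odd_prod q * odd_prod (- q) = odd_prod (q\<^sup>2)"
  using qpoch_mult_minus[OF norm_power2_less_1[OF assms], of "-q"] by (simp add: odd_prod_def)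

lemma holomorphic_on_odd_prod: "odd_prod holomorphic_on ball 0 1"
proof -
  have "(\<lambda>q::complex. \<Prod>n. 1 + (- q * (q\<^sup>2) ^ n)) holomorphic_on ball 0 1"
  proof (rule holomorphic_on_prodinf)
    fix z :: complex assume z: "z \<in> ball 0 1"
    \<comment> \<open>The closed ball of radius (1 - |z|) / 2 about z stays inside |w| \<le> r < 1,
      so the powers of r are a summable majorant.\<close>
    define r where "r = (1 + norm z) / 2"
    have r: "0 < r" "r < 1" using z by (auto simp: r_def intro: add_pos_nonneg)
    have nw: "norm w \<le> r" if "w \<in> cball z ((1 - norm z) / 2)" for w
    proof -
      have "norm w \<le> norm z + dist z w"
        by (metis dist_0_norm dist_commute dist_triangle)
      then show ?thesis using that by (simp add: r_def field_simps)
    qed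
    have "norm (- w * (w\<^sup>2) ^ n) \<le> r ^ n" if "w \<in> cball z ((1 - norm z) / 2)" for w n
    proof -
      have "norm (- w * (w\<^sup>2) ^ n) = norm w ^ Suc (2 * n)"
        by (simp add: norm_mult norm_power power_mult)
      also have "\<dots> \<le> r ^ Suc (2 * n)" using nw[OF that] by (intro power_mono) auto
      also have "\<dots> \<le> r ^ n" using r by (intro power_decreasing) auto
      finally show ?thesis .
    qed
    moreover have "summable (\<lambda>n. r ^ n)" using r by auto
    moreover have "cball z ((1 - norm z) / 2) \<subseteq> ball 0 1"
      using nw r by (fastforce simp: )
    ultimately show "\<exists>d>0. cball z d \<subseteq> ball 0 1 \<and>
        (\<exists>M. summable M \<and> (\<forall>n. \<forall>w\<in>cball z d. norm (- w * (w\<^sup>2) ^ n) \<le> M n))"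
      using z by (intro exI[of _ "(1 - norm z) / 2"] conjI exI[of _ "\<lambda>n. r ^ n"]) simp_all
  qed (auto intro!: holomorphic_intros)
  then show ?thesis unfolding odd_prod_def[abs_def] qpoch_def by simp
qed

definition euler_prod :: "complex \<Rightarrow> complex" where
  "euler_prod x = (\<Prod>n. 1 - x ^ Suc n)"

lemma euler_prod_eq: "euler_prod x = qpoch x (- x)"
  by (simp add: euler_prod_def qpoch_def)

lemma euler_prod_nonzero: "norm x < 1 \<Longrightarrow> euler_prod x \<noteq> 0"
  unfolding euler_prod_eq by (rule qpoch_nonzero') auto

lemma euler_prod_split:
  assumes "norm x < 1"
  shows "euler_prod x = odd_prod x * euler_prod (x\<^sup>2)"
  using qpoch_split[OF assms, of "- x"] by (simp add: euler_prod_eq odd_prod_def power2_eq_square)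

text \<open>Euler's identity between partitions into distinct and into odd parts, at q^2: multiply
  by the Euler product, use (1 + y) (1 - y) = 1 - y^2 in each factor, and cancel.\<close>

lemma qpoch_square_odd_prod:
  assumes "norm q < 1"
  shows "qpoch (q\<^sup>2) (q\<^sup>2) * odd_prod (q\<^sup>2) = 1"
proof -
  have q2: "norm (q\<^sup>2) < 1" using assms by (rule norm_power2_less_1)
  have "qpoch (q\<^sup>2) (q\<^sup>2) * euler_prod (q\<^sup>2) = euler_prod ((q\<^sup>2)\<^sup>2)"
    using qpoch_mult_minus[OF q2, of "q\<^sup>2"] by (simp add: euler_prod_eq)
  moreover have "euler_prod ((q\<^sup>2)\<^sup>2) \<noteq> 0" by (intro euler_prod_nonzero norm_power2_less_1 assms)
  ultimately show ?thesis
    using euler_prod_split[OF q2] by auto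
qed

section \<open>Theta products\<close>

lemma bounded_imp_not_is_pole:
  assumes "\<forall>\<^sub>F w in at z. norm (f w) \<le> B"
  shows "\<not> is_pole f (z::complex)"
proof
  assume "is_pole f z"
  then have "\<forall>\<^sub>F w in at z. norm (f w) > B"
    unfolding is_pole_def
    using filterlim_at_infinity_imp_norm_at_top filterlim_at_top_dense[of "\<lambda>w. norm (f w)"]
    by blast
  with assms have "\<forall>\<^sub>F w in at z. False" by eventually_elim simp
  then show False by simp
qed

text \<open>The quotient f / g is bounded, so its singularities at the zeros of g are removable and
  Liouville's theorem makes the extension constant. Division by zero gives 0, so the bound on the
  quotient holds at every point.\<close>

lemma entire_bounded_ratio:
  assumes hol: "f holomorphic_on UNIV" "g holomorphic_on UNIV"
    and le: "\<And>z. norm (f z) \<le> C * norm (g z)"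
  shows "\<exists>c. \<forall>z::complex. f z = c * g z"
proof -
  define R where "R = remove_sings (\<lambda>z. f z / g z)"
  have ana: "f analytic_on {z}" "g analytic_on {z}" for z
    using hol by (auto simp: analytic_on_holomorphic)
  have mero: "(\<lambda>z. f z / g z) meromorphic_on {z}" for z
    by (intro meromorphic_on_divide analytic_on_imp_meromorphic_on ana)
  have bnd: "norm (f z / g z) \<le> \<bar>C\<bar>" for z
  proof (cases "g z = 0")
    case False
    have "norm (f z) \<le> \<bar>C\<bar> * norm (g z)"
      by (rule order_trans[OF le]) (auto intro: mult_right_mono)
    then show ?thesis using False by (simp add: norm_divide field_simps)
  qed auto
  have lim: "((\<lambda>z. f z / g z) \<longlongrightarrow> R z) (at z)" for z
  proof -
    have "\<not> is_pole (\<lambda>z. f z / g z) z"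
      by (rule bounded_imp_not_is_pole[OF always_eventually]) (use bnd in blast)
    then obtain c where "((\<lambda>z. f z / g z) \<longlongrightarrow> c) (at z)"
      using meromorphic_on_not_essential[OF mero[of z]] by (auto simp: not_essential_def)
    then show ?thesis unfolding R_def by (metis remove_sings_eqI)
  qed
  have "R analytic_on {z}" for z
    unfolding R_def
    by (rule remove_sings_analytic_at[OF meromorphic_on_isolated_singularity[OF mero] lim])
  then have "R holomorphic_on UNIV"
    by (meson analytic_imp_holomorphic analytic_on_analytic_at)
  moreover have "norm (R z) \<le> \<bar>C\<bar>" for z
    by (rule tendsto_upperbound[OF tendsto_norm[OF lim]]) (use bnd in auto)
  then have "bounded (range R)" by (auto simp: bounded_iff)
  ultimately obtain c where c: "\<And>z. R z = c"
    using Liouville_theorem by (auto simp: constant_on_def)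
  have "f z = c * g z" for z
  proof (cases "g z = 0")
    case True
    then show ?thesis using le[of z] by simp
  next
    case False
    then have "(\<lambda>z. f z / g z) analytic_on {z}"
      by (intro analytic_on_divide ana) auto
    then have "R z = f z / g z" unfolding R_def by simp
    then show ?thesis using False c by (simp add: field_simps)
  qed
  then show ?thesis by blast
qed

text \<open>The multiplier e is common to f and g and cancels in an estimate |f| \<le> C |g|. It is
  therefore enough to prove the estimate on a closed period parallelogram centred at a, where
  compactness reduces it to neighbourhoods of points. The only zero of g there is a; it is simple
  and f vanishes there too, so f / g has a finite limit.\<close>

lemma quasi_periodic_proportional:
  fixes \<tau> a :: complex
  assumes \<tau>: "Im \<tau> > 0"
    and hol: "f holomorphic_on UNIV" "g holomorphic_on UNIV"
    and per1: "\<And>z. f (z + 1) = f z" "\<And>z. g (z + 1) = g z"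
    and per2: "\<And>z. f (z + \<tau>) = e z * f z" "\<And>z. g (z + \<tau>) = e z * g z" and e: "\<And>z. e z \<noteq> 0"
    and a: "f a = 0" "g a = 0" "deriv g a \<noteq> 0"
    and zeros: "\<And>s t :: real. \<bar>s\<bar> \<le> 1/2 \<Longrightarrow> \<bar>t\<bar> \<le> 1/2 \<Longrightarrow> g (a + complex_of_real s + complex_of_real t * \<tau>) = 0 \<Longrightarrow> s = 0 \<and> t = 0"
  shows "\<exists>c. \<forall>z. f z = c * g z"
proof -
  define P where "P = (\<lambda>(s, t). a + complex_of_real s + complex_of_real t * \<tau>) ` ({-1/2..1/2} \<times> {-1/2..1/2})"
  have "compact P"
    unfolding P_def
    by (intro compact_continuous_image compact_Times)
       (auto intro!: continuous_intros simp: case_prod_unfold)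
  have loc: "\<exists>U C. open U \<and> z \<in> U \<and> C \<ge> 0 \<and> (\<forall>w\<in>U. norm (f w) \<le> C * norm (g w))" if z: "z \<in> P" for z
  proof -
    have df: "(f has_field_derivative deriv f z) (at z)" "(g has_field_derivative deriv g z) (at z)"
      using hol by (auto intro: holomorphic_derivI)
    have "\<exists>l. ((\<lambda>w. f w / g w) \<longlongrightarrow> l) (at z) \<and> (\<forall>\<^sub>F w in at z. g w \<noteq> 0) \<and> (g z = 0 \<longrightarrow> f z = 0)"
    proof (cases "g z = 0")
      case True
      from z obtain s t where "\<bar>s\<bar> \<le> 1/2" "\<bar>t\<bar> \<le> 1/2" "z = a + complex_of_real s + complex_of_real t * \<tau>"
        unfolding P_def abs_le_iff by (force simp: minus_le_iff)
      with zeros[of s t] True have "z = a" by simp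
      have "((\<lambda>w. (g w - g z) / (w - z)) \<longlongrightarrow> deriv g z) (at z)"
        using df(2) by (simp add: has_field_derivative_iff)
      then have "\<forall>\<^sub>F w in at z. (g w - g z) / (w - z) \<noteq> 0"
        using a(3) \<open>z = a\<close> tendsto_imp_eventually_ne by metis
      then have "\<forall>\<^sub>F w in at z. g w \<noteq> 0"
        using True by (auto elim: eventually_mono)
      then show ?thesis
        using lhopital_complex_simple[OF df] a \<open>z = a\<close> by auto
    next
      case False
      have "isCont f z" "isCont g z" using df DERIV_isCont by auto
      then have "((\<lambda>w. f w / g w) \<longlongrightarrow> f z / g z) (at z)"
        using False by (auto simp: isCont_def intro!: tendsto_intros)
      moreover have "\<forall>\<^sub>F w in at z. g w \<noteq> 0"
        using \<open>isCont g z\<close> False tendsto_imp_eventually_ne unfolding isCont_def by blast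
      ultimately show ?thesis using False by blast
    qed
    then obtain l where l: "((\<lambda>w. f w / g w) \<longlongrightarrow> l) (at z)" "\<forall>\<^sub>F w in at z. g w \<noteq> 0" "g z = 0 \<longrightarrow> f z = 0"
      by blast
    have "\<forall>\<^sub>F w in at z. norm (f w / g w) < norm l + 1"
      using order_tendstoD(2)[OF tendsto_norm[OF l(1)], of "norm l + 1"] by simp
    then have "\<forall>\<^sub>F w in at z. norm (f w) \<le> (norm l + 1) * norm (g w)"
      using l(2) by eventually_elim (simp add: norm_divide field_simps)
    then obtain U where U: "open U" "z \<in> U" "\<And>w. w \<in> U \<Longrightarrow> w \<noteq> z \<Longrightarrow> norm (f w) \<le> (norm l + 1) * norm (g w)"
      unfolding eventually_at_topological by blast
    \<comment> \<open>The last summand covers w = z, which the punctured neighbourhood leaves out;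
      if g z = 0 then this summand is 0, and f z = 0 as well.\<close>
    define C where "C = norm l + 1 + norm (f z) / norm (g z)"
    have "norm (f w) \<le> C * norm (g w)" if "w \<in> U" for w
    proof (cases "w = z")
      case True
      then show ?thesis using l(3) by (cases "g z = 0") (auto simp: C_def field_simps)
    next
      case False
      have "norm (f w) \<le> (norm l + 1) * norm (g w)" using U that False by blast
      also have "\<dots> \<le> C * norm (g w)" by (intro mult_right_mono) (auto simp: C_def)
      finally show ?thesis .
    qed
    moreover have "C \<ge> 0" by (auto simp: C_def)
    ultimately show ?thesis using U by blast
  qed
  then obtain U B where UB: "\<And>z. z \<in> P \<Longrightarrow> open (U z) \<and> z \<in> U z \<and> B z \<ge> (0::real) \<and>
      (\<forall>w\<in>U z. norm (f w) \<le> B z * norm (g w))"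
    by metis
  obtain F where F: "F \<subseteq> P" "finite F" "P \<subseteq> (\<Union>z\<in>F. U z)"
    using compactE_image[OF \<open>compact P\<close>, of P U] UB by blast
  define C where "C = (\<Sum>z\<in>F. B z)"
  have leP: "norm (f w) \<le> C * norm (g w)" if w: "w \<in> P" for w
  proof -
    obtain z where z: "z \<in> F" "w \<in> U z" using F w by blast
    have "norm (f w) \<le> B z * norm (g w)" using UB z F by blast
    also have "B z \<le> C" unfolding C_def using z F UB by (intro member_le_sum) auto
    finally show ?thesis by (simp add: mult_right_mono)
  qed
  \<comment> \<open>Invariance of \<open>Q\<close> under the lattice carries it from
    \<open>P\<close> to the whole plane.\<close>
  define Q where "Q = (\<lambda>w. norm (f w) \<le> C * norm (g w))"
  have Q1: "Q (w + 1) \<longleftrightarrow> Q w" for w by (simp add: Q_def per1)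
  have Q2: "Q (w + \<tau>) \<longleftrightarrow> Q w" for w using e by (simp add: Q_def per2 norm_mult)
  have Q1': "Q (w + of_int m) \<longleftrightarrow> Q w" for w m
  proof (induction m rule: int_induct[where k = 0])
    case (step1 i)
    then show ?case using Q1[of "w + of_int i"] by (simp add: add_ac)
  next
    case (step2 i)
    then show ?case using Q1[of "w + of_int (i - 1)"] by (simp add: add_ac)
  qed auto
  have Q2': "Q (w + of_int m * \<tau>) \<longleftrightarrow> Q w" for w m
  proof (induction m rule: int_induct[where k = 0])
    case (step1 i)
    then show ?case using Q2[of "w + of_int i * \<tau>"] by (simp add: algebra_simps)
  next
    case (step2 i)
    then show ?case using Q2[of "w + of_int (i - 1) * \<tau>"] by (simp add: algebra_simps)
  qed auto
  have "Q z" for z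
  proof -
    \<comment> \<open>Real coordinates of z - a in the basis 1, \<tau>; rounding them moves z into
      \<open>P\<close>.\<close>
    define t where "t = Im (z - a) / Im \<tau>"
    define s where "s = Re (z - a) - t * Re \<tau>"
    have z: "z = a + of_real s + of_real t * \<tau>"
      using \<tau> by (auto simp: complex_eq_iff s_def t_def)
    define w where "w = a + complex_of_real (s - round s) + complex_of_real (t - round t) * \<tau>"
    have "w \<in> P"
      unfolding P_def w_def
      by (rule image_eqI[of _ _ "(s - round s, t - round t)"])
         (use of_int_round_abs_le[of s] of_int_round_abs_le[of t] in
           \<open>simp_all add: abs_le_iff, linarith\<close>)
    then have "Q w" using leP by (simp add: Q_def)
    then have "Q (w + of_int (round s) + of_int (round t) * \<tau>)" by (simp add: Q1' Q2')
    moreover have "w + of_int (round s) + of_int (round t) * \<tau> = z"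
      by (simp add: w_def z algebra_simps)
    ultimately show ?thesis by simp
  qed
  then show ?thesis
    by (intro entire_bounded_ratio[OF hol]) (auto simp: Q_def)
qed

section \<open>Theta as a two-sided product: quasi-periods, zeros, inversion\<close>

definition theta_prod :: "complex \<Rightarrow> complex \<Rightarrow> complex" where
  "theta_prod q w = qpoch (q\<^sup>2) (q * w) * qpoch (q\<^sup>2) (q / w)"

text \<open>Replacing w by q^2 w removes the factor 1 + q w from one product and adds 1 + 1 / (q w)
  to the other.\<close>

lemma theta_prod_shift:
  assumes "norm q < 1" "q \<noteq> 0" "w \<noteq> 0"
  shows "theta_prod q (q\<^sup>2 * w) * (q * w) = theta_prod q w"
proof -
  note q2 = norm_power2_less_1[OF assms(1)]
  have "qpoch (q\<^sup>2) (q * w) = (1 + q * w) * qpoch (q\<^sup>2) (q * (q\<^sup>2 * w))"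
    by (subst qpoch_rec[OF q2]) (simp add: mult_ac)
  moreover have "qpoch (q\<^sup>2) (q / (q\<^sup>2 * w)) = (1 + q / (q\<^sup>2 * w)) * qpoch (q\<^sup>2) (q / w)"
    by (subst qpoch_rec[OF q2]) (use assms in simp)
  moreover have "(1 + q / (q\<^sup>2 * w)) * (q * w) = 1 + q * w"
    using assms by (simp add: field_simps power2_eq_square)
  ultimately show ?thesis by (simp add: theta_prod_def)
qed

lemma theta_prod_1: "theta_prod q 1 = odd_prod (- q) ^ 2"
  and theta_prod_minus_1: "theta_prod q (- 1) = odd_prod q ^ 2"
  by (simp_all add: theta_prod_def odd_prod_def power2_eq_square)

text \<open>At w = q the second product starts with 1 + 1, and Euler's identity evaluates the
  remaining factors.\<close>

lemma theta_prod_self: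
  assumes "norm q < 1" "q \<noteq> 0"
  shows "theta_prod q q * odd_prod (q\<^sup>2) ^ 2 = 2"
proof -
  have "qpoch (q\<^sup>2) 1 = 2 * qpoch (q\<^sup>2) (q\<^sup>2)"
    by (subst qpoch_rec) (use assms norm_power2_less_1 in auto)
  then have "theta_prod q q = 2 * qpoch (q\<^sup>2) (q\<^sup>2) ^ 2"
    using assms by (simp add: theta_prod_def power2_eq_square)
  then have "theta_prod q q * odd_prod (q\<^sup>2) ^ 2 = 2 * (qpoch (q\<^sup>2) (q\<^sup>2) * odd_prod (q\<^sup>2)) ^ 2"
    by (simp add: power_mult_distrib)
  then show ?thesis using qpoch_square_odd_prod[OF assms(1)] by simp
qed

definition nome :: "complex \<Rightarrow> complex" where
  "nome \<tau> = exp (\<i> * of_real pi * \<tau>)"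

lemma nome_nonzero [simp]: "nome \<tau> \<noteq> 0"
  by (simp add: nome_def)

lemma norm_nome: "norm (nome \<tau>) = exp (- pi * Im \<tau>)"
  by (simp add: nome_def)

lemma norm_nome_less_1: "Im \<tau> > 0 \<Longrightarrow> norm (nome \<tau>) < 1"
  by (simp add: norm_nome)

lemma nome_power: "nome \<tau> ^ n = exp (\<i> * of_real pi * \<tau> * of_nat n)"
  by (simp only: nome_def exp_of_nat2_mult)

lemma exp_eq_minus_1D:
  assumes "exp (\<i> * of_real pi * z) = -1"
  shows "\<exists>k::int. z = 2 * of_int k + 1"
proof -
  have "exp (\<i> * of_real pi * z) = exp (\<i> * of_real pi)" using assms by simp
  then obtain k :: int where "\<i> * of_real pi * z = \<i> * of_real pi + (of_int (2 * k) * pi) * \<i>"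
    using exp_eq by blast
  then have "(\<i> * of_real pi) * z = (\<i> * of_real pi) * (2 * of_int k + 1)"
    by (simp add: algebra_simps)
  then have "z = 2 * of_int k + 1"
    by (subst (asm) mult_left_cancel) auto
  then show ?thesis by blast
qed

text \<open>The Jacobi function \<theta>_3 in the variable z, without the product of all 1 - q^(2 n)
  from the triple product; that factor does not depend on z.\<close>

definition theta :: "complex \<Rightarrow> complex \<Rightarrow> complex" where
  "theta \<tau> z = theta_prod (nome \<tau>) (exp (2 * \<i> * of_real pi * z))"

lemma theta_add_1: "theta \<tau> (z + 1) = theta \<tau> z"
  by (simp add: theta_def algebra_simps exp_add)

lemma theta_minus: "theta \<tau> (- z) = theta \<tau> z"
  by (simp add: theta_def theta_prod_def exp_minus divide_inverse mult.commute)

lemma theta_add_tau: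
  assumes "Im \<tau> > 0"
  shows "theta \<tau> (z + \<tau>) = inverse (nome \<tau> * exp (2 * \<i> * of_real pi * z)) * theta \<tau> z"
proof -
  have "exp (2 * \<i> * of_real pi * (z + \<tau>)) = (nome \<tau>)\<^sup>2 * exp (2 * \<i> * of_real pi * z)"
    unfolding nome_power exp_add [symmetric]
    by (rule arg_cong[of _ _ exp]) (simp add: algebra_simps)
  moreover have "theta_prod (nome \<tau>) ((nome \<tau>)\<^sup>2 * w) = theta_prod (nome \<tau>) w / (nome \<tau> * w)"
    if "w \<noteq> 0" for w
    by (rule eq_divide_imp[OF _ theta_prod_shift[OF norm_nome_less_1[OF assms]]]) (use that in auto)
  ultimately show ?thesis
    unfolding theta_def by (metis exp_not_eq_zero divide_inverse mult.commute)
qed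

lemma holomorphic_on_theta:
  assumes "Im \<tau> > 0"
  shows "theta \<tau> holomorphic_on S"
proof -
  have *: "(\<lambda>z. qpoch ((nome \<tau>)\<^sup>2) (h z)) holomorphic_on S" if "h holomorphic_on S" for h
    using holomorphic_on_compose[OF that holomorphic_on_qpoch]
      norm_power2_less_1[OF norm_nome_less_1[OF assms]] by (auto simp: o_def)
  show ?thesis
    unfolding theta_def[abs_def] theta_prod_def by (intro holomorphic_intros *) auto
qed

lemma qpoch_nome_eq_0D:
  assumes "Im \<tau> > 0" "qpoch ((nome \<tau>)\<^sup>2) (nome \<tau> * exp (2 * \<i> * of_real pi * z)) = 0"
  shows "\<exists>(n::nat) (k::int). (2 * of_nat n + 1) * \<tau> + 2 * z = 2 * of_int k + 1"
proof -
  obtain n where n: "1 + nome \<tau> * exp (2 * \<i> * of_real pi * z) * ((nome \<tau>)\<^sup>2) ^ n = 0"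
    using assms qpoch_nonzero norm_power2_less_1 norm_nome_less_1 by metis
  have "nome \<tau> * exp (2 * \<i> * of_real pi * z) * ((nome \<tau>)\<^sup>2) ^ n =
      exp (\<i> * of_real pi * ((2 * of_nat n + 1) * \<tau> + 2 * z))"
    unfolding power_mult [symmetric] unfolding nome_power unfolding nome_def exp_add [symmetric]
    by (rule arg_cong[of _ _ exp]) (simp add: algebra_simps)
  then have "exp (\<i> * of_real pi * ((2 * of_nat n + 1) * \<tau> + 2 * z)) = -1"
    using n by (metis add_eq_0_iff)
  then show ?thesis using exp_eq_minus_1D by blast
qed

lemma theta_zero:
  fixes s t :: real and \<tau> :: complex
  assumes \<tau>: "Im \<tau> > 0" and st: "\<bar>s\<bar> \<le> 1/2" "\<bar>t\<bar> \<le> 1/2" and 0: "theta \<tau> ((1 + \<tau>) / 2 + complex_of_real s + complex_of_real t * \<tau>) = 0"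
  shows "s = 0 \<and> t = 0"
proof -
  define z where "z = (1 + \<tau>) / 2 + complex_of_real s + complex_of_real t * \<tau>"
  have "qpoch ((nome \<tau>)\<^sup>2) (nome \<tau> * exp (2 * \<i> * of_real pi * z)) = 0 \<or>
      qpoch ((nome \<tau>)\<^sup>2) (nome \<tau> * exp (2 * \<i> * of_real pi * (- z))) = 0"
    using 0 [folded z_def] by (simp add: theta_def theta_prod_def exp_minus divide_inverse)
  then obtain n :: nat and k :: int where
    "(2 * of_nat n + 1) * \<tau> + 2 * z = 2 * of_int k + 1 \<or> (2 * of_nat n + 1) * \<tau> + 2 * (- z) = 2 * of_int k + 1"
    using qpoch_nome_eq_0D[OF \<tau>] by blast
  then show ?thesis
  proof
    \<comment> \<open>A factor of the first product would force t = - n - 1 by imaginary parts,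
      outside the parallelogram.\<close>
    assume *: "(2 * of_nat n + 1) * \<tau> + 2 * z = 2 * of_int k + 1"
    have "(2 * real n + 2 + 2 * t) * Im \<tau> = 0"
      using arg_cong[OF *, of Im] by (simp add: z_def algebra_simps)
    then have "2 * real n + 2 + 2 * t = 0" using \<tau> by simp
    moreover have "t \<ge> -1/2" using st by linarith
    ultimately show ?thesis using of_nat_0_le_iff[of n] by linarith
  next
    \<comment> \<open>For the second product imaginary parts give t = n, hence t = 0, and real parts
      make s an integer of absolute value below 1.\<close>
    assume *: "(2 * of_nat n + 1) * \<tau> + 2 * (- z) = 2 * of_int k + 1"
    have "(2 * real n - 2 * t) * Im \<tau> = 0"
      using arg_cong[OF *, of Im] by (simp add: z_def algebra_simps)
    then have t: "real n = t" using \<tau> by simp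
    have n: "n = 0" using t st by linarith
    have "- 1 - 2 * s = 2 * of_int k + 1"
      using arg_cong[OF *, of Re] t n by (simp add: z_def field_simps)
    then have "s = of_int (- 1 - k)" by simp
    moreover have "\<bar>of_int (- 1 - k) :: real\<bar> < 1" using st calculation by linarith
    then have "- 1 - k = 0" by linarith
    ultimately show ?thesis using t n by simp
  qed
qed

text \<open>The factor 1 + q / w vanishes at w = - q and the cofactor \<open>r\<close> does not. So
  the derivative at the zero is the derivative of that factor times \<open>r\<close>.\<close>

lemma theta_zero_simple:
  assumes \<tau>: "Im \<tau> > 0"
  shows "theta \<tau> ((1 + \<tau>) / 2) = 0" "deriv (theta \<tau>) ((1 + \<tau>) / 2) \<noteq> 0"
proof -
  define q where "q = nome \<tau>"
  define z0 where "z0 = (1 + \<tau>) / 2"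
  define r where "r = (\<lambda>z. qpoch (q\<^sup>2) (q * exp (2 * \<i> * of_real pi * z)) * qpoch (q\<^sup>2) (q\<^sup>2 * (q / exp (2 * \<i> * of_real pi * z))))"
  have q2: "norm (q\<^sup>2) < 1" using \<tau> by (simp add: q_def norm_nome_less_1 norm_power2_less_1)
  have "exp (2 * \<i> * of_real pi * z0) = exp (\<i> * of_real pi + \<i> * of_real pi * \<tau>)"
    by (rule arg_cong[of _ _ exp]) (simp add: z0_def field_simps)
  then have w0: "exp (2 * \<i> * of_real pi * z0) = - q"
    by (simp add: q_def nome_def exp_add)
  have eq: "theta \<tau> = (\<lambda>z. (1 + q * exp (- 2 * \<i> * of_real pi * z)) * r z)"
  proof
    fix z
    show "theta \<tau> z = (1 + q * exp (- 2 * \<i> * of_real pi * z)) * r z"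
      unfolding theta_def theta_prod_def q_def [symmetric] r_def
      by (subst (2) qpoch_rec[OF q2]) (simp add: exp_minus field_simps)
  qed
  have e0: "q * exp (- 2 * \<i> * of_real pi * z0) = - 1"
    using w0 by (simp add: exp_minus q_def)
  show "theta \<tau> z0 = 0" using e0 by (simp add: eq)
  have "r z0 = qpoch (q\<^sup>2) (- (q\<^sup>2)) ^ 2"
    using w0 by (simp add: r_def power2_eq_square q_def)
  then have r0: "r z0 \<noteq> 0" using qpoch_nonzero'[OF q2, of "- (q\<^sup>2)"] q2 by simp
  have *: "(\<lambda>z. qpoch (q\<^sup>2) (h z)) holomorphic_on UNIV" if "h holomorphic_on UNIV" for h
    using holomorphic_on_compose[OF that holomorphic_on_qpoch[OF q2]] by (auto simp: o_def)
  have "r holomorphic_on UNIV"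
    unfolding r_def by (intro holomorphic_intros *) auto
  then have dr: "(r has_field_derivative deriv r z0) (at z0)"
    by (auto intro: holomorphic_derivI)
  have "(theta \<tau> has_field_derivative
      (1 + q * exp (- 2 * \<i> * of_real pi * z0)) * deriv r z0 +
      q * (exp (- 2 * \<i> * of_real pi * z0) * (- 2 * \<i> * of_real pi)) * r z0) (at z0)"
    unfolding eq by (rule derivative_eq_intros dr refl | simp)+
  from DERIV_imp_deriv[OF this]
  have "deriv (theta \<tau>) z0 = 2 * \<i> * of_real pi * r z0"
    unfolding mult.assoc [of q, symmetric] mult.assoc [of "q * _", symmetric] e0 by simp
  then show "deriv (theta \<tau>) z0 \<noteq> 0" using r0 by simp
qed

text \<open>Jacobi's inversion formula with its constant left open. Passing to z / \<tau> exchanges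
  the roles of the period and the quasi-period, and the Gaussian factor restores the multipliers of
  \<open>theta\<close> \<tau>.\<close>

lemma theta_modular:
  assumes \<tau>: "Im \<tau> > 0"
  shows "\<exists>c. \<forall>z. theta (- 1 / \<tau>) (z / \<tau>) * exp (- (\<i> * of_real pi * z\<^sup>2 / \<tau>)) = c * theta \<tau> z"
proof (rule quasi_periodic_proportional[OF \<tau>, where a = "(1 + \<tau>) / 2" and
      e = "\<lambda>z. inverse (nome \<tau> * exp (2 * \<i> * of_real pi * z))"])
  define \<tau>' where "\<tau>' = - 1 / \<tau>"
  have [simp]: "\<tau> \<noteq> 0" using \<tau> by auto
  have "Im \<tau>' = Im \<tau> / (norm \<tau>)\<^sup>2" by (simp add: \<tau>'_def Im_divide cmod_power2)
  then have \<tau>': "Im \<tau>' > 0" using \<tau> by simp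
  show "theta \<tau> holomorphic_on UNIV" by (rule holomorphic_on_theta[OF \<tau>])
  have "(\<lambda>z. z / \<tau>) holomorphic_on UNIV"
    by (auto intro!: holomorphic_intros)
  then have "(\<lambda>z. theta \<tau>' (z / \<tau>)) holomorphic_on UNIV"
    using holomorphic_on_compose[of "\<lambda>z. z / \<tau>" UNIV "theta \<tau>'", OF _ holomorphic_on_theta[OF \<tau>']]
    unfolding o_def by simp
  then show "(\<lambda>z. theta (- 1 / \<tau>) (z / \<tau>) * exp (- (\<i> * of_real pi * z\<^sup>2 / \<tau>))) holomorphic_on UNIV"
    by (auto intro!: holomorphic_intros simp: \<tau>'_def)
  show "theta \<tau> (z + 1) = theta \<tau> z" for z by (rule theta_add_1)
  show "theta \<tau> (z + \<tau>) = inverse (nome \<tau> * exp (2 * \<i> * of_real pi * z)) * theta \<tau> z" for z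
    by (rule theta_add_tau[OF \<tau>])
  show "s = 0 \<and> t = 0" if "\<bar>s\<bar> \<le> 1/2" "\<bar>t\<bar> \<le> 1/2" "theta \<tau> ((1 + \<tau>) / 2 + complex_of_real s + complex_of_real t * \<tau>) = 0" for s t :: real
    using theta_zero[OF \<tau> that] .
  show "theta \<tau> ((1 + \<tau>) / 2) = 0" "deriv (theta \<tau>) ((1 + \<tau>) / 2) \<noteq> 0"
    using theta_zero_simple[OF \<tau>] by auto
  show "inverse (nome \<tau> * exp (2 * \<i> * of_real pi * z)) \<noteq> 0" for z by simp
  show "theta (- 1 / \<tau>) ((z + \<tau>) / \<tau>) * exp (- (\<i> * of_real pi * (z + \<tau>)\<^sup>2 / \<tau>)) =
      inverse (nome \<tau> * exp (2 * \<i> * of_real pi * z)) *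
      (theta (- 1 / \<tau>) (z / \<tau>) * exp (- (\<i> * of_real pi * z\<^sup>2 / \<tau>)))" for z
  proof -
    have "(z + \<tau>) / \<tau> = z / \<tau> + 1" by (simp add: field_simps)
    moreover have "exp (- (\<i> * of_real pi * (z + \<tau>)\<^sup>2 / \<tau>)) =
        inverse (nome \<tau> * exp (2 * \<i> * of_real pi * z)) * exp (- (\<i> * of_real pi * z\<^sup>2 / \<tau>))"
      unfolding nome_def exp_add [symmetric] exp_minus [symmetric]
      by (rule arg_cong[of _ _ exp]) (simp add: field_simps power2_eq_square)
    ultimately show ?thesis
      by (simp add: theta_add_1)
  qed
  show "theta (- 1 / \<tau>) ((z + 1) / \<tau>) * exp (- (\<i> * of_real pi * (z + 1)\<^sup>2 / \<tau>)) =
      theta (- 1 / \<tau>) (z / \<tau>) * exp (- (\<i> * of_real pi * z\<^sup>2 / \<tau>))" for z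
  proof -
    define X where "X = nome \<tau>' * exp (2 * \<i> * of_real pi * ((z + 1) / \<tau>))"
    have "(z + 1) / \<tau> + \<tau>' = z / \<tau>" by (simp add: \<tau>'_def field_simps)
    then have "theta \<tau>' (z / \<tau>) = inverse X * theta \<tau>' ((z + 1) / \<tau>)"
      using theta_add_tau[OF \<tau>', of "(z + 1) / \<tau>"] by (simp only: X_def)
    moreover have "X \<noteq> 0" by (simp add: X_def)
    ultimately have "theta \<tau>' ((z + 1) / \<tau>) = X * theta \<tau>' (z / \<tau>)"
      by simp
    moreover have "X * exp (- (\<i> * of_real pi * (z + 1)\<^sup>2 / \<tau>)) = exp (- (\<i> * of_real pi * z\<^sup>2 / \<tau>))"
      unfolding X_def nome_def exp_add [symmetric]
      by (rule arg_cong[of _ _ exp])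
         (simp add: \<tau>'_def add_divide_distrib diff_divide_distrib power2_eq_square algebra_simps)
    ultimately show ?thesis
      unfolding \<tau>'_def [symmetric] by (metis mult.assoc mult.commute)
  qed
  show "theta (- 1 / \<tau>) ((1 + \<tau>) / 2 / \<tau>) * exp (- (\<i> * of_real pi * ((1 + \<tau>) / 2)\<^sup>2 / \<tau>)) = 0"
  proof -
    have q2: "norm ((nome \<tau>')\<^sup>2) < 1" using \<tau>' by (simp add: norm_nome_less_1 norm_power2_less_1)
    \<comment> \<open>The point (1 + \<tau>) / (2 \<tau>) equals (1 - \<tau>') / 2, again a zero of
      theta: the first factor of one product is 1 - 1.\<close>
    have "nome \<tau>' * exp (2 * \<i> * of_real pi * ((1 + \<tau>) / 2 / \<tau>)) = exp (\<i> * of_real pi)"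
      unfolding nome_def exp_add [symmetric]
      by (rule arg_cong[of _ _ exp]) (simp add: field_simps \<tau>'_def)
    then have "theta \<tau>' ((1 + \<tau>) / 2 / \<tau>) = 0"
      unfolding theta_def theta_prod_def by (simp add: qpoch_rec[OF q2, of "-1"])
    then show ?thesis by (simp add: \<tau>'_def)
  qed
qed

section \<open>The Weber functions\<close>

lemma dedekind_eta_eq:
  "dedekind_eta \<tau> = exp (\<i> * of_real pi * \<tau> / 12) * euler_prod ((nome \<tau>)\<^sup>2)"
proof -
  have "exp (2 * of_real pi * \<i> * \<tau>) = (nome \<tau>)\<^sup>2"
    unfolding nome_power by (rule arg_cong[of _ _ exp]) simp
  moreover have "2 * of_real pi * \<i> * \<tau> / 24 = \<i> * of_real pi * \<tau> / 12" by simp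
  ultimately show ?thesis unfolding dedekind_eta_def euler_prod_def by (simp only:)
qed

lemma nome_add_1: "nome (\<tau> + 1) = - nome \<tau>"
  by (simp add: nome_def distrib_left exp_add)

lemma nome_half_square: "(nome (\<tau> / 2))\<^sup>2 = nome \<tau>"
  unfolding nome_power unfolding nome_def by (rule arg_cong[of _ _ exp]) simp

lemma euler_prod_nome_nonzero: "Im \<tau> > 0 \<Longrightarrow> euler_prod ((nome \<tau>)\<^sup>2) \<noteq> 0"
  by (intro euler_prod_nonzero norm_power2_less_1 norm_nome_less_1)

lemma cancel_factor:
  fixes x :: complex
  assumes "x \<noteq> 0"
  shows "a * (y * x) / (b * x) = a * inverse b * y"
  using assms by (simp add: divide_inverse)

text \<open>With q the nome, the Euler product at - q is (- q; q^2) times the Euler product at q^2,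
  which cancels against the denominator. The constant \<open>zeta_root 48\<close> absorbs the shift
  by 1 in (\<tau> + 1) / 2.\<close>

lemma weber_f_eq:
  assumes "Im \<tau> > 0"
  shows "weber_f \<tau> = exp (- (\<i> * of_real pi * \<tau> / 24)) * odd_prod (- nome \<tau>)"
proof -
  have nz: "euler_prod ((nome \<tau>)\<^sup>2) \<noteq> 0" using euler_prod_nome_nonzero[OF assms] .
  have "(nome ((\<tau> + 1) / 2))\<^sup>2 = - nome \<tau>"
    using nome_half_square[of "\<tau> + 1"] nome_add_1[of \<tau>] by simp
  moreover have "euler_prod (- nome \<tau>) = odd_prod (- nome \<tau>) * euler_prod ((nome \<tau>)\<^sup>2)"
    using euler_prod_split[of "- nome \<tau>"] norm_nome_less_1[OF assms] by simp
  ultimately have "weber_f \<tau> = inverse (zeta_root 48) * exp (\<i> * of_real pi * ((\<tau> + 1) / 2) / 12) *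
      inverse (exp (\<i> * of_real pi * \<tau> / 12)) * odd_prod (- nome \<tau>)"
    unfolding weber_f_def dedekind_eta_eq by (simp only: cancel_factor[OF nz] mult.assoc)
  also have "inverse (zeta_root 48) * exp (\<i> * of_real pi * ((\<tau> + 1) / 2) / 12) *
      inverse (exp (\<i> * of_real pi * \<tau> / 12)) = exp (- (\<i> * of_real pi * \<tau> / 24))"
    unfolding zeta_root_def exp_minus [symmetric] exp_add [symmetric]
    by (rule arg_cong[of _ _ exp]) (simp add: field_simps)
  finally show ?thesis .
qed

lemma weber_f1_eq:
  assumes "Im \<tau> > 0"
  shows "weber_f1 \<tau> = exp (- (\<i> * of_real pi * \<tau> / 24)) * odd_prod (nome \<tau>)"
proof -
  have nz: "euler_prod ((nome \<tau>)\<^sup>2) \<noteq> 0" using euler_prod_nome_nonzero[OF assms] .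
  have "weber_f1 \<tau> = exp (\<i> * of_real pi * (\<tau> / 2) / 12) *
      inverse (exp (\<i> * of_real pi * \<tau> / 12)) * odd_prod (nome \<tau>)"
    unfolding weber_f1_def dedekind_eta_eq nome_half_square
      euler_prod_split[OF norm_nome_less_1[OF assms]]
    by (simp only: cancel_factor[OF nz])
  also have "exp (\<i> * of_real pi * (\<tau> / 2) / 12) *
      inverse (exp (\<i> * of_real pi * \<tau> / 12)) = exp (- (\<i> * of_real pi * \<tau> / 24))"
    unfolding exp_minus [symmetric] exp_add [symmetric]
    by (rule arg_cong[of _ _ exp]) (simp add: field_simps)
  finally show ?thesis .
qed

lemma weber_f2_eq:
  assumes "Im \<tau> > 0"
  shows "weber_f2 \<tau> = of_real (sqrt 2) * exp (\<i> * of_real pi * \<tau> / 12) / odd_prod ((nome \<tau>)\<^sup>2)"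
proof -
  have n2: "nome (2 * \<tau>) = (nome \<tau>)\<^sup>2"
    unfolding nome_power unfolding nome_def by (rule arg_cong[of _ _ exp]) simp
  have q2: "norm ((nome \<tau>)\<^sup>2) < 1" by (intro norm_power2_less_1 norm_nome_less_1 assms)
  have nz: "euler_prod ((nome \<tau>)\<^sup>2) \<noteq> 0" "odd_prod ((nome \<tau>)\<^sup>2) \<noteq> 0"
    by (rule euler_prod_nonzero[OF q2], rule odd_prod_nonzero[OF q2])
  have "euler_prod (((nome \<tau>)\<^sup>2)\<^sup>2) = inverse (odd_prod ((nome \<tau>)\<^sup>2)) * euler_prod ((nome \<tau>)\<^sup>2)"
    using euler_prod_split[OF q2] nz by simp
  then have "weber_f2 \<tau> = of_real (sqrt 2) * (exp (\<i> * of_real pi * (2 * \<tau>) / 12) *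
      inverse (exp (\<i> * of_real pi * \<tau> / 12)) * inverse (odd_prod ((nome \<tau>)\<^sup>2)))"
    unfolding weber_f2_def dedekind_eta_eq n2 by (simp only: cancel_factor[OF nz(1)])
  also have "exp (\<i> * of_real pi * (2 * \<tau>) / 12) *
      inverse (exp (\<i> * of_real pi * \<tau> / 12)) = exp (\<i> * of_real pi * \<tau> / 12)"
    unfolding exp_minus [symmetric] exp_add [symmetric]
    by (rule arg_cong[of _ _ exp]) (simp add: field_simps)
  finally show ?thesis by (simp only: divide_inverse mult.assoc)
qed

section \<open>Eighth powers, expressed by a cube root of the nome, under T and S\<close>

definition nome3 :: "complex \<Rightarrow> complex" where
  "nome3 \<tau> = exp (\<i> * of_real pi * \<tau> / 3)"

lemma nome3_nonzero [simp]: "nome3 \<tau> \<noteq> 0"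
  by (simp add: nome3_def)

lemma nome3_cubed: "nome3 \<tau> ^ 3 = nome \<tau>"
  by (simp add: nome3_def nome_def flip: exp_of_nat_mult)

lemma weber_u0_power8:
  assumes "Im \<tau> > 0"
  shows "weber_u0 \<tau> ^ 8 = odd_prod (- nome \<tau>) ^ 8 / nome3 \<tau>"
proof -
  have "exp (- (\<i> * of_real pi * \<tau> / 24)) ^ 8 = inverse (nome3 \<tau>)"
    unfolding nome3_def exp_minus [symmetric] exp_of_nat_mult [symmetric]
    by (rule arg_cong[of _ _ exp]) simp
  then show ?thesis
    unfolding weber_u0_def weber_f_eq[OF assms] power_mult_distrib
    by (simp only: divide_inverse mult.commute)
qed

lemma zeta_root_16_power8: "zeta_root 16 ^ 8 = - 1"
proof -
  have "zeta_root 16 ^ 8 = exp (\<i> * of_real pi)"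
    unfolding zeta_root_def exp_of_nat_mult [symmetric]
    by (rule arg_cong[of _ _ exp]) simp
  then show ?thesis by simp
qed

lemma weber_u1_power8:
  assumes "Im \<tau> > 0"
  shows "weber_u1 \<tau> ^ 8 = - (odd_prod (nome \<tau>) ^ 8 / nome3 \<tau>)"
proof -
  have "exp (- (\<i> * of_real pi * \<tau> / 24)) ^ 8 = inverse (nome3 \<tau>)"
    unfolding nome3_def exp_minus [symmetric] exp_of_nat_mult [symmetric]
    by (rule arg_cong[of _ _ exp]) simp
  then show ?thesis
    unfolding weber_u1_def weber_f1_eq[OF assms] power_mult_distrib zeta_root_16_power8
    by (simp only: divide_inverse mult_minus1 mult.commute)
qed

lemma weber_u2_power8:
  assumes "Im \<tau> > 0"
  shows "weber_u2 \<tau> ^ 8 = - 16 * nome3 \<tau> ^ 2 / odd_prod ((nome \<tau>)\<^sup>2) ^ 8"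
proof -
  have "exp (\<i> * of_real pi * \<tau> / 12) ^ 8 = nome3 \<tau> ^ 2"
    unfolding nome3_def exp_minus [symmetric] exp_of_nat_mult [symmetric]
    by (rule arg_cong[of _ _ exp]) simp
  moreover have "complex_of_real (sqrt 2) ^ 8 = 16"
  proof -
    have "sqrt 2 ^ 8 = (sqrt 2 ^ 2) ^ 4" by (subst power_mult [symmetric]) simp
    then have "sqrt 2 ^ 8 = 16" by simp
    then show ?thesis by (metis of_real_numeral of_real_power)
  qed
  ultimately show ?thesis
    unfolding weber_u2_def weber_f2_eq[OF assms] power_mult_distrib power_divide
      power_inverse zeta_root_16_power8
    by simp
qed

text \<open>The pair (c, d) modulo 2 is a nonzero row vector: (1, 1), (1, 0), (0, 1) stand for
  \<open>weber_u0\<close>, \<open>weber_u1\<close>, \<open>weber_u2\<close>, and SL2 over the field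
  with two elements permutes these vectors. For c and d both even the value is a default; hence the
  condition \<open>odd c \<or> odd d\<close> in the transformation laws below.\<close>

definition weber8 :: "int \<Rightarrow> int \<Rightarrow> complex \<Rightarrow> complex" where
  "weber8 c d \<tau> = (if even c then weber_u2 \<tau> else if even d then weber_u1 \<tau> else weber_u0 \<tau>) ^ 8"

lemma weber8_cong: "even (c - c') \<Longrightarrow> even (d - d') \<Longrightarrow> weber8 c d = weber8 c' d'"
  by (auto simp: weber8_def fun_eq_iff)

lemma weber8_nonzero: "Im \<tau> > 0 \<Longrightarrow> weber8 c d \<tau> \<noteq> 0"
proof -
  assume \<tau>: "Im \<tau> > 0"
  note q = norm_nome_less_1[OF \<tau>]
  have "odd_prod (- nome \<tau>) \<noteq> 0" "odd_prod (nome \<tau>) \<noteq> 0" "odd_prod ((nome \<tau>)\<^sup>2) \<noteq> 0"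
    using odd_prod_nonzero[of "- nome \<tau>"] odd_prod_nonzero[OF q]
      odd_prod_nonzero[OF norm_power2_less_1[OF q]] q by simp_all
  then have "weber_u0 \<tau> ^ 8 \<noteq> 0" "weber_u1 \<tau> ^ 8 \<noteq> 0" "weber_u2 \<tau> ^ 8 \<noteq> 0"
    unfolding weber_u0_power8[OF \<tau>] weber_u1_power8[OF \<tau>] weber_u2_power8[OF \<tau>] by simp_all
  then show ?thesis by (simp add: weber8_def)
qed

text \<open>The classical relation f f_1 f_2 = sqrt 2 in eighth powers, from (q; q^2) (- q; q^2) =
  (q^2; q^4). It later pins down the common factor in the law for S.\<close>

lemma weber_product:
  assumes "Im \<tau> > 0"
  shows "weber_u0 \<tau> ^ 8 * weber_u1 \<tau> ^ 8 * weber_u2 \<tau> ^ 8 = 16"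
proof -
  note q = norm_nome_less_1[OF assms]
  have "odd_prod (- nome \<tau>) ^ 8 * odd_prod (nome \<tau>) ^ 8 = odd_prod ((nome \<tau>)\<^sup>2) ^ 8"
    by (simp add: power_mult_distrib [symmetric] odd_prod_mult_minus[OF q, symmetric] mult.commute)
  moreover have "odd_prod ((nome \<tau>)\<^sup>2) \<noteq> 0"
    by (intro odd_prod_nonzero norm_power2_less_1 q)
  ultimately show ?thesis
    using assms by (simp add: weber_u0_power8 weber_u1_power8 weber_u2_power8 power2_eq_square)
qed

definition omega :: complex where "omega = exp (2 * \<i> * of_real pi / 3)"

lemma omega_cubed: "omega ^ 3 = 1"
proof -
  have "omega ^ 3 = exp (2 * of_real pi * \<i>)"
    unfolding omega_def exp_of_nat_mult [symmetric] by (rule arg_cong[of _ _ exp]) simp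
  then show ?thesis by simp
qed

text \<open>The nome changes sign, which exchanges the products of \<open>weber_u0\<close> and
  \<open>weber_u1\<close>; its cube root picks up exp (\<pi> i / 3) = - 1 / omega.\<close>

lemma weber8_add_1:
  assumes "Im \<tau> > 0"
  shows "weber8 c d (\<tau> + 1) = omega * weber8 c (c + d) \<tau>"
proof -
  have \<tau>1: "Im (\<tau> + 1) > 0" using assms by simp
  have "nome3 (\<tau> + 1) = nome3 \<tau> * exp (\<i> * of_real pi / 3)"
    unfolding nome3_def exp_add [symmetric] by (rule arg_cong[of _ _ exp]) (simp add: field_simps)
  moreover have "exp (\<i> * of_real pi / 3) * omega = -1"
  proof -
    have "exp (\<i> * of_real pi / 3) * omega = exp (\<i> * of_real pi)"
      unfolding omega_def exp_add [symmetric] by (rule arg_cong[of _ _ exp]) (simp add: field_simps)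
    then show ?thesis by simp
  qed
  then have "exp (\<i> * of_real pi / 3) = - 1 / omega"
    by (metis mult_zero_right nonzero_mult_div_cancel_right zero_neq_neg_one)
  ultimately have n3: "nome3 (\<tau> + 1) = - nome3 \<tau> / omega" by simp
  have o2: "1 / omega ^ 2 = omega" "omega \<noteq> 0"
    using omega_cubed by (auto simp: field_simps power3_eq_cube power2_eq_square omega_def)
  have sq: "(nome3 \<tau> / omega) ^ 2 = omega * nome3 \<tau> ^ 2"
    using arg_cong[OF o2(1), of "\<lambda>x. nome3 \<tau> ^ 2 * x"] by (simp add: power_divide mult.commute)
  show ?thesis
    using o2
    by (auto simp: weber8_def weber_u0_power8[OF assms] weber_u1_power8[OF assms] weber_u2_power8[OF assms]
       weber_u0_power8[OF \<tau>1] weber_u1_power8[OF \<tau>1] weber_u2_power8[OF \<tau>1] nome_add_1 n3 sq)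
qed

lemma Im_S: "Im (- 1 / \<tau>) = Im \<tau> / (norm \<tau>)\<^sup>2"
  by (simp add: Im_divide cmod_power2)

lemma Im_S_pos: "Im \<tau> > 0 \<Longrightarrow> Im (- 1 / \<tau>) > 0"
  unfolding Im_S by (intro divide_pos_pos) auto

text \<open>The points 0, 1/2 and \<tau>/2 are the half periods at which theta does not vanish;
  inversion permutes them up to sign and scaling.\<close>

lemma theta_values:
  assumes "Im \<tau> > 0"
  shows "theta \<tau> 0 ^ 4 = nome3 \<tau> * weber_u0 \<tau> ^ 8"
    and "theta \<tau> (1 / 2) ^ 4 = - nome3 \<tau> * weber_u1 \<tau> ^ 8"
    and "nome3 \<tau> ^ 2 * theta \<tau> (\<tau> / 2) ^ 4 = - (weber_u2 \<tau> ^ 8)"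
proof -
  have p: "(x ^ 2) ^ 4 = x ^ 8" for x :: complex
    by (simp flip: power_mult)
  show "theta \<tau> 0 ^ 4 = nome3 \<tau> * weber_u0 \<tau> ^ 8"
    by (simp add: theta_def theta_prod_1 weber_u0_power8[OF assms] p)
  have "exp (2 * \<i> * of_real pi * (1 / 2)) = -1" by simp
  then show "theta \<tau> (1 / 2) ^ 4 = - nome3 \<tau> * weber_u1 \<tau> ^ 8"
    unfolding theta_def by (simp only: theta_prod_minus_1 weber_u1_power8[OF assms] p) simp
  have q2: "odd_prod ((nome \<tau>)\<^sup>2) \<noteq> 0"
    by (intro odd_prod_nonzero norm_power2_less_1 norm_nome_less_1 assms)
  have "exp (2 * \<i> * of_real pi * (\<tau> / 2)) = nome \<tau>"
    unfolding nome_def by (rule arg_cong[of _ _ exp]) simp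
  then have "theta \<tau> (\<tau> / 2) = 2 / odd_prod ((nome \<tau>)\<^sup>2) ^ 2"
    unfolding theta_def using theta_prod_self[OF norm_nome_less_1[OF assms] nome_nonzero] q2
    by (simp add: field_simps)
  then show "nome3 \<tau> ^ 2 * theta \<tau> (\<tau> / 2) ^ 4 = - (weber_u2 \<tau> ^ 8)"
    by (simp add: weber_u2_power8[OF assms] power_divide p)
qed

text \<open>The inversion formula is read at z = 0, \<tau> / 2 and - 1 / 2, which division by \<tau>
  sends to half periods for - 1 / \<tau>. The unknown \<open>c\<close> enters all three values
  through the same \<open>k\<close>, and since the product of the three eighth powers is 16 at both
  points, k^3 = 1.\<close>

lemma weber8_S:
  assumes \<tau>: "Im \<tau> > 0"
  shows "\<exists>k. k ^ 3 = 1 \<and> (\<forall>c d. odd c \<or> odd d \<longrightarrow> weber8 c d (- 1 / \<tau>) = k * weber8 d (- c) \<tau>)"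
proof -
  have \<tau>0: "\<tau> \<noteq> 0" using \<tau> by auto
  define \<tau>' where "\<tau>' = - 1 / \<tau>"
  have \<tau>': "Im \<tau>' > 0" using Im_S_pos[OF \<tau>] by (simp add: \<tau>'_def)
  obtain c where c: "\<And>z. theta \<tau>' (z / \<tau>) * exp (- (\<i> * of_real pi * z\<^sup>2 / \<tau>)) = c * theta \<tau> z"
    using theta_modular[OF \<tau>] unfolding \<tau>'_def by blast
  define q where "q = nome3 \<tau>"
  define q' where "q' = nome3 \<tau>'"
  have q0: "q \<noteq> 0" "q' \<noteq> 0" by (simp_all add: q_def q'_def)
  have e: "exp (- (\<i> * of_real pi * z\<^sup>2 / \<tau>)) ^ 4 = exp (- (4 * \<i> * of_real pi * z\<^sup>2 / \<tau>))" for z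
    unfolding exp_of_nat_mult [symmetric] by (rule arg_cong[of _ _ exp]) simp
  have c4: "theta \<tau>' (z / \<tau>) ^ 4 * exp (- (4 * \<i> * of_real pi * z\<^sup>2 / \<tau>)) = c ^ 4 * theta \<tau> z ^ 4" for z
    using arg_cong[OF c[of z], of "\<lambda>x. x ^ 4"] by (simp only: power_mult_distrib e)
  define k where "k = c ^ 4 * q / q'"
  have 0: "weber_u0 \<tau>' ^ 8 = k * weber_u0 \<tau> ^ 8"
    using c4[of 0] q0 unfolding k_def
    by (simp add: theta_values[OF \<tau>] theta_values[OF \<tau>'] q_def [symmetric] q'_def [symmetric] field_simps)
  have 1: "weber_u1 \<tau>' ^ 8 = k * weber_u2 \<tau> ^ 8"
  proof -
    have "exp (- (4 * \<i> * of_real pi * (\<tau> / 2)\<^sup>2 / \<tau>)) = inverse (q ^ 3)"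
      unfolding q_def nome3_cubed nome_def exp_minus [symmetric]
      by (rule arg_cong[of _ _ exp]) (use \<tau>0 in \<open>simp add: power2_eq_square field_simps\<close>)
    moreover have "\<tau> / 2 / \<tau> = 1 / 2" using \<tau>0 by simp
    ultimately have "theta \<tau>' (1 / 2) ^ 4 * inverse (q ^ 3) = c ^ 4 * theta \<tau> (\<tau> / 2) ^ 4"
      using c4[of "\<tau> / 2"] by (simp only:)
    moreover have "theta \<tau> (\<tau> / 2) ^ 4 = - (weber_u2 \<tau> ^ 8) / q ^ 2"
      using theta_values(3)[OF \<tau>] q0 by (simp add: q_def field_simps)
    moreover have "theta \<tau>' (1 / 2) ^ 4 = - q' * weber_u1 \<tau>' ^ 8"
      using theta_values(2)[OF \<tau>'] by (simp add: q'_def)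
    ultimately have "- q' * weber_u1 \<tau>' ^ 8 * inverse (q ^ 3) = c ^ 4 * (- (weber_u2 \<tau> ^ 8) / q ^ 2)"
      by simp
    then show ?thesis using q0 unfolding k_def by (simp add: field_simps power2_eq_square power3_eq_cube)
  qed
  have 2: "weber_u2 \<tau>' ^ 8 = k * weber_u1 \<tau> ^ 8"
  proof -
    have "exp (- (4 * \<i> * of_real pi * (- 1 / 2)\<^sup>2 / \<tau>)) = q' ^ 3"
      unfolding q'_def nome3_cubed nome_def \<tau>'_def
      by (rule arg_cong[of _ _ exp]) (use \<tau>0 in \<open>simp add: power2_eq_square field_simps\<close>)
    moreover have "- 1 / 2 / \<tau> = \<tau>' / 2" using \<tau>0 by (simp add: \<tau>'_def)
    ultimately have "theta \<tau>' (\<tau>' / 2) ^ 4 * q' ^ 3 = c ^ 4 * theta \<tau> (- 1 / 2) ^ 4"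
      using c4[of "- 1 / 2"] by (simp only:)
    moreover have "theta \<tau>' (\<tau>' / 2) ^ 4 = - (weber_u2 \<tau>' ^ 8) / q' ^ 2"
      using theta_values(3)[OF \<tau>'] q0 by (simp add: q'_def field_simps)
    moreover have "theta \<tau> (- 1 / 2) ^ 4 = - q * weber_u1 \<tau> ^ 8"
      using theta_values(2)[OF \<tau>] theta_minus[of \<tau> "1 / 2"] by (simp add: q_def)
    ultimately have "- (weber_u2 \<tau>' ^ 8) / q' ^ 2 * q' ^ 3 = c ^ 4 * (- q * weber_u1 \<tau> ^ 8)"
      by simp
    then show ?thesis using q0 unfolding k_def by (simp add: field_simps power2_eq_square power3_eq_cube)
  qed
  have "k ^ 3 * (weber_u0 \<tau> ^ 8 * weber_u1 \<tau> ^ 8 * weber_u2 \<tau> ^ 8) =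
      weber_u0 \<tau>' ^ 8 * weber_u1 \<tau>' ^ 8 * weber_u2 \<tau>' ^ 8"
    unfolding 0 1 2 by (simp add: power3_eq_cube)
  then have "k ^ 3 = 1"
    by (simp add: weber_product \<tau> \<tau>')
  moreover have "weber8 c d \<tau>' = k * weber8 d (- c) \<tau>" if "odd c \<or> odd d" for c d
    using that 0 1 2 by (auto simp: weber8_def)
  ultimately show ?thesis by (auto simp: \<tau>'_def)
qed

section \<open>The modular group\<close>

no_notation fps_nth (infixl \<open>$\<close> 75)

section \<open>Matrices by entries, and generation by S and T\<close>

definition mat2 :: "int \<Rightarrow> int \<Rightarrow> int \<Rightarrow> int \<Rightarrow> int ^ 2 ^ 2" where
  "mat2 a b c d = vector [vector [a, b], vector [c, d]]"

lemma mat2_nth [simp]: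
  "mat2 a b c d $ 1 $ 1 = a" "mat2 a b c d $ 1 $ 2 = b"
  "mat2 a b c d $ 2 $ 1 = c" "mat2 a b c d $ 2 $ 2 = d"
  by (simp_all add: mat2_def)

lemma mat2_eq_iff: "A = B \<longleftrightarrow> A $ 1 $ 1 = B $ 1 $ 1 \<and> A $ 1 $ 2 = B $ 1 $ 2 \<and>
    A $ 2 $ 1 = B $ 2 $ 1 \<and> A $ 2 $ 2 = B $ 2 $ 2" for A B :: "int ^ 2 ^ 2"
  by (auto simp: vec_eq_iff forall_2)

lemma mat2_mult_nth [simp]: "(A ** B) $ i $ j = A $ i $ 1 * B $ 1 $ j + A $ i $ 2 * B $ 2 $ j"
  for A B :: "int ^ 2 ^ 2"
  by (simp add: matrix_matrix_mult_def sum_2)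

lemma mat_1_nth [simp]:
  "(mat 1 :: int ^ 2 ^ 2) $ 1 $ 1 = 1" "(mat 1 :: int ^ 2 ^ 2) $ 1 $ 2 = 0"
  "(mat 1 :: int ^ 2 ^ 2) $ 2 $ 1 = 0" "(mat 1 :: int ^ 2 ^ 2) $ 2 $ 2 = 1"
  by (simp_all add: mat_def)

lemma det_mat2 [simp]: "det (mat2 a b c d) = a * d - b * c"
  by (simp add: det_2)

definition matS :: "int ^ 2 ^ 2" where "matS = mat2 0 (- 1) 1 0"

definition matT :: "int \<Rightarrow> int ^ 2 ^ 2" where "matT m = mat2 1 m 0 1"

lemma det_matS [simp]: "det matS = 1" and det_matT [simp]: "det (matT m) = 1"
  by (simp_all add: matS_def matT_def)

text \<open>S and T generate: Euclid's algorithm on the first column lowers the absolute value of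
  the lower left entry, and once this is 0 the matrix is a translation up to sign.\<close>

lemma SL2Z_induct [consumes 1, case_names one S T]:
  assumes "det A = 1"
    and one: "P (mat 1)"
    and S: "\<And>B. det B = 1 \<Longrightarrow> P B \<Longrightarrow> P (matS ** B)"
    and T: "\<And>B. det B = 1 \<Longrightarrow> P B \<Longrightarrow> P (matT 1 ** B)"
  shows "P (A :: int ^ 2 ^ 2)"
proof -
  have d: "det (matS ** B) = 1" "det (matT m ** B) = 1" if "det B = 1" for B m
    using that by (simp_all add: det_mul)
  have neg1: "P (matT (- 1) ** B)" if "det B = 1" "P B" for B
  proof -
    \<comment> \<open>From (S T)^3 = - 1 = S^2 the inverse of T is the word S^3 T S T S, with
      positive exponents only.\<close>
    have "matT (- 1) ** B = matS ** (matS ** (matS ** (matT 1 ** (matS ** (matT 1 ** (matS ** B))))))"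
      by (simp add: mat2_eq_iff matS_def matT_def)
    then show ?thesis using that by (simp add: S T d)
  qed
  have Tm: "P (matT m ** B)" if B: "det B = 1" "P B" for B m
  proof (induction m rule: int_induct[where k = 0])
    case base
    have "matT 0 ** B = B" by (simp add: mat2_eq_iff matT_def)
    then show ?case using B by simp
  next
    case (step1 i)
    have "matT (i + 1) ** B = matT 1 ** (matT i ** B)"
      by (simp add: mat2_eq_iff matT_def algebra_simps)
    then show ?case using T d B step1 by metis
  next
    case (step2 i)
    have "matT (i - 1) ** B = matT (- 1) ** (matT i ** B)"
      by (simp add: mat2_eq_iff matT_def algebra_simps)
    then show ?case using neg1 d B step2 by metis
  qed
  show ?thesis using \<open>det A = 1\<close>
  proof (induction "nat \<bar>A $ 2 $ 1\<bar>" arbitrary: A rule: less_induct)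
    case less
    have det: "A $ 1 $ 1 * A $ 2 $ 2 - A $ 1 $ 2 * A $ 2 $ 1 = 1" using less.prems by (simp add: det_2)
    show ?case
    proof (cases "A $ 2 $ 1 = 0")
      case True
      then have "A $ 1 $ 1 * A $ 2 $ 2 = 1" using det by simp
      then consider "A $ 1 $ 1 = 1" "A $ 2 $ 2 = 1" | "A $ 1 $ 1 = - 1" "A $ 2 $ 2 = - 1"
        using zmult_eq_1_iff by auto
      then show ?thesis
      proof cases
        case 1
        then have "A = matT (A $ 1 $ 2) ** mat 1" using True by (simp add: mat2_eq_iff matT_def)
        then show ?thesis using Tm[of "mat 1" "A $ 1 $ 2"] one by simp
      next
        case 2
        then have "A = matT (- (A $ 1 $ 2)) ** (matS ** (matS ** mat 1))"
          using True by (simp add: mat2_eq_iff matT_def matS_def)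
        then show ?thesis using Tm[of "matS ** (matS ** mat 1)" "- (A $ 1 $ 2)"] S one d by (metis det_I)
      qed
    next
      case False
      \<comment> \<open>One division step: after translation by - k and S, the lower left entry is
        the remainder. It is undone with S^3 as the inverse of S.\<close>
      define k where "k = A $ 1 $ 1 div A $ 2 $ 1"
      define B where "B = matS ** (matT (- k) ** A)"
      have "B $ 2 $ 1 = A $ 1 $ 1 mod A $ 2 $ 1"
        by (simp add: B_def k_def matS_def matT_def minus_div_mult_eq_mod)
      then have "\<bar>B $ 2 $ 1\<bar> < \<bar>A $ 2 $ 1\<bar>" using False by (simp add: abs_mod_less)
      moreover have dB: "det B = 1" using less.prems by (simp add: B_def d)
      ultimately have "P B" using less.hyps by simp
      moreover have "A = matT k ** (matS ** (matS ** (matS ** B)))"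
        by (simp add: B_def mat2_eq_iff matT_def matS_def)
      ultimately show ?thesis using Tm[of "matS ** (matS ** (matS ** B))" k] S d dB by metis
    qed
  qed
qed

section \<open>The action on the upper half plane\<close>

lemma moebius_denom_nonzero:
  fixes A :: "int ^ 2 ^ 2"
  assumes "Im \<tau> > 0" "det A = 1"
  shows "of_int (A $ 2 $ 1) * \<tau> + of_int (A $ 2 $ 2) \<noteq> 0"
proof
  assume 0: "of_int (A $ 2 $ 1) * \<tau> + of_int (A $ 2 $ 2) = 0"
  from arg_cong[OF 0, of Im] have "A $ 2 $ 1 = 0" using assms by simp
  with 0 have "A $ 2 $ 2 = 0" by simp
  with \<open>A $ 2 $ 1 = 0\<close> show False using assms(2) by (simp add: det_2)
qed

lemma Im_divide_mult_norm:
  fixes x y :: complex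
  assumes "y \<noteq> 0"
  shows "Im (x / y) * (norm y)\<^sup>2 = Im x * Re y - Re x * Im y"
proof -
  have "(Re y)\<^sup>2 + (Im y)\<^sup>2 \<noteq> 0" using assms by (simp flip: cmod_power2)
  then show ?thesis by (simp add: Im_divide cmod_power2)
qed

lemma Im_moebius:
  assumes "Im \<tau> > 0" "det A = 1"
  shows "Im (moebius A \<tau>) = Im \<tau> / (norm (of_int (A $ 2 $ 1) * \<tau> + of_int (A $ 2 $ 2)))\<^sup>2"
proof -
  have det: "real_of_int (A $ 1 $ 1) * real_of_int (A $ 2 $ 2) - real_of_int (A $ 1 $ 2) * real_of_int (A $ 2 $ 1) = 1"
    using assms(2) by (simp add: det_2 flip: of_int_mult of_int_diff)
  have "Im (moebius A \<tau>) * (norm (of_int (A $ 2 $ 1) * \<tau> + of_int (A $ 2 $ 2)))\<^sup>2 =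
     (real_of_int (A $ 1 $ 1) * real_of_int (A $ 2 $ 2) - real_of_int (A $ 1 $ 2) * real_of_int (A $ 2 $ 1)) * Im \<tau>"
    unfolding moebius_def Im_divide_mult_norm[OF moebius_denom_nonzero[OF assms]]
    by (simp add: algebra_simps)
  then show ?thesis using moebius_denom_nonzero[OF assms] by (simp add: det field_simps)
qed

lemma Im_moebius_pos: "Im \<tau> > 0 \<Longrightarrow> det A = 1 \<Longrightarrow> Im (moebius A \<tau>) > 0"
  using moebius_denom_nonzero[of \<tau> A] by (simp add: Im_moebius)

lemma moebius_mult:
  assumes "Im \<tau> > 0" "det A = 1" "det B = 1"
  shows "moebius (A ** B) \<tau> = moebius A (moebius B \<tau>)"
proof -
  define y where "y = of_int (B $ 2 $ 1) * \<tau> + of_int (B $ 2 $ 2)"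
  define x where "x = of_int (B $ 1 $ 1) * \<tau> + of_int (B $ 1 $ 2)"
  have y: "y \<noteq> 0" using moebius_denom_nonzero[of \<tau> B] assms by (simp add: y_def)
  have "moebius A (moebius B \<tau>) =
      (of_int (A $ 1 $ 1) * (x / y) + of_int (A $ 1 $ 2)) / (of_int (A $ 2 $ 1) * (x / y) + of_int (A $ 2 $ 2))"
    by (simp add: moebius_def x_def y_def)
  also have "\<dots> = ((of_int (A $ 1 $ 1) * (x / y) + of_int (A $ 1 $ 2)) * y) / ((of_int (A $ 2 $ 1) * (x / y) + of_int (A $ 2 $ 2)) * y)"
    using y by simp
  also have "\<dots> = (of_int (A $ 1 $ 1) * x + of_int (A $ 1 $ 2) * y) / (of_int (A $ 2 $ 1) * x + of_int (A $ 2 $ 2) * y)"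
    using y by (simp add: distrib_right)
  also have "\<dots> = moebius (A ** B) \<tau>"
    by (simp add: moebius_def x_def y_def algebra_simps)
  finally show ?thesis ..
qed

lemma moebius_mat_1 [simp]: "moebius (mat 1) \<tau> = \<tau>"
  and moebius_matS: "moebius matS \<tau> = - 1 / \<tau>"
  and moebius_matT: "moebius (matT m) \<tau> = \<tau> + of_int m"
  by (simp_all add: moebius_def matS_def matT_def)

lemma moebius_uminus: "moebius (- A) \<tau> = moebius A \<tau>"
proof -
  have "of_int ((- A) $ i $ 1) * \<tau> + of_int ((- A) $ i $ 2) = - (of_int (A $ i $ 1) * \<tau> + of_int (A $ i $ 2))"
    for i by simp
  then show ?thesis unfolding moebius_def by (simp only: minus_divide_divide)
qed

definition adj :: "int ^ 2 ^ 2 \<Rightarrow> int ^ 2 ^ 2" where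
  "adj A = mat2 (A $ 2 $ 2) (- (A $ 1 $ 2)) (- (A $ 2 $ 1)) (A $ 1 $ 1)"

lemma adj_nth [simp]:
  "adj A $ 1 $ 1 = A $ 2 $ 2" "adj A $ 1 $ 2 = - (A $ 1 $ 2)"
  "adj A $ 2 $ 1 = - (A $ 2 $ 1)" "adj A $ 2 $ 2 = A $ 1 $ 1"
  by (simp_all add: adj_def)

lemma det_adj [simp]: "det (adj A) = det A"
  by (simp add: adj_def det_2)

lemma adj_mult:
  assumes "det A = 1"
  shows "adj A ** A = mat 1" "A ** adj A = mat 1"
  using assms by (simp_all add: adj_def mat2_eq_iff det_2 algebra_simps)

lemma holomorphic_on_moebius: "det A = 1 \<Longrightarrow> moebius A holomorphic_on upper_half_plane"
  unfolding moebius_def[abs_def]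
  by (intro holomorphic_intros) (use moebius_denom_nonzero in auto)

text \<open>The pair \<open>(c, d)\<close> transforms like a row vector, so the parities of the entries of a matrix
  determine how it permutes the three functions.\<close>

lemma weber8_moebius:
  assumes "det A = 1" "Im \<tau> > 0"
  shows "\<exists>k. k ^ 3 = 1 \<and> (\<forall>c d. odd c \<or> odd d \<longrightarrow>
     weber8 c d (moebius A \<tau>) = k * weber8 (c * A $ 1 $ 1 + d * A $ 2 $ 1) (c * A $ 1 $ 2 + d * A $ 2 $ 2) \<tau>)"
  using assms(1)
proof (induction A rule: SL2Z_induct)
  case one
  show ?case by (rule exI[of _ 1]) simp
next
  case (S B)
  then obtain k where k: "k ^ 3 = 1" "\<And>c d. odd c \<or> odd d \<Longrightarrow>
     weber8 c d (moebius B \<tau>) = k * weber8 (c * B $ 1 $ 1 + d * B $ 2 $ 1) (c * B $ 1 $ 2 + d * B $ 2 $ 2) \<tau>"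
    by blast
  obtain k' where k': "k' ^ 3 = 1" "\<And>c d. odd c \<or> odd d \<Longrightarrow>
      weber8 c d (- 1 / moebius B \<tau>) = k' * weber8 d (- c) (moebius B \<tau>)"
    using weber8_S[OF Im_moebius_pos[OF assms(2) S(1)]] by blast
  show ?case
  proof (intro exI[of _ "k' * k"] conjI allI impI)
    show "(k' * k) ^ 3 = 1" using k k' by (simp add: power_mult_distrib)
    fix c d :: int assume cd: "odd c \<or> odd d"
    have "weber8 c d (moebius (matS ** B) \<tau>) = k' * weber8 d (- c) (moebius B \<tau>)"
      using moebius_mult[OF assms(2) det_matS S(1)] k'(2)[OF cd] by (simp add: moebius_matS)
    also have "weber8 d (- c) (moebius B \<tau>) =
        k * weber8 (d * B $ 1 $ 1 + - c * B $ 2 $ 1) (d * B $ 1 $ 2 + - c * B $ 2 $ 2) \<tau>"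
      using cd by (intro k(2)) auto
    finally show "weber8 c d (moebius (matS ** B) \<tau>) = k' * k * weber8
        (c * (matS ** B) $ 1 $ 1 + d * (matS ** B) $ 2 $ 1) (c * (matS ** B) $ 1 $ 2 + d * (matS ** B) $ 2 $ 2) \<tau>"
      by (simp add: matS_def)
  qed
next
  case (T B)
  then obtain k where k: "k ^ 3 = 1" "\<And>c d. odd c \<or> odd d \<Longrightarrow>
     weber8 c d (moebius B \<tau>) = k * weber8 (c * B $ 1 $ 1 + d * B $ 2 $ 1) (c * B $ 1 $ 2 + d * B $ 2 $ 2) \<tau>"
    by blast
  show ?case
  proof (intro exI[of _ "omega * k"] conjI allI impI)
    show "(omega * k) ^ 3 = 1" using k omega_cubed by (simp add: power_mult_distrib)
    fix c d :: int assume cd: "odd c \<or> odd d"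
    have "weber8 c d (moebius (matT 1 ** B) \<tau>) = omega * weber8 c (c + d) (moebius B \<tau>)"
      using moebius_mult[OF assms(2) det_matT T(1)] weber8_add_1[OF Im_moebius_pos[OF assms(2) T(1)]]
      by (simp add: moebius_matT)
    also have "weber8 c (c + d) (moebius B \<tau>) =
        k * weber8 (c * B $ 1 $ 1 + (c + d) * B $ 2 $ 1) (c * B $ 1 $ 2 + (c + d) * B $ 2 $ 2) \<tau>"
      using cd by (intro k(2)) auto
    finally show "weber8 c d (moebius (matT 1 ** B) \<tau>) = omega * k * weber8
        (c * (matT 1 ** B) $ 1 $ 1 + d * (matT 1 ** B) $ 2 $ 1) (c * (matT 1 ** B) $ 1 $ 2 + d * (matT 1 ** B) $ 2 $ 2) \<tau>"
      by (simp add: matT_def algebra_simps)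
  qed
qed

text \<open>Where |Re| \<le> 1/2 and Im < 1/2 one has |\<tau>|^2 \<le> 1/2, so inversion at least
  doubles the imaginary part. The induction is on the number of doublings that reach 1/2. The strip
  contains the usual fundamental domain and serves equally well for compactness arguments.\<close>

lemma reduction_to_strip:
  assumes "Im \<tau> > 0"
  shows "\<exists>A \<tau>'. det A = 1 \<and> \<tau> = moebius A \<tau>' \<and> \<bar>Re \<tau>'\<bar> \<le> 1/2 \<and> Im \<tau>' \<ge> 1/2"
proof -
  obtain n where "2 ^ n * Im \<tau> \<ge> 1/2"
  proof -
    obtain n where "1 / (2 * Im \<tau>) < 2 ^ n" using real_arch_pow[of 2] by auto
    then have "2 ^ n * Im \<tau> \<ge> 1/2" using assms by (simp add: field_simps)
    then show ?thesis using that by blast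
  qed
  then show ?thesis using assms
  proof (induction n arbitrary: \<tau>)
    case 0
    define m where "m = round (Re \<tau>)"
    have "\<bar>Re (\<tau> - of_int m)\<bar> \<le> 1/2"
      using of_int_round_abs_le[of "Re \<tau>"] by (simp add: m_def abs_minus_commute)
    moreover have "\<tau> = moebius (matT m) (\<tau> - of_int m)" by (simp add: moebius_matT)
    ultimately show ?case using 0
      by (intro exI[of _ "matT m"] exI[of _ "\<tau> - of_int m"]) auto
  next
    case (Suc n)
    define m where "m = round (Re \<tau>)"
    define \<tau>1 where "\<tau>1 = \<tau> - of_int m"
    have re: "\<bar>Re \<tau>1\<bar> \<le> 1/2"
      using of_int_round_abs_le[of "Re \<tau>"] by (simp add: m_def \<tau>1_def abs_minus_commute)
    have \<tau>: "\<tau> = moebius (matT m) \<tau>1" by (simp add: moebius_matT \<tau>1_def)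
    have im: "Im \<tau>1 = Im \<tau>" by (simp add: \<tau>1_def)
    show ?case
    proof (cases "Im \<tau>1 \<ge> 1/2")
      case True
      then show ?thesis using re \<tau>
        by (intro exI[of _ "matT m"] exI[of _ "\<tau>1"]) auto
    next
      case False
      have "\<bar>Re \<tau>1\<bar>\<^sup>2 \<le> (1/2)\<^sup>2" "(Im \<tau>1)\<^sup>2 \<le> (1/2)\<^sup>2"
        using re False im Suc.prems by (intro power_mono; simp)+
      then have "(norm \<tau>1)\<^sup>2 \<le> 1/2" by (simp add: cmod_power2 power_divide)
      moreover have "\<tau>1 \<noteq> 0" using im Suc.prems by auto
      ultimately have "2 * Im \<tau>1 \<le> Im (- 1 / \<tau>1)"
        unfolding Im_S using im Suc.prems by (simp add: field_simps)
      then have "2 ^ n * (2 * Im \<tau>) \<le> 2 ^ n * Im (- 1 / \<tau>1)"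
        using im by (intro mult_left_mono) auto
      then have "2 ^ n * Im (- 1 / \<tau>1) \<ge> 1/2" using Suc.prems by (simp add: mult_ac)
      then obtain A \<tau>' where A: "det A = 1" "- 1 / \<tau>1 = moebius A \<tau>'" "\<bar>Re \<tau>'\<bar> \<le> 1/2" "Im \<tau>' \<ge> 1/2"
        using Suc.IH Im_S_pos im Suc.prems by metis
      have \<tau>'0: "Im \<tau>' > 0" using A by linarith
      have "\<tau>1 = moebius matS (moebius A \<tau>')"
        using A(2) by (simp add: moebius_matS flip: A(2))
      then have "\<tau> = moebius (matT m ** (matS ** A)) \<tau>'"
        using A \<tau>'0 \<tau> by (simp add: moebius_mult det_mul)
      moreover have "det (matT m ** (matS ** A)) = 1" using A by (simp add: det_mul)
      ultimately show ?thesis using A by blast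
    qed
  qed
qed

section \<open>The level 2 group and its finitely many cosets\<close>

definition Gamma2 :: "(int ^ 2 ^ 2) set" where
  "Gamma2 = {A. det A = 1 \<and> odd (A $ 1 $ 1) \<and> even (A $ 1 $ 2) \<and> even (A $ 2 $ 1) \<and> odd (A $ 2 $ 2)}"

definition parities :: "int ^ 2 ^ 2 \<Rightarrow> (bool \<times> bool) \<times> (bool \<times> bool)" where
  "parities A = ((odd (A $ 1 $ 1), odd (A $ 1 $ 2)), (odd (A $ 2 $ 1), odd (A $ 2 $ 2)))"

lemma Gamma2_parities:
  assumes "det A = 1" "det B = 1" "parities A = parities B"
  shows "\<exists>g\<in>Gamma2. B = g ** A"
proof
  show "B = (B ** adj A) ** A"
    by (simp add: matrix_mul_assoc [symmetric] adj_mult assms)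
  have *: "odd (A $ 1 $ 1 * A $ 2 $ 2 - A $ 1 $ 2 * A $ 2 $ 1)"
    using assms(1) by (simp add: det_2)
  show "B ** adj A \<in> Gamma2"
    using * assms by (auto simp: Gamma2_def det_mul parities_def)
qed

text \<open>The cosets are classified by the parities of the entries, which range over a finite
  type; one matrix is chosen for each pattern that occurs.\<close>

lemma finite_representatives:
  obtains R where "finite R" "\<And>A. A \<in> R \<Longrightarrow> det A = 1"
    "\<And>B. det B = 1 \<Longrightarrow> \<exists>A\<in>R. \<exists>g\<in>Gamma2. B = g ** A"
proof
  define s where "s = (\<lambda>p. SOME A. det A = 1 \<and> parities A = p)"
  have s: "det (s (parities A)) = 1 \<and> parities (s (parities A)) = parities A" if "det A = 1" for A
    unfolding s_def by (rule someI[of _ A]) (use that in auto)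
  show "finite (s ` parities ` {A. det A = 1})" by (rule finite_imageI) (rule finite)
  show "det A = 1" if "A \<in> s ` parities ` {A. det A = 1}" for A using that s by auto
  show "\<exists>A\<in>s ` parities ` {A. det A = 1}. \<exists>g\<in>Gamma2. B = g ** A" if "det B = 1" for B
    using that s[OF that] Gamma2_parities[of "s (parities B)" B] by auto
qed

lemma Gamma2_det: "A \<in> Gamma2 \<Longrightarrow> det A = 1"
  by (simp add: Gamma2_def)

definition Gamma2_invariant :: "(complex \<Rightarrow> complex) \<Rightarrow> bool" where
  "Gamma2_invariant f \<longleftrightarrow> (\<forall>A\<in>Gamma2. \<forall>\<tau>. Im \<tau> > 0 \<longrightarrow> f (moebius A \<tau>) = f \<tau>)"

section \<open>Holomorphic functions invariant under the principal congruence subgroup of level 2\<close>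

abbreviation at_ii_inf :: "complex filter" where
  "at_ii_inf \<equiv> filtercomap Im at_top"

lemma eventually_at_ii_inf: "eventually P at_ii_inf \<longleftrightarrow> (\<exists>y. \<forall>\<tau>. Im \<tau> > y \<longrightarrow> P \<tau>)"
  by (simp add: eventually_filtercomap_at_top_dense)

lemma eventually_at_ii_inf_gt: "eventually (\<lambda>\<tau>. Im \<tau> > y) at_ii_inf"
  unfolding eventually_at_ii_inf by blast

lemma open_upper_half_plane: "open upper_half_plane"
  using open_halfspace_Im_gt[of 0] by simp

lemma connected_upper_half_plane: "connected upper_half_plane"
  using convex_halfspace_Im_gt[of 0] convex_connected by auto

lemma holomorphic_on_nome: "nome holomorphic_on S"
  unfolding nome_def[abs_def] by (intro holomorphic_intros)

lemma holomorphic_on_nome3: "nome3 holomorphic_on S"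
  unfolding nome3_def[abs_def] by (intro holomorphic_intros) auto

lemma tendsto_exp_at_ii_inf:
  assumes "c > 0"
  shows "((\<lambda>\<tau>. exp (\<i> * of_real c * \<tau>)) \<longlongrightarrow> 0) at_ii_inf"
proof -
  have "filterlim (\<lambda>y. exp (- c * y)) (nhds 0) at_top"
    by (rule filterlim_compose[OF exp_at_bot], rule filterlim_tendsto_neg_mult_at_bot)
       (use assms in \<open>auto intro: filterlim_ident\<close>)
  then have "((\<lambda>\<tau>. exp (- c * Im \<tau>)) \<longlongrightarrow> 0) at_ii_inf"
    by (rule filterlim_compose[OF _ filterlim_filtercomap])
  then have "((\<lambda>\<tau>. norm (exp (\<i> * of_real c * \<tau>))) \<longlongrightarrow> 0) at_ii_inf"
    by simp
  then show ?thesis by (rule tendsto_norm_zero_cancel)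
qed

lemma tendsto_nome: "(nome \<longlongrightarrow> 0) at_ii_inf"
  using tendsto_exp_at_ii_inf[of pi] by (simp add: nome_def[abs_def])

lemma tendsto_nome3: "(nome3 \<longlongrightarrow> 0) at_ii_inf"
  using tendsto_exp_at_ii_inf[of "pi / 3"] by (simp add: nome3_def[abs_def])

text \<open>The nome never vanishes, so statements on a punctured neighbourhood of 0 transfer to
  large imaginary parts.\<close>

lemma filterlim_nome: "filterlim nome (at 0) at_ii_inf"
  using tendsto_nome by (auto simp: filterlim_at)

lemma holomorphic_on_odd_prod':
  assumes "f holomorphic_on S" "\<And>z. z \<in> S \<Longrightarrow> norm (f z) < 1"
  shows "(\<lambda>z. odd_prod (f z)) holomorphic_on S"
  using holomorphic_on_compose_gen[OF assms(1) holomorphic_on_odd_prod] assms(2)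
  by (simp add: o_def image_subset_iff)

lemma holomorphic_on_weber8: "weber8 c d holomorphic_on upper_half_plane"
proof -
  have q: "norm (nome \<tau>) < 1" "norm ((nome \<tau>)\<^sup>2) < 1" if "\<tau> \<in> upper_half_plane" for \<tau>
    using that norm_nome_less_1 norm_power2_less_1 by auto
  have h: "(\<lambda>\<tau>. odd_prod (- nome \<tau>)) holomorphic_on upper_half_plane"
    "(\<lambda>\<tau>. odd_prod (nome \<tau>)) holomorphic_on upper_half_plane"
    "(\<lambda>\<tau>. odd_prod ((nome \<tau>)\<^sup>2)) holomorphic_on upper_half_plane"
    using q by (auto intro!: holomorphic_on_odd_prod' holomorphic_intros holomorphic_on_nome)
  have "(\<lambda>\<tau>. odd_prod (- nome \<tau>) ^ 8 / nome3 \<tau>) holomorphic_on upper_half_plane"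
    "(\<lambda>\<tau>. - (odd_prod (nome \<tau>) ^ 8 / nome3 \<tau>)) holomorphic_on upper_half_plane"
    "(\<lambda>\<tau>. - 16 * nome3 \<tau> ^ 2 / odd_prod ((nome \<tau>)\<^sup>2) ^ 8) holomorphic_on upper_half_plane"
    using q by (auto intro!: holomorphic_intros h holomorphic_on_nome3 simp: odd_prod_nonzero)
  then have "(\<lambda>\<tau>. weber_u0 \<tau> ^ 8) holomorphic_on upper_half_plane"
    "(\<lambda>\<tau>. weber_u1 \<tau> ^ 8) holomorphic_on upper_half_plane"
    "(\<lambda>\<tau>. weber_u2 \<tau> ^ 8) holomorphic_on upper_half_plane"
    using weber_u0_power8 weber_u1_power8 weber_u2_power8
    by - (erule holomorphic_transform, simp; fail)+
  then show ?thesis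
    by (cases "even c"; cases "even d") (simp_all add: weber8_def[abs_def])
qed

lemma tendsto_odd_prod:
  assumes "(f \<longlongrightarrow> 0) F"
  shows "((\<lambda>x. odd_prod (f x)) \<longlongrightarrow> 1) F"
proof -
  have "isCont odd_prod 0"
    using holomorphic_on_imp_continuous_on[OF holomorphic_on_odd_prod]
    by (simp add: continuous_on_eq_continuous_at)
  then show ?thesis using isCont_tendsto_compose[OF _ assms] by force
qed

section \<open>A maximum principle modulo Gamma(2)\<close>

lemma compact_strip: "compact {\<tau>. \<bar>Re \<tau>\<bar> \<le> 1/2 \<and> 1/2 \<le> Im \<tau> \<and> Im \<tau> \<le> y}"
proof -
  have "{\<tau>. \<bar>Re \<tau>\<bar> \<le> 1/2 \<and> 1/2 \<le> Im \<tau> \<and> Im \<tau> \<le> y} = cbox (Complex (-1/2) (1/2)) (Complex (1/2) y)"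
    by (auto simp: in_cbox_complex_iff abs_le_iff)
  then show ?thesis by simp
qed

lemma holomorphic_on_moebius_compose:
  assumes "f holomorphic_on upper_half_plane" "det A = 1"
  shows "(\<lambda>\<tau>. f (moebius A \<tau>)) holomorphic_on upper_half_plane"
  using holomorphic_on_compose_gen[OF holomorphic_on_moebius[OF assms(2)] assms(1)]
    Im_moebius_pos[OF _ assms(2)] by (auto simp: o_def)

lemma Gamma2_decomposition:
  assumes R: "\<And>B. det B = 1 \<Longrightarrow> \<exists>A\<in>R. \<exists>g\<in>Gamma2. B = g ** A" "\<And>A. A \<in> R \<Longrightarrow> det A = 1"
    and "Im \<tau> > 0"
  obtains g A \<tau>' where "g \<in> Gamma2" "A \<in> R" "\<tau> = moebius g (moebius A \<tau>')" "\<bar>Re \<tau>'\<bar> \<le> 1/2" "Im \<tau>' \<ge> 1/2"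
proof -
  obtain B \<tau>' where B: "det B = 1" "\<tau> = moebius B \<tau>'" "\<bar>Re \<tau>'\<bar> \<le> 1/2" "Im \<tau>' \<ge> 1/2"
    using reduction_to_strip[OF assms(3)] by blast
  obtain A g where A: "A \<in> R" "g \<in> Gamma2" "B = g ** A" using R B(1) by blast
  have "\<tau> = moebius g (moebius A \<tau>')"
    using B A R(2) Gamma2_det by (simp add: moebius_mult)
  then show ?thesis using that A B by blast
qed

text \<open>If h were nonzero at \<tau>0, the points with |h| \<ge> e = |h \<tau>0| would lie,
  modulo \<open>Gamma2\<close>, in a compact set: the translates of the strip cut off at a height
  beyond which |h| < e on all of them. Then |h| attains its maximum over the half plane, h is
  constant of norm e, and this contradicts its smallness near a cusp.\<close>

lemma vanish_at_cusps_imp_zero: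
  assumes hol: "h holomorphic_on upper_half_plane" and inv: "Gamma2_invariant h"
    and cusps: "\<And>A. det A = 1 \<Longrightarrow> ((\<lambda>\<tau>. h (moebius A \<tau>)) \<longlongrightarrow> 0) at_ii_inf"
    and "Im \<tau>0 > 0"
  shows "h \<tau>0 = 0"
proof (rule ccontr)
  assume nz: "h \<tau>0 \<noteq> 0"
  define e where "e = norm (h \<tau>0)"
  have "e > 0" using nz by (simp add: e_def)
  obtain R where R: "finite R" "\<And>A. A \<in> R \<Longrightarrow> det A = 1"
    "\<And>B. det B = 1 \<Longrightarrow> \<exists>A\<in>R. \<exists>g\<in>Gamma2. B = g ** A"
    using finite_representatives by blast
  have "\<forall>A\<in>R. \<forall>\<^sub>F \<tau> in at_ii_inf. norm (h (moebius A \<tau>)) < e"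
    using cusps R(2) \<open>e > 0\<close> by (auto simp: tendsto_iff)
  then have "\<forall>\<^sub>F \<tau> in at_ii_inf. \<forall>A\<in>R. norm (h (moebius A \<tau>)) < e"
    using R(1) by (simp add: eventually_ball_finite)
  then obtain y where y: "\<And>\<tau> A. Im \<tau> > y \<Longrightarrow> A \<in> R \<Longrightarrow> norm (h (moebius A \<tau>)) < e"
    unfolding eventually_at_ii_inf by blast
  define K where "K = {\<tau>. \<bar>Re \<tau>\<bar> \<le> 1/2 \<and> 1/2 \<le> Im \<tau> \<and> Im \<tau> \<le> y}"
  have KH: "K \<subseteq> upper_half_plane" by (auto simp: K_def)
  define U where "U = (\<Union>A\<in>R. moebius A ` K)"
  have "compact U" unfolding U_def
  proof (intro compact_UN R(1) compact_continuous_image)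
    fix A assume "A \<in> R"
    show "continuous_on K (moebius A)"
      using holomorphic_on_imp_continuous_on[OF holomorphic_on_moebius[OF R(2)[OF \<open>A \<in> R\<close>]]] KH
      by (rule continuous_on_subset)
    show "compact K" unfolding K_def by (rule compact_strip)
  qed
  have UH: "U \<subseteq> upper_half_plane" using KH R(2) Im_moebius_pos by (auto simp: U_def)
  have red: "\<exists>w\<in>U. h \<tau> = h w" if \<tau>: "Im \<tau> > 0" and ge: "norm (h \<tau>) \<ge> e" for \<tau>
  proof -
    obtain g A \<tau>' where *: "g \<in> Gamma2" "A \<in> R" "\<tau> = moebius g (moebius A \<tau>')" "\<bar>Re \<tau>'\<bar> \<le> 1/2" "Im \<tau>' \<ge> 1/2"
      using Gamma2_decomposition[OF R(3,2) \<tau>] by metis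
    then have eq: "h \<tau> = h (moebius A \<tau>')"
      using inv R(2) Im_moebius_pos by (simp add: Gamma2_invariant_def)
    then have "\<not> Im \<tau>' > y" using y[of \<tau>' A] ge * by auto
    then have "\<tau>' \<in> K" using * by (simp add: K_def)
    then show ?thesis using eq * by (auto simp: U_def)
  qed
  obtain w0 where "w0 \<in> U" "h \<tau>0 = h w0" using red[OF assms(4)] by (auto simp: e_def)
  have "continuous_on U (\<lambda>w. norm (h w))"
    using holomorphic_on_imp_continuous_on[OF hol] UH by (auto intro: continuous_intros continuous_on_subset)
  then obtain w1 where w1: "w1 \<in> U" "\<And>w. w \<in> U \<Longrightarrow> norm (h w) \<le> norm (h w1)"
    using continuous_attains_sup[OF \<open>compact U\<close>] \<open>w0 \<in> U\<close> by blast
  have "norm (h \<tau>) \<le> norm (h w1)" if \<tau>: "\<tau> \<in> upper_half_plane" for \<tau>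
  proof (cases "norm (h \<tau>) \<ge> e")
    case True
    then show ?thesis using red[of \<tau>] \<tau> w1 by auto
  next
    case False
    then show ?thesis using w1(2)[OF \<open>w0 \<in> U\<close>] \<open>h \<tau>0 = h w0\<close> by (simp add: e_def)
  qed
  then have "h constant_on upper_half_plane"
    using maximum_modulus_principle[OF hol open_upper_half_plane connected_upper_half_plane open_upper_half_plane order_refl]
      UH w1(1) by blast
  then have "h \<tau> = h \<tau>0" if "Im \<tau> > 0" for \<tau>
    using that assms(4) unfolding constant_on_def by auto
  then have e: "norm (h (moebius A \<tau>)) = e" if "Im \<tau> > 0" "A \<in> R" for A \<tau>
    using that R(2) Im_moebius_pos by (simp add: e_def)
  obtain A where "A \<in> R" using R(3)[of "mat 1"] by auto
  define w where "w = Complex 0 (\<bar>y\<bar> + 1)"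
  have "Im w = \<bar>y\<bar> + 1" by (simp add: w_def)
  then have "Im w > 0" "Im w > y" by linarith+
  then show False using y[of w A] \<open>A \<in> R\<close> e[of w A] by simp
qed

section \<open>The Jacobi identity and the modular lambda function\<close>

text \<open>Modulo 2 the rows of A and their sum are again the three nonzero vectors.\<close>

lemma weber8_sum_permuted:
  fixes A :: "int ^ 2 ^ 2"
  assumes "det A = 1"
  shows "weber8 (A $ 2 $ 1) (A $ 2 $ 2) \<tau> + weber8 (A $ 1 $ 1) (A $ 1 $ 2) \<tau> +
     weber8 (A $ 1 $ 1 + A $ 2 $ 1) (A $ 1 $ 2 + A $ 2 $ 2) \<tau> = weber8 0 1 \<tau> + weber8 1 0 \<tau> + weber8 1 1 \<tau>"
proof -
  have "odd (A $ 1 $ 1 * A $ 2 $ 2 - A $ 1 $ 2 * A $ 2 $ 1)" using assms by (simp add: det_2)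
  then show ?thesis by (auto simp: weber8_def)
qed

text \<open>The terms from \<open>weber_u0\<close> and \<open>weber_u1\<close> grow like q^(-1/3),
  but their sum is k(q) / q^(1/3) with k(0) = 0. As k(q) / q has a finite limit, this sum is
  O(q^(2/3)), and so is the term from \<open>weber_u2\<close>.\<close>

lemma weber8_sum_tendsto: "((\<lambda>\<tau>. weber8 0 1 \<tau> + weber8 1 0 \<tau> + weber8 1 1 \<tau>) \<longlongrightarrow> 0) at_ii_inf"
proof -
  define k where "k = (\<lambda>x. odd_prod (- x) ^ 8 - odd_prod x ^ 8)"
  have "k holomorphic_on ball 0 1"
    unfolding k_def by (intro holomorphic_intros holomorphic_on_odd_prod') auto
  then have "(k has_field_derivative deriv k 0) (at 0)"
    by (auto intro: holomorphic_derivI[of _ "ball 0 1"])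
  then have "((\<lambda>x. k x / x) \<longlongrightarrow> deriv k 0) (at 0)"
    by (simp add: has_field_derivative_iff k_def)
  then have "((\<lambda>\<tau>. k (nome \<tau>) / nome \<tau>) \<longlongrightarrow> deriv k 0) at_ii_inf"
    by (rule filterlim_compose[OF _ filterlim_nome])
  moreover have "((\<lambda>\<tau>. odd_prod ((nome \<tau>)\<^sup>2)) \<longlongrightarrow> 1) at_ii_inf"
    using tendsto_power[OF tendsto_nome, of 2] by (intro tendsto_odd_prod) simp
  ultimately have "((\<lambda>\<tau>. nome3 \<tau> ^ 2 * (k (nome \<tau>) / nome \<tau> - 16 / odd_prod ((nome \<tau>)\<^sup>2) ^ 8))
      \<longlongrightarrow> 0 ^ 2 * (deriv k 0 - 16 / 1 ^ 8)) at_ii_inf"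
    by (intro tendsto_intros tendsto_nome3) auto
  moreover have "\<forall>\<^sub>F \<tau> in at_ii_inf. nome3 \<tau> ^ 2 * (k (nome \<tau>) / nome \<tau> - 16 / odd_prod ((nome \<tau>)\<^sup>2) ^ 8) =
      weber8 0 1 \<tau> + weber8 1 0 \<tau> + weber8 1 1 \<tau>"
    using eventually_at_ii_inf_gt[of 0]
  proof eventually_elim
    case (elim \<tau>)
    have e: "nome3 \<tau> ^ 2 / nome \<tau> = 1 / nome3 \<tau>"
      unfolding nome3_cubed [symmetric] by (simp add: power2_eq_square power3_eq_cube)
    have "nome3 \<tau> ^ 2 * (k (nome \<tau>) / nome \<tau> - 16 / odd_prod ((nome \<tau>)\<^sup>2) ^ 8) =
       nome3 \<tau> ^ 2 / nome \<tau> * k (nome \<tau>) - 16 * nome3 \<tau> ^ 2 / odd_prod ((nome \<tau>)\<^sup>2) ^ 8"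
      by (simp add: algebra_simps)
    then show ?case unfolding e using elim
      by (simp add: k_def weber8_def weber_u0_power8 weber_u1_power8 weber_u2_power8 diff_divide_distrib)
  qed
  ultimately show ?thesis by (simp add: tendsto_cong)
qed

text \<open>Jacobi's identity f^8 = f_1^8 + f_2^8. The sum s is preserved by \<open>SL2Z\<close> up
  to a cube root of unity, so s^3 is invariant under the full group and its limit at every cusp is
  the one at infinity.\<close>

lemma weber8_sum_eq_0:
  assumes "Im \<tau> > 0"
  shows "weber8 0 1 \<tau> + weber8 1 0 \<tau> + weber8 1 1 \<tau> = 0"
proof -
  define s where "s = (\<lambda>\<tau>. weber8 0 1 \<tau> + weber8 1 0 \<tau> + weber8 1 1 \<tau>)"
  have inv: "s (moebius A \<tau>) ^ 3 = s \<tau> ^ 3" if A: "det A = 1" and \<tau>: "Im \<tau> > 0" for A \<tau>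
  proof -
    obtain k where k: "k ^ 3 = 1" "\<And>c d. odd c \<or> odd d \<Longrightarrow>
     weber8 c d (moebius A \<tau>) = k * weber8 (c * A $ 1 $ 1 + d * A $ 2 $ 1) (c * A $ 1 $ 2 + d * A $ 2 $ 2) \<tau>"
      using weber8_moebius[OF A \<tau>] by blast
    have "s (moebius A \<tau>) = k * (weber8 (A $ 2 $ 1) (A $ 2 $ 2) \<tau> + weber8 (A $ 1 $ 1) (A $ 1 $ 2) \<tau> +
     weber8 (A $ 1 $ 1 + A $ 2 $ 1) (A $ 1 $ 2 + A $ 2 $ 2) \<tau>)"
      by (simp add: s_def k(2) distrib_left)
    also have "\<dots> = k * s \<tau>" unfolding weber8_sum_permuted[OF A] by (simp add: s_def)
    finally show ?thesis by (simp add: power_mult_distrib k(1))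
  qed
  have "(\<lambda>\<tau>. s \<tau> ^ 3) holomorphic_on upper_half_plane"
    unfolding s_def by (intro holomorphic_intros holomorphic_on_weber8)
  moreover have "Gamma2_invariant (\<lambda>\<tau>. s \<tau> ^ 3)"
    by (simp add: Gamma2_invariant_def inv Gamma2_det)
  moreover have "((\<lambda>\<tau>. s (moebius A \<tau>) ^ 3) \<longlongrightarrow> 0) at_ii_inf" if "det A = 1" for A
  proof -
    have "((\<lambda>\<tau>. s \<tau> ^ 3) \<longlongrightarrow> 0 ^ 3) at_ii_inf"
      unfolding s_def by (intro tendsto_power weber8_sum_tendsto)
    moreover have "\<forall>\<^sub>F \<tau> in at_ii_inf. s (moebius A \<tau>) ^ 3 = s \<tau> ^ 3"
      using eventually_at_ii_inf_gt[of 0] by eventually_elim (simp add: inv that)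
    ultimately show ?thesis by (simp add: tendsto_cong)
  qed
  ultimately have "s \<tau> ^ 3 = 0" using vanish_at_cusps_imp_zero assms by blast
  then show ?thesis by (simp add: s_def)
qed

section \<open>The modular lambda function \<theta>_2^4 / \<theta>_3^4 and the anharmonic
  group\<close>

definition lam :: "complex \<Rightarrow> complex" where
  "lam \<tau> = - (weber8 0 1 \<tau> / weber8 1 1 \<tau>)"

lemma holomorphic_on_lam: "lam holomorphic_on upper_half_plane"
  unfolding lam_def[abs_def] by (intro holomorphic_intros holomorphic_on_weber8) (simp add: weber8_nonzero)

lemma weber8_eq_lam:
  assumes "Im \<tau> > 0"
  shows "weber8 0 1 \<tau> = - lam \<tau> * weber8 1 1 \<tau>" "weber8 1 0 \<tau> = (lam \<tau> - 1) * weber8 1 1 \<tau>"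
proof -
  show 1: "weber8 0 1 \<tau> = - lam \<tau> * weber8 1 1 \<tau>"
    using weber8_nonzero[OF assms, of 1 1] by (simp add: lam_def)
  show "weber8 1 0 \<tau> = (lam \<tau> - 1) * weber8 1 1 \<tau>"
  proof -
    have "weber8 1 0 \<tau> = (lam \<tau> - 1) * weber8 1 1 \<tau> + (- lam \<tau> * weber8 1 1 \<tau> + weber8 1 0 \<tau> + weber8 1 1 \<tau>)"
      by (simp add: algebra_simps)
    also have "- lam \<tau> * weber8 1 1 \<tau> + weber8 1 0 \<tau> + weber8 1 1 \<tau> = 0"
      using weber8_sum_eq_0[OF assms] unfolding 1 .
    finally show ?thesis by simp
  qed
qed

lemma lam_nonzero: "Im \<tau> > 0 \<Longrightarrow> lam \<tau> \<noteq> 0"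
  by (simp add: lam_def weber8_nonzero)

lemma lam_neq_1: "Im \<tau> > 0 \<Longrightarrow> lam \<tau> \<noteq> 1"
  using weber8_nonzero[of \<tau> 1 0] by (auto simp: weber8_eq_lam)

text \<open>\<open>SL2Z\<close> acts on \<open>lam\<close> through the anharmonic group. The lower
  left entry separates the matrices that fix the cusp infinity modulo Gamma(2), after which
  \<open>lam\<close> stays near 0 high in the half plane, from those that move it to the cusps with
  values 1 or infinity.\<close>

lemma lam_moebius:
  assumes A: "det A = 1" and \<tau>: "Im \<tau> > 0"
  shows "even (A $ 2 $ 1) \<and> even (A $ 1 $ 2) \<and> lam (moebius A \<tau>) = lam \<tau> \<or>
     even (A $ 2 $ 1) \<and> odd (A $ 1 $ 2) \<and> lam (moebius A \<tau>) = lam \<tau> / (lam \<tau> - 1) \<or>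
     odd (A $ 2 $ 1) \<and> lam (moebius A \<tau>) \<in> {1 - lam \<tau>, 1 / lam \<tau>, 1 / (1 - lam \<tau>), (lam \<tau> - 1) / lam \<tau>}"
proof -
  obtain k where k: "k ^ 3 = 1" "\<And>c d. odd c \<or> odd d \<Longrightarrow>
     weber8 c d (moebius A \<tau>) = k * weber8 (c * A $ 1 $ 1 + d * A $ 2 $ 1) (c * A $ 1 $ 2 + d * A $ 2 $ 2) \<tau>"
    using weber8_moebius[OF A \<tau>] by blast
  define W where "W = weber8 1 1 \<tau>"
  have nz: "k \<noteq> 0" "W \<noteq> 0" "lam \<tau> \<noteq> 0" "lam \<tau> \<noteq> 1"
    using k(1) weber8_nonzero[OF \<tau>] lam_nonzero[OF \<tau>] lam_neq_1[OF \<tau>] by (auto simp: W_def)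
  have eq: "lam (moebius A \<tau>) = - (weber8 (A $ 2 $ 1) (A $ 2 $ 2) \<tau> /
      weber8 (A $ 1 $ 1 + A $ 2 $ 1) (A $ 1 $ 2 + A $ 2 $ 2) \<tau>)"
    using nz by (simp add: lam_def k(2))
  have w: "weber8 c d \<tau> = (if even c then - lam \<tau> else if even d then lam \<tau> - 1 else 1) * W" for c d
    using weber8_eq_lam[OF \<tau>] by (auto simp: W_def weber8_def)
  have 1: "odd (A $ 1 $ 1 * A $ 2 $ 2 - A $ 1 $ 2 * A $ 2 $ 1)" using A by (simp add: det_2)
  have 2: "- ((lam \<tau> - 1) / 1) = 1 - lam \<tau>" "- (lam \<tau> / (1 - lam \<tau>)) = lam \<tau> / (lam \<tau> - 1)"
    "- (1 / (lam \<tau> - 1)) = 1 / (1 - lam \<tau>)"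
    using nz by (auto simp: field_simps)
  show ?thesis using 1 nz unfolding eq w by (auto simp: 2)
qed

lemma lam_invariant: "Gamma2_invariant lam"
  unfolding Gamma2_invariant_def
proof (intro ballI allI impI)
  fix A \<tau> assume "A \<in> Gamma2" "Im \<tau> > 0"
  then show "lam (moebius A \<tau>) = lam \<tau>"
    using lam_moebius[of A \<tau>] unfolding Gamma2_def by blast
qed

lemma lam_nome:
  assumes "Im \<tau> > 0"
  shows "lam \<tau> = 16 * nome \<tau> / (odd_prod ((nome \<tau>)\<^sup>2) * odd_prod (- nome \<tau>)) ^ 8"
  using assms
  by (simp add: lam_def weber8_def weber_u0_power8 weber_u2_power8 nome3_cubed [symmetric] power_mult_distrib
      power2_eq_square power3_eq_cube)

lemma lam_over_nome_tendsto: "((\<lambda>\<tau>. lam \<tau> / nome \<tau>) \<longlongrightarrow> 16) at_ii_inf"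
proof -
  have "((\<lambda>\<tau>. odd_prod ((nome \<tau>)\<^sup>2)) \<longlongrightarrow> 1) at_ii_inf"
    using tendsto_power[OF tendsto_nome, of 2] by (intro tendsto_odd_prod) simp
  moreover have "((\<lambda>\<tau>. odd_prod (- nome \<tau>)) \<longlongrightarrow> 1) at_ii_inf"
    using tendsto_minus[OF tendsto_nome] by (intro tendsto_odd_prod) simp
  ultimately have "((\<lambda>\<tau>. 16 / (odd_prod ((nome \<tau>)\<^sup>2) * odd_prod (- nome \<tau>)) ^ 8) \<longlongrightarrow> 16 / (1 * 1) ^ 8) at_ii_inf"
    by (intro tendsto_intros) auto
  moreover have "\<forall>\<^sub>F \<tau> in at_ii_inf. 16 / (odd_prod ((nome \<tau>)\<^sup>2) * odd_prod (- nome \<tau>)) ^ 8 = lam \<tau> / nome \<tau>"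
    using eventually_at_ii_inf_gt[of 0] by eventually_elim (simp add: lam_nome)
  ultimately show ?thesis by (simp add: tendsto_cong)
qed

text \<open>16 is the leading coefficient of \<open>lam\<close> in the nome; 1 and 32 leave room on
  both sides.\<close>

lemma lam_nome_bounds: "\<forall>\<^sub>F \<tau> in at_ii_inf. norm (nome \<tau>) \<le> norm (lam \<tau>) \<and> norm (lam \<tau>) \<le> 32 * norm (nome \<tau>)"
proof -
  have *: "((\<lambda>\<tau>. norm (lam \<tau> / nome \<tau>)) \<longlongrightarrow> 16) at_ii_inf"
    using tendsto_norm[OF lam_over_nome_tendsto] by simp
  have "\<forall>\<^sub>F \<tau> in at_ii_inf. norm (lam \<tau> / nome \<tau>) > 1" "\<forall>\<^sub>F \<tau> in at_ii_inf. norm (lam \<tau> / nome \<tau>) < 32"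
    using order_tendstoD[OF *] by auto
  then show ?thesis
    by eventually_elim (simp add: norm_divide field_simps)
qed

lemma lam_tendsto: "(lam \<longlongrightarrow> 0) at_ii_inf"
proof -
  have "((\<lambda>\<tau>. lam \<tau> / nome \<tau> * nome \<tau>) \<longlongrightarrow> 16 * 0) at_ii_inf"
    by (intro tendsto_intros lam_over_nome_tendsto tendsto_nome)
  then show ?thesis by simp
qed

section \<open>Expansion at a cusp in the nome\<close>

lemma periodic_imp_analytic_in_nome:
  assumes hol: "u holomorphic_on {\<tau>. Im \<tau> > y}" and per: "\<And>\<tau>. Im \<tau> > y \<Longrightarrow> u (\<tau> + 2) = u \<tau>"
  obtains G where "G holomorphic_on ball 0 (exp (- pi * y)) - {0}" "\<And>\<tau>. Im \<tau> > y \<Longrightarrow> u \<tau> = G (nome \<tau>)"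
proof
  \<comment> \<open>The principal logarithm jumps on the negative axis, but a change of branch
    shifts the argument of u by an even integer, a period of u.\<close>
  define G where "G = (\<lambda>q. u (Ln q / (\<i> * of_real pi)))"
  have per': "u (\<tau> + 2 * of_int n) = u \<tau>" if "Im \<tau> > y" for \<tau> n
  proof (induction n rule: int_induct[where k = 0])
    case (step1 i)
    then show ?case using per[of "\<tau> + 2 * of_int i"] that by (simp add: algebra_simps)
  next
    case (step2 i)
    then show ?case using per[of "\<tau> + 2 * of_int (i - 1)"] that by (simp add: algebra_simps)
  qed simp
  have eq: "u \<tau> = G (nome \<tau>)" if "Im \<tau> > y" for \<tau>
  proof -
    have "exp (\<i> * of_real pi * \<tau>) = exp (Ln (nome \<tau>))" by (simp add: nome_def)
    then obtain n :: int where n: "\<i> * of_real pi * \<tau> = Ln (nome \<tau>) + (of_int (2 * n) * pi) * \<i>"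
      using exp_eq by blast
    have "Ln (nome \<tau>) / (\<i> * of_real pi) = \<tau> + 2 * of_int (- n)"
    proof -
      have "Ln (nome \<tau>) = (\<tau> + 2 * of_int (- n)) * (\<i> * of_real pi)"
        using n by (simp add: algebra_simps)
      then show ?thesis by simp
    qed
    then show ?thesis using per'[OF that, of "- n"] by (simp add: G_def)
  qed
  then show "\<And>\<tau>. Im \<tau> > y \<Longrightarrow> u \<tau> = G (nome \<tau>)" .
  have "G field_differentiable (at q0)" if q0: "q0 \<in> ball 0 (exp (- pi * y)) - {0}" for q0
  proof -
    \<comment> \<open>A right inverse of \<open>nome\<close> that is holomorphic near
      \<open>q0\<close>, because q / q0 is near 1 there; \<open>u\<close> after \<open>g\<close>
      agrees with \<open>G\<close> near \<open>q0\<close>.\<close>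
    define g where "g = (\<lambda>q. (Ln (q / q0) + Ln q0) / (\<i> * of_real pi))"
    have g: "nome (g q) = q" if "q \<noteq> 0" for q
      using q0 that by (simp add: g_def nome_def exp_add)
    have img: "Im (g q) = - ln (norm q) / pi" if "q \<noteq> 0" for q
    proof -
      have "norm q = exp (- pi * Im (g q))" using norm_nome[of "g q"] g[OF that] by simp
      then have "ln (norm q) = - pi * Im (g q)" by simp
      then show ?thesis by simp
    qed
    have pos: "Im (g q) > y" if "q \<noteq> 0" "norm q < exp (- pi * y)" for q
    proof -
      have "ln (norm q) < - pi * y" using that by (metis ln_exp ln_less_cancel_iff exp_gt_zero zero_less_norm_iff)
      then have "y * pi < - ln (norm q)" by (simp add: mult.commute)
      then have "y < - ln (norm q) / pi" by (subst pos_less_divide_eq) auto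
      then show ?thesis using img[OF that(1)] by simp
    qed
    have "q0 \<noteq> 0" using q0 by simp
    then have "(Ln has_field_derivative inverse (q0 / q0)) (at (q0 / q0))"
      by (intro has_field_derivative_Ln) simp
    from DERIV_cdivide[OF DERIV_add[OF DERIV_chain2[OF this DERIV_cdivide[OF DERIV_ident]] DERIV_const]]
    have dg: "g field_differentiable (at q0)"
      unfolding g_def field_differentiable_def by blast
    have "u field_differentiable (at (g q0))"
      using hol pos[of q0] q0 open_halfspace_Im_gt[of y]
      by (auto intro: holomorphic_on_imp_differentiable_at)
    then have "(\<lambda>q. u (g q)) field_differentiable (at q0)"
      using field_differentiable_compose[OF dg] by (simp add: o_def)
    moreover have ev: "\<forall>\<^sub>F q in nhds q0. u (g q) = G q"
    proof -
      have "\<forall>\<^sub>F q in nhds q0. q \<in> ball 0 (exp (- pi * y)) - {0}"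
        by (rule eventually_nhds_in_open) (use q0 in auto)
      then show ?thesis
        by eventually_elim (use eq[OF pos] g in auto)
    qed
    ultimately show ?thesis
      unfolding field_differentiable_def DERIV_cong_ev[OF refl ev refl] by blast
  qed
  then show "G holomorphic_on ball 0 (exp (- pi * y)) - {0}"
    by (auto simp: holomorphic_on_def intro: field_differentiable_at_within)
qed

text \<open>Riemann's theorem extends the function of the nome over 0; c is its value there, and
  differentiability gives the linear error.\<close>

lemma periodic_bounded_limit:
  assumes hol: "u holomorphic_on {\<tau>. Im \<tau> > y}" and per: "\<And>\<tau>. Im \<tau> > y \<Longrightarrow> u (\<tau> + 2) = u \<tau>"
    and bd: "\<And>\<tau>. Im \<tau> > y \<Longrightarrow> norm (u \<tau>) \<le> B"
  shows "\<exists>c C. \<forall>\<^sub>F \<tau> in at_ii_inf. norm (u \<tau> - c) \<le> C * norm (nome \<tau>)"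
proof -
  obtain G where G: "G holomorphic_on ball 0 (exp (- pi * y)) - {0}" "\<And>\<tau>. Im \<tau> > y \<Longrightarrow> u \<tau> = G (nome \<tau>)"
    using periodic_imp_analytic_in_nome[OF hol per] by blast
  define r where "r = exp (- pi * y)"
  have "r > 0" by (simp add: r_def)
  have bdG: "norm (G q) \<le> B" if q: "norm q < r" "q \<noteq> 0" for q
  proof -
    define \<tau> where "\<tau> = Ln q / (\<i> * of_real pi)"
    have n: "nome \<tau> = q" using q by (simp add: \<tau>_def nome_def)
    have "exp (- pi * Im \<tau>) < exp (- pi * y)" using q norm_nome[of \<tau>] by (simp add: n r_def)
    then have "Im \<tau> > y" by simp
    then show ?thesis using bd G(2) n by metis
  qed
  have "\<forall>\<^sub>F q in at 0. norm (G q) \<le> B"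
    unfolding eventually_at using bdG \<open>r > 0\<close> by (intro exI[of _ r]) auto
  then obtain g where g: "g holomorphic_on ball 0 r" "\<And>q. q \<in> ball 0 r - {0} \<Longrightarrow> g q = G q"
    using holomorphic_on_extend_bounded[of G "ball 0 r" 0] G(1) \<open>r > 0\<close>
    unfolding r_def [symmetric] by auto
  have "(g has_field_derivative deriv g 0) (at 0)"
    using g(1) \<open>r > 0\<close> by (auto intro: holomorphic_derivI[of _ "ball 0 r"])
  then have "((\<lambda>q. norm ((g q - g 0) / q)) \<longlongrightarrow> norm (deriv g 0)) (at 0)"
    by (intro tendsto_norm) (simp add: has_field_derivative_iff)
  then have "\<forall>\<^sub>F q in at 0. norm ((g q - g 0) / q) < norm (deriv g 0) + 1"
    by (rule order_tendstoD) simp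
  then have "\<forall>\<^sub>F \<tau> in at_ii_inf. norm ((g (nome \<tau>) - g 0) / nome \<tau>) < norm (deriv g 0) + 1"
    by (rule eventually_compose_filterlim[OF _ filterlim_nome])
  moreover have "\<forall>\<^sub>F \<tau> in at_ii_inf. norm (nome \<tau>) < r"
    using order_tendstoD(2)[OF tendsto_norm[OF tendsto_nome], of r] \<open>r > 0\<close> by simp
  ultimately have "\<forall>\<^sub>F \<tau> in at_ii_inf. norm (u \<tau> - g 0) \<le> (norm (deriv g 0) + 1) * norm (nome \<tau>)"
    using eventually_at_ii_inf_gt[of y]
  proof eventually_elim
    case (elim \<tau>)
    then have "u \<tau> = g (nome \<tau>)" using G(2) g(2) by simp
    then show ?case using elim(1) by (simp add: norm_divide field_simps)
  qed
  then show ?thesis by blast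
qed

text \<open>T^2 is trivial modulo 2, hence so is its conjugate A T^2 A^(-1); thus 2 is a period at
  every cusp.\<close>

lemma Gamma2_invariant_compose_period:
  assumes "Gamma2_invariant f" "det A = 1" "Im \<tau> > 0"
  shows "f (moebius A (\<tau> + 2)) = f (moebius A \<tau>)"
proof -
  define g where "g = A ** (matT 2 ** adj A)"
  have det: "det g = 1" "det (matT 2 ** adj A) = 1" using assms by (simp_all add: g_def det_mul)
  have "g \<in> Gamma2"
    unfolding Gamma2_def using det assms(2)
    by (auto simp: g_def matT_def det_2 algebra_simps)
  moreover have "moebius A (\<tau> + 2) = moebius g (moebius A \<tau>)"
  proof -
    have "g ** A = A ** matT 2"
      by (simp add: g_def matrix_mul_assoc [symmetric] adj_mult assms)
    then show ?thesis
      using assms det moebius_mult[of \<tau> g A] moebius_mult[of \<tau> A "matT 2"] by (simp add: moebius_matT)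
  qed
  ultimately show ?thesis
    using assms Im_moebius_pos by (simp add: Gamma2_invariant_def)
qed

lemma Gamma2_invariant_cusp_limit:
  assumes hol: "h holomorphic_on upper_half_plane" and inv: "Gamma2_invariant h"
    and A: "det A = 1" and bd: "\<forall>\<^sub>F \<tau> in at_ii_inf. norm (h (moebius A \<tau>)) \<le> B"
  shows "\<exists>c C. \<forall>\<^sub>F \<tau> in at_ii_inf. norm (h (moebius A \<tau>) - c) \<le> C * norm (nome \<tau>)"
proof -
  obtain y where y: "\<And>\<tau>. Im \<tau> > y \<Longrightarrow> norm (h (moebius A \<tau>)) \<le> B"
    using bd unfolding eventually_at_ii_inf by blast
  show ?thesis
  proof (rule periodic_bounded_limit[where y = "max y 0" and B = B])
    show "(\<lambda>\<tau>. h (moebius A \<tau>)) holomorphic_on {\<tau>. Im \<tau> > max y 0}"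
      by (rule holomorphic_on_subset[OF holomorphic_on_moebius_compose[OF hol A]]) auto
  qed (use y Gamma2_invariant_compose_period[OF inv A] in auto)
qed

text \<open>The limits at different cusps may differ a priori, so no single constant can be
  subtracted. The product of h - c A over the representatives vanishes at all cusps, hence
  identically; h takes finitely many values, and connectedness makes it constant.\<close>

lemma bounded_imp_constant:
  assumes hol: "h holomorphic_on upper_half_plane" and inv: "Gamma2_invariant h"
    and bd: "\<And>\<tau>. Im \<tau> > 0 \<Longrightarrow> norm (h \<tau>) \<le> B"
  shows "\<exists>c. \<forall>\<tau>. Im \<tau> > 0 \<longrightarrow> h \<tau> = c"
proof -
  obtain R where R: "finite R" "\<And>A. A \<in> R \<Longrightarrow> det A = 1"
    "\<And>B. det B = 1 \<Longrightarrow> \<exists>A\<in>R. \<exists>g\<in>Gamma2. B = g ** A"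
    using finite_representatives by blast
  have "\<exists>c. ((\<lambda>\<tau>. h (moebius A \<tau>)) \<longlongrightarrow> c) at_ii_inf" if A: "det A = 1" for A
  proof -
    have "\<forall>\<^sub>F \<tau> in at_ii_inf. norm (h (moebius A \<tau>)) \<le> B"
      using eventually_at_ii_inf_gt[of 0] by eventually_elim (use bd Im_moebius_pos A in auto)
    then obtain c C where c: "\<forall>\<^sub>F \<tau> in at_ii_inf. norm (h (moebius A \<tau>) - c) \<le> C * norm (nome \<tau>)"
      using Gamma2_invariant_cusp_limit[OF hol inv A] by blast
    have "((\<lambda>\<tau>. C * norm (nome \<tau>)) \<longlongrightarrow> C * norm (0::complex)) at_ii_inf"
      by (intro tendsto_intros tendsto_nome)
    then have "((\<lambda>\<tau>. h (moebius A \<tau>) - c) \<longlongrightarrow> 0) at_ii_inf"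
      by (intro Lim_null_comparison[OF c]) simp
    then show ?thesis by (auto simp: LIM_zero_iff)
  qed
  then obtain c where c: "\<And>A. det A = 1 \<Longrightarrow> ((\<lambda>\<tau>. h (moebius A \<tau>)) \<longlongrightarrow> c A) at_ii_inf"
    by metis
  define H where "H = (\<lambda>\<tau>. \<Prod>A\<in>R. h \<tau> - c A)"
  have "H holomorphic_on upper_half_plane" unfolding H_def by (intro holomorphic_intros hol)
  moreover have "Gamma2_invariant H" using inv by (simp add: H_def Gamma2_invariant_def)
  moreover have "((\<lambda>\<tau>. H (moebius B \<tau>)) \<longlongrightarrow> 0) at_ii_inf" if B: "det B = 1" for B
  proof -
    obtain A g where A: "A \<in> R" "g \<in> Gamma2" "B = g ** A" using R(3)[OF B] by blast
    have "((\<lambda>\<tau>. H (moebius A \<tau>)) \<longlongrightarrow> (\<Prod>A'\<in>R. c A - c A')) at_ii_inf"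
      unfolding H_def by (intro tendsto_intros c R(2) A)
    also have "(\<Prod>A'\<in>R. c A - c A') = 0" using A R(1) by (auto intro: prod_zero)
    finally have *: "((\<lambda>\<tau>. H (moebius A \<tau>)) \<longlongrightarrow> 0) at_ii_inf" .
    have "\<forall>\<^sub>F \<tau> in at_ii_inf. H (moebius A \<tau>) = H (moebius B \<tau>)"
      using eventually_at_ii_inf_gt[of 0]
    proof eventually_elim
      case (elim \<tau>)
      have "h (moebius B \<tau>) = h (moebius A \<tau>)"
        using elim A R(2) Gamma2_det inv Im_moebius_pos
        by (simp add: moebius_mult Gamma2_invariant_def)
      then show ?case by (simp add: H_def)
    qed
    with * show ?thesis by (simp add: tendsto_cong)
  qed
  ultimately have "H \<tau> = 0" if "Im \<tau> > 0" for \<tau>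
    using vanish_at_cusps_imp_zero that by blast
  then have "h ` upper_half_plane \<subseteq> c ` R"
    using R(1) by (auto simp: H_def)
  then have "finite (h ` upper_half_plane)" using R(1) finite_surj by blast
  then have "h constant_on upper_half_plane"
    by (intro continuous_finite_range_constant connected_upper_half_plane holomorphic_on_imp_continuous_on hol)
  then show ?thesis by (auto simp: constant_on_def)
qed

text \<open>The value 0 is approached only at the cusp infinity. Reduce \<tau> to \<tau>' in the
  strip. On the compact part all six anharmonic values are bounded away from 0. Above it |lam
  \<tau>'| < 1/2, and the four values that belong to an odd lower left entry have norm at least 1/2.
  The remaining matrices lie in \<open>Gamma2\<close>, possibly after \<tau>' is moved to \<tau>' +
  1.\<close>

lemma lam_near_0:
  shows "\<exists>\<epsilon>>0. \<forall>\<tau>. Im \<tau> > 0 \<longrightarrow> norm (lam \<tau>) < \<epsilon> \<longrightarrow> (\<exists>g\<in>Gamma2. \<exists>\<tau>'. Im \<tau>' > y \<and> Im \<tau>' > 0 \<and> \<tau> = moebius g \<tau>')"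
proof -
  have "\<forall>\<^sub>F \<tau> in at_ii_inf. norm (lam \<tau>) < 1/2"
    using order_tendstoD(2)[OF tendsto_norm[OF lam_tendsto], of "1/2"] by simp
  then obtain y1 where y1: "\<And>\<tau>. Im \<tau> > y1 \<Longrightarrow> norm (lam \<tau>) < 1/2"
    unfolding eventually_at_ii_inf by blast
  define y2 where "y2 = max y y1"
  define K where "K = {\<tau>. \<bar>Re \<tau>\<bar> \<le> 1/2 \<and> 1/2 \<le> Im \<tau> \<and> Im \<tau> \<le> y2}"
  have K: "compact K" "K \<subseteq> upper_half_plane" unfolding K_def by (rule compact_strip) auto
  have cont: "continuous_on K lam"
    using holomorphic_on_imp_continuous_on[OF holomorphic_on_lam] K(2) by (rule continuous_on_subset)
  define m where "m = (\<lambda>x::complex. Min {norm x, norm (x / (x - 1)), norm (1 - x), norm (1 / x), norm (1 / (1 - x)), norm ((x - 1) / x)})"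
  have "\<exists>\<epsilon>>0. \<forall>\<tau>\<in>K. m (lam \<tau>) \<ge> \<epsilon>"
  proof (cases "K = {}")
    case False
    have nz: "lam \<tau> \<noteq> 0" "lam \<tau> \<noteq> 1" if "\<tau> \<in> K" for \<tau>
      using lam_nonzero lam_neq_1 K(2) that by auto
    have "continuous_on K (\<lambda>\<tau>. m (lam \<tau>))"
      unfolding m_def using nz by (simp, intro continuous_intros cont) (auto)
    then obtain \<tau>0 where \<tau>0: "\<tau>0 \<in> K" "\<And>\<tau>. \<tau> \<in> K \<Longrightarrow> m (lam \<tau>0) \<le> m (lam \<tau>)"
      using continuous_attains_inf[OF K(1) False] by blast
    moreover have "m (lam \<tau>0) > 0" unfolding m_def using nz[OF \<tau>0(1)] by auto
    ultimately show ?thesis by blast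
  qed (auto intro: exI[of _ 1])
  then obtain \<epsilon> where \<epsilon>: "\<epsilon> > 0" "\<And>\<tau>. \<tau> \<in> K \<Longrightarrow> m (lam \<tau>) \<ge> \<epsilon>" by blast
  show ?thesis
  proof (intro exI[of _ "min \<epsilon> (1/2)"] conjI allI impI)
    show "min \<epsilon> (1/2) > 0" using \<epsilon> by simp
    fix \<tau> :: complex assume \<tau>: "Im \<tau> > 0" and small: "norm (lam \<tau>) < min \<epsilon> (1/2)"
    obtain A \<tau>' where A: "det A = 1" "\<tau> = moebius A \<tau>'" "\<bar>Re \<tau>'\<bar> \<le> 1/2" "Im \<tau>' \<ge> 1/2"
      using reduction_to_strip[OF \<tau>] by blast
    define x where "x = lam \<tau>'"
    have \<tau>': "Im \<tau>' > 0" using A by linarith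
    have nz: "x \<noteq> 0" "x \<noteq> 1" using lam_nonzero[OF \<tau>'] lam_neq_1[OF \<tau>'] by (auto simp: x_def)
    have cases: "even (A $ 2 $ 1) \<and> even (A $ 1 $ 2) \<and> lam \<tau> = x \<or>
     even (A $ 2 $ 1) \<and> odd (A $ 1 $ 2) \<and> lam \<tau> = x / (x - 1) \<or>
     odd (A $ 2 $ 1) \<and> lam \<tau> \<in> {1 - x, 1 / x, 1 / (1 - x), (x - 1) / x}"
      using lam_moebius[OF A(1) \<tau>'] by (simp add: A(2) x_def)
    then have "m x \<le> norm (lam \<tau>)"
      unfolding m_def by (intro Min_le) auto
    then have "\<tau>' \<notin> K" using \<epsilon>(2)[of \<tau>'] small by (auto simp: x_def)
    then have im: "Im \<tau>' > y2" using A by (auto simp: K_def)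
    then have x: "norm x < 1/2" using y1 by (simp add: x_def y2_def)
    have x1: "norm (1 - x) > 1/2" "norm (1 - x) < 3/2" "norm (x - 1) > 1/2"
      using x norm_triangle_ineq2[of 1 x] norm_triangle_ineq4[of 1 x] by (auto simp: norm_minus_commute)
    have "1/2 \<le> norm (1 - x)" "1/2 \<le> norm (1 / x)" "1/2 \<le> norm (1 / (1 - x))" "1/2 \<le> norm ((x - 1) / x)"
      using x x1 nz by (auto simp: norm_divide field_simps)
    then have "lam \<tau> \<notin> {1 - x, 1 / x, 1 / (1 - x), (x - 1) / x}"
      using small by auto
    then have ev: "even (A $ 2 $ 1)" using cases by blast
    have odd: "odd (A $ 1 $ 1 * A $ 2 $ 2 - A $ 1 $ 2 * A $ 2 $ 1)" using A(1) by (simp add: det_2)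
    show "\<exists>g\<in>Gamma2. \<exists>\<tau>'. Im \<tau>' > y \<and> Im \<tau>' > 0 \<and> \<tau> = moebius g \<tau>'"
    proof (cases "even (A $ 1 $ 2)")
      case True
      then have "A \<in> Gamma2" using ev odd A(1) by (auto simp: Gamma2_def)
      then show ?thesis using A(2) im \<tau>' by (auto simp: y2_def)
    next
      case False
      have "det (A ** matT (- 1)) = 1" using A(1) by (simp add: det_mul)
      then have "A ** matT (- 1) \<in> Gamma2" using False ev odd unfolding Gamma2_def
        by (simp add: matT_def del: det_mat2)
      moreover have "\<tau> = moebius (A ** matT (- 1)) (\<tau>' + 1)"
        using A \<tau>' by (simp add: moebius_mult moebius_matT)
      ultimately show ?thesis using im \<tau>' by (intro bexI[of _ "A ** matT (- 1)"] exI[of _ "\<tau>' + 1"]) (auto simp: y2_def)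
    qed
  qed
qed

text \<open>Subtracting the value at the cusp where \<open>lam\<close> vanishes and dividing by \<open>lam\<close> lowers the
  order of growth by one.\<close>

lemma polynomial_in_lam:
  assumes "h holomorphic_on upper_half_plane" "Gamma2_invariant h"
    and "\<And>\<tau>. Im \<tau> > 0 \<Longrightarrow> norm (h \<tau>) \<le> C * (1 + norm (lam \<tau>)) ^ m"
  shows "\<exists>p. \<forall>\<tau>. Im \<tau> > 0 \<longrightarrow> h \<tau> = poly p (lam \<tau>)"
  using assms
proof (induction m arbitrary: h C)
  case 0
  then obtain c where "\<And>\<tau>. Im \<tau> > 0 \<Longrightarrow> h \<tau> = c"
    using bounded_imp_constant[of h C] by auto
  then show ?case by (intro exI[of _ "[:c:]"]) simp
next
  case (Suc m)
  have Cpos: "C \<ge> 0"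
  proof -
    have "0 \<le> norm (h \<i>)" by simp
    also have "\<dots> \<le> C * (1 + norm (lam \<i>)) ^ Suc m" by (rule Suc.prems(3)) simp
    finally have "0 \<le> C * (1 + norm (lam \<i>)) ^ Suc m" .
    moreover have "(1 + norm (lam \<i>)) ^ Suc m > 0" by (intro zero_less_power add_pos_nonneg) auto
    ultimately show ?thesis by (simp add: zero_le_mult_iff)
  qed
  have "\<forall>\<^sub>F \<tau> in at_ii_inf. norm (lam \<tau>) < 1"
    using order_tendstoD(2)[OF tendsto_norm[OF lam_tendsto], of 1] by simp
  then have "\<forall>\<^sub>F \<tau> in at_ii_inf. norm (h (moebius (mat 1) \<tau>)) \<le> C * 2 ^ Suc m"
    using eventually_at_ii_inf_gt[of 0]
  proof eventually_elim
    case (elim \<tau>)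
    have "norm (h \<tau>) \<le> C * (1 + norm (lam \<tau>)) ^ Suc m" using Suc.prems(3) elim by blast
    also have "\<dots> \<le> C * 2 ^ Suc m" using elim Cpos by (intro mult_left_mono power_mono) auto
    finally show ?case by simp
  qed
  then obtain c C1 where "\<forall>\<^sub>F \<tau> in at_ii_inf. norm (h (moebius (mat 1) \<tau>) - c) \<le> C1 * norm (nome \<tau>)"
    using Gamma2_invariant_cusp_limit[OF Suc.prems(1,2) det_I] by blast
  then have "\<forall>\<^sub>F \<tau> in at_ii_inf. norm (h \<tau> - c) \<le> \<bar>C1\<bar> * norm (lam \<tau>)"
    using lam_nome_bounds
  proof eventually_elim
    case (elim \<tau>)
    have "norm (h \<tau> - c) \<le> C1 * norm (nome \<tau>)" using elim by simp
    also have "\<dots> \<le> \<bar>C1\<bar> * norm (lam \<tau>)" using elim by (intro mult_mono) auto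
    finally show ?case .
  qed
  then obtain y where y: "\<And>\<tau>. Im \<tau> > y \<Longrightarrow> norm (h \<tau> - c) \<le> \<bar>C1\<bar> * norm (lam \<tau>)"
    unfolding eventually_at_ii_inf by blast
  obtain \<epsilon> where \<epsilon>: "\<epsilon> > 0" "\<And>\<tau>. Im \<tau> > 0 \<Longrightarrow> norm (lam \<tau>) < \<epsilon> \<Longrightarrow>
      \<exists>g\<in>Gamma2. \<exists>\<tau>'. Im \<tau>' > y \<and> Im \<tau>' > 0 \<and> \<tau> = moebius g \<tau>'"
    using lam_near_0[of y] by blast
  define h2 where "h2 = (\<lambda>\<tau>. (h \<tau> - c) / lam \<tau>)"
  \<comment> \<open>The first term bounds \<open>h2\<close> where |lam| < \<epsilon>. Elsewhere (1 +
    |lam|) / |lam| \<le> 1 + 1 / \<epsilon> trades one power of 1 + |lam| for a constant.\<close>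
  define C2 where "C2 = \<bar>C1\<bar> + (C + norm c) * (1 + 1 / \<epsilon>)"
  have "h2 holomorphic_on upper_half_plane"
    unfolding h2_def by (intro holomorphic_intros Suc.prems holomorphic_on_lam) (simp add: lam_nonzero)
  moreover have "Gamma2_invariant h2"
    using Suc.prems(2) lam_invariant by (simp add: h2_def Gamma2_invariant_def)
  moreover have "norm (h2 \<tau>) \<le> C2 * (1 + norm (lam \<tau>)) ^ m" if \<tau>: "Im \<tau> > 0" for \<tau>
  proof -
    define b where "b = 1 + norm (lam \<tau>)"
    have b: "b \<ge> 1" by (simp add: b_def)
    then have bm: "b ^ m \<ge> 1" by simp
    show ?thesis
    proof (cases "norm (lam \<tau>) < \<epsilon>")
      case True
      then obtain g \<tau>' where g: "g \<in> Gamma2" "Im \<tau>' > y" "Im \<tau>' > 0" "\<tau> = moebius g \<tau>'"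
        using \<epsilon>(2)[OF \<tau>] by blast
      then have "h \<tau> = h \<tau>'" "lam \<tau> = lam \<tau>'"
        using Suc.prems(2) lam_invariant by (auto simp: Gamma2_invariant_def)
      then have "norm (h2 \<tau>) \<le> \<bar>C1\<bar>"
        using y[OF g(2)] lam_nonzero[OF \<tau>] by (simp add: h2_def norm_divide field_simps)
      also have "\<dots> \<le> C2" using Cpos \<epsilon>(1) by (simp add: C2_def)
      also have "C2 = C2 * 1" by simp
      also have "\<dots> \<le> C2 * b ^ m"
        using bm Cpos \<epsilon>(1) by (intro mult_left_mono) (auto simp: C2_def)
      finally show ?thesis by (simp add: b_def)
    next
      case False
      then have l: "norm (lam \<tau>) > 0" using \<epsilon>(1) by linarith
      have "norm (h \<tau> - c) \<le> norm (h \<tau>) + norm c" by (rule norm_triangle_ineq4)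
      also have "\<dots> \<le> C * b ^ Suc m + norm c * b ^ Suc m"
        using Suc.prems(3)[OF \<tau>] one_le_power[OF b, of "Suc m"]
        by (intro add_mono) (auto simp: b_def mult_le_cancel_left1)
      finally have "norm (h2 \<tau>) \<le> (C + norm c) * b ^ m * (b / norm (lam \<tau>))"
        using l by (simp add: h2_def norm_divide field_simps)
      also have "b / norm (lam \<tau>) \<le> 1 + 1 / \<epsilon>"
        using False \<epsilon>(1) l by (simp add: b_def add_divide_distrib frac_le)
      then have "(C + norm c) * b ^ m * (b / norm (lam \<tau>)) \<le> (C + norm c) * b ^ m * (1 + 1 / \<epsilon>)"
        using Cpos b by (intro mult_left_mono) auto
      also have "\<dots> \<le> C2 * b ^ m" using b by (simp add: C2_def algebra_simps)
      finally show ?thesis by (simp add: b_def)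
    qed
  qed
  ultimately obtain p where p: "\<And>\<tau>. Im \<tau> > 0 \<Longrightarrow> h2 \<tau> = poly p (lam \<tau>)"
    using Suc.IH by blast
  show ?case
  proof (intro exI[of _ "pCons c p"] allI impI)
    fix \<tau> :: complex assume \<tau>: "Im \<tau> > 0"
    then show "h \<tau> = poly (pCons c p) (lam \<tau>)"
      using p[OF \<tau>] lam_nonzero[OF \<tau>] by (simp add: h2_def field_simps)
  qed
qed

section \<open>Modular functions are rational in lambda\<close>

lemma meromorphic_growth:
  assumes "f meromorphic_on {z}"
  shows "\<exists>n B. \<forall>\<^sub>F w in at z. norm (f w) * norm (w - z) ^ n \<le> B"
proof (cases "is_pole f z")
  case True
  obtain r where r: "r > 0" "f holomorphic_on ball z r - {z}"
    using meromorphic_on_isolated_singularity[OF assms] analytic_imp_holomorphic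
    unfolding isolated_singularity_at_def by blast
  define n where "n = nat (- zorder f z)"
  define g where "g = zor_poly f z"
  obtain r' where r': "r' > 0" "g holomorphic_on cball z r'"
     "\<And>w. w \<in> cball z r' - {z} \<Longrightarrow> f w = g w / (w - z) ^ n"
    using zorder_exist_pole[OF r(2) open_ball _ True] r(1) unfolding n_def g_def by auto
  have "(g \<longlongrightarrow> g z) (at z)"
    using holomorphic_on_imp_continuous_on[OF holomorphic_on_subset[OF r'(2) ball_subset_cball]] r'(1)
    by (auto simp: continuous_on_eq_continuous_at isCont_def)
  then have "\<forall>\<^sub>F w in at z. norm (g w) < norm (g z) + 1"
    using order_tendstoD(2)[OF tendsto_norm] by fastforce
  moreover have "\<forall>\<^sub>F w in at z. w \<in> cball z r' - {z}"
    using r'(1) eventually_at_ball'[of r' z UNIV] by (auto elim!: eventually_mono)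
  ultimately have "\<forall>\<^sub>F w in at z. norm (f w) * norm (w - z) ^ n \<le> norm (g z) + 1"
    by eventually_elim (simp add: r'(3) norm_divide norm_power)
  then show ?thesis by blast
next
  case False
  then obtain l where "(f \<longlongrightarrow> l) (at z)"
    using meromorphic_on_not_essential[OF assms] by (auto simp: not_essential_def)
  then have "\<forall>\<^sub>F w in at z. norm (f w) < norm l + 1"
    using order_tendstoD(2)[OF tendsto_norm] by fastforce
  then have "\<forall>\<^sub>F w in at z. norm (f w) * norm (w - z) ^ 0 \<le> norm l + 1"
    by eventually_elim simp
  then show ?thesis by blast
qed

lemma poly_growth: "\<exists>C\<ge>0. \<exists>m. \<forall>x. norm (poly p x) \<le> C * (1 + norm x) ^ m" for p :: "complex poly"
proof (induction p)
  case (pCons a p)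
  then obtain C m where C: "C \<ge> 0" "\<And>x. norm (poly p x) \<le> C * (1 + norm x) ^ m" by blast
  have "norm (poly (pCons a p) x) \<le> (norm a + C) * (1 + norm x) ^ Suc m" for x
  proof -
    define b where "b = 1 + norm x"
    have b: "b \<ge> 1" by (simp add: b_def)
    have "norm (poly (pCons a p) x) \<le> norm a + norm x * norm (poly p x)"
      by (simp add: norm_mult [symmetric] norm_triangle_ineq)
    also have "\<dots> \<le> norm a * b ^ Suc m + b * (C * b ^ m)"
      using C one_le_power[OF b, of "Suc m"]
      by (intro add_mono mult_mono) (auto simp: b_def mult_le_cancel_left1)
    finally show ?thesis by (simp add: b_def algebra_simps)
  qed
  then show ?case using C(1) by (intro exI[of _ "norm a + C"] conjI exI[of _ "Suc m"]) auto
qed (auto intro: exI[of _ 0])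

text \<open>Clearing of poles is expressed as a growth estimate, which covers interior points and
  cusps alike. Powers of 1 + |lam| allow for the pole of \<open>lam\<close> itself, and denominators
  found on several sets can simply be multiplied.\<close>

definition lam_denominator :: "(complex \<Rightarrow> complex) \<Rightarrow> complex set \<Rightarrow> complex poly \<Rightarrow> bool" where
  "lam_denominator f S q \<longleftrightarrow> q \<noteq> 0 \<and>
     (\<exists>C\<ge>0. \<exists>m. \<forall>\<tau>\<in>S. norm (f \<tau> * poly q (lam \<tau>)) \<le> C * (1 + norm (lam \<tau>)) ^ m)"

lemma lam_denominator_mult:
  assumes "lam_denominator f S q" "q' \<noteq> 0"
  shows "lam_denominator f S (q * q')"
proof -
  obtain C m where C: "q \<noteq> 0" "C \<ge> 0" "\<And>\<tau>. \<tau> \<in> S \<Longrightarrow> norm (f \<tau> * poly q (lam \<tau>)) \<le> C * (1 + norm (lam \<tau>)) ^ m"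
    using assms unfolding lam_denominator_def by blast
  obtain C' m' where C': "C' \<ge> 0" "\<And>x. norm (poly q' x) \<le> C' * (1 + norm x) ^ m'"
    using poly_growth[of q'] by blast
  have "norm (f \<tau> * poly (q * q') (lam \<tau>)) \<le> C * C' * (1 + norm (lam \<tau>)) ^ (m + m')" if "\<tau> \<in> S" for \<tau>
  proof -
    have "norm (f \<tau> * poly (q * q') (lam \<tau>)) = norm (f \<tau> * poly q (lam \<tau>)) * norm (poly q' (lam \<tau>))"
      by (simp add: norm_mult mult.assoc)
    also have "\<dots> \<le> (C * (1 + norm (lam \<tau>)) ^ m) * (C' * (1 + norm (lam \<tau>)) ^ m')"
      using C C' that by (intro mult_mono) auto
    finally show ?thesis by (simp add: power_add mult_ac)
  qed
  moreover have "C * C' \<ge> 0" "q * q' \<noteq> 0" using C C' assms by auto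
  ultimately show ?thesis unfolding lam_denominator_def by blast
qed

lemma lam_denominator_Un:
  assumes "lam_denominator f S q" "lam_denominator f S' q'"
  shows "lam_denominator f (S \<union> S') (q * q')"
proof -
  have "lam_denominator f S (q * q')" "lam_denominator f S' (q * q')"
    using lam_denominator_mult[OF assms(1), of q'] lam_denominator_mult[OF assms(2), of q] assms
    by (auto simp: lam_denominator_def mult.commute)
  then obtain C m C' m' where C: "C \<ge> 0" "\<And>\<tau>. \<tau> \<in> S \<Longrightarrow> norm (f \<tau> * poly (q * q') (lam \<tau>)) \<le> C * (1 + norm (lam \<tau>)) ^ m"
    "C' \<ge> 0" "\<And>\<tau>. \<tau> \<in> S' \<Longrightarrow> norm (f \<tau> * poly (q * q') (lam \<tau>)) \<le> C' * (1 + norm (lam \<tau>)) ^ m'" "q * q' \<noteq> 0"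
    unfolding lam_denominator_def by blast
  have "norm (f \<tau> * poly (q * q') (lam \<tau>)) \<le> (C + C') * (1 + norm (lam \<tau>)) ^ max m m'" if "\<tau> \<in> S \<union> S'" for \<tau>
  proof -
    have "C * (1 + norm (lam \<tau>)) ^ m \<le> (C + C') * (1 + norm (lam \<tau>)) ^ max m m'"
      "C' * (1 + norm (lam \<tau>)) ^ m' \<le> (C + C') * (1 + norm (lam \<tau>)) ^ max m m'"
      using C(1,3) by (auto intro!: mult_mono power_increasing)
    then show ?thesis using C(2)[of \<tau>] C(4)[of \<tau>] that by force
  qed
  moreover have "C + C' \<ge> 0" using C by simp
  ultimately show ?thesis using C(5) unfolding lam_denominator_def by blast
qed

lemma lam_denominator_subset: "lam_denominator f S q \<Longrightarrow> S' \<subseteq> S \<Longrightarrow> lam_denominator f S' q"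
  unfolding lam_denominator_def by blast

lemma lam_denominator_UN:
  assumes "finite I" "\<And>i. i \<in> I \<Longrightarrow> \<exists>q. lam_denominator f (S i) q"
  shows "\<exists>q. lam_denominator f (\<Union>i\<in>I. S i) q"
  using assms
proof (induction I rule: finite_induct)
  case empty
  show ?case by (rule exI[of _ 1]) (auto simp: lam_denominator_def)
next
  case (insert i I)
  then obtain q q' where "lam_denominator f (\<Union>i\<in>I. S i) q" "lam_denominator f (S i) q'" by blast
  then show ?case using lam_denominator_Un[of f "S i" q' "\<Union>i\<in>I. S i" q] by auto
qed

text \<open>The difference \<open>lam w - lam z\<close> is O(w - z), so its n-th power clears a pole
  of order n at z.\<close>

lemma lam_denominator_local:
  assumes f: "f nicely_meromorphic_on upper_half_plane" and z: "Im z > 0"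
  shows "\<exists>U q. open U \<and> z \<in> U \<and> lam_denominator f U q"
proof -
  have mero: "f meromorphic_on {z}"
    using f z meromorphic_on_subset unfolding nicely_meromorphic_on_def by blast
  obtain n B where nB: "\<forall>\<^sub>F w in at z. norm (f w) * norm (w - z) ^ n \<le> B"
    using meromorphic_growth[OF mero] by blast
  define q where "q = [:- lam z, 1:] ^ n"
  have "(lam has_field_derivative deriv lam z) (at z)"
    using holomorphic_derivI[OF holomorphic_on_lam open_upper_half_plane] z by simp
  then have "((\<lambda>w. norm ((lam w - lam z) / (w - z))) \<longlongrightarrow> norm (deriv lam z)) (at z)"
    by (intro tendsto_norm) (simp add: has_field_derivative_iff)
  then have "\<forall>\<^sub>F w in at z. norm ((lam w - lam z) / (w - z)) < norm (deriv lam z) + 1"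
    by (rule order_tendstoD) simp
  moreover have "\<forall>\<^sub>F w in at z. w \<noteq> z" by (simp add: eventually_at_filter)
  ultimately have "\<forall>\<^sub>F w in at z. norm (f w * poly q (lam w)) \<le> \<bar>B\<bar> * (norm (deriv lam z) + 1) ^ n"
    using nB
  proof eventually_elim
    case (elim w)
    have "norm (lam w - lam z) \<le> (norm (deriv lam z) + 1) * norm (w - z)"
      using elim by (simp add: norm_divide field_simps)
    then have "norm (lam w - lam z) ^ n \<le> ((norm (deriv lam z) + 1) * norm (w - z)) ^ n"
      by (intro power_mono) auto
    then have "norm (f w * poly q (lam w)) \<le> norm (f w) * ((norm (deriv lam z) + 1) * norm (w - z)) ^ n"
      by (simp add: q_def poly_power norm_mult norm_power mult_left_mono)
    also have "\<dots> = (norm (f w) * norm (w - z) ^ n) * (norm (deriv lam z) + 1) ^ n"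
      by (simp add: power_mult_distrib mult_ac)
    also have "\<dots> \<le> \<bar>B\<bar> * (norm (deriv lam z) + 1) ^ n"
      using elim by (intro mult_right_mono) auto
    finally show ?case .
  qed
  then obtain U where U: "open U" "z \<in> U"
    "\<And>w. w \<in> U \<Longrightarrow> w \<noteq> z \<Longrightarrow> norm (f w * poly q (lam w)) \<le> \<bar>B\<bar> * (norm (deriv lam z) + 1) ^ n"
    unfolding eventually_at_topological by blast
  \<comment> \<open>The maximum covers z itself, where f may have its conventional value at a
    pole.\<close>
  define C where "C = max (\<bar>B\<bar> * (norm (deriv lam z) + 1) ^ n) (norm (f z * poly q (lam z)))"
  have "norm (f w * poly q (lam w)) \<le> C * (1 + norm (lam w)) ^ 0" if "w \<in> U" for w
    using U(3)[OF that] by (cases "w = z") (auto simp: C_def max_def)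
  moreover have "C \<ge> 0" by (simp add: C_def le_max_iff_disj)
  moreover have "q \<noteq> 0" by (simp add: q_def)
  ultimately have "lam_denominator f U q" unfolding lam_denominator_def by blast
  then show ?thesis using U by blast
qed

text \<open>Here x is a small value of \<open>lam\<close> near infinity and y its value at the
  transformed point near another cusp. For y near 0 or 1 the product y (1 - y) is O(x). For y near
  infinity it has size x^(-2), which is also the size of x (1 + |y|)^3; this explains the exponent
  3.\<close>

lemma anharmonic_bound:
  fixes x y :: complex
  assumes x: "x \<noteq> 0" "norm x \<le> 1/2"
    and y: "y \<in> {x, x / (x - 1), 1 - x, 1 / x, 1 / (1 - x), (x - 1) / x}"
  shows "norm (y * (1 - y)) \<le> 16 * norm x * (1 + norm y) ^ 3"
proof -
  define t where "t = norm x"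
  define s where "s = norm (1 - x)"
  have t: "0 < t" "t \<le> 1/2" using x by (auto simp: t_def)
  have s: "1/2 \<le> s" "s \<le> 3/2"
    using x norm_triangle_ineq2[of 1 x] norm_triangle_ineq4[of 1 x] by (auto simp: s_def)
  have x1: "x \<noteq> 1" using x(2) by auto
  have one: "1 \<le> (1 + norm y) ^ 3" by (rule one_le_power) simp
  have bound: ?thesis if "norm (y * (1 - y)) \<le> 16 * t"
  proof -
    have "16 * t * 1 \<le> 16 * t * (1 + norm y) ^ 3" using one t by (intro mult_left_mono) auto
    then show ?thesis using that by (simp add: t_def)
  qed
  have ts: "t / s\<^sup>2 \<le> 16 * t"
  proof -
    have "(1/2)\<^sup>2 \<le> s\<^sup>2" using s by (intro power_mono) auto
    then have "t * 1 \<le> t * (16 * s\<^sup>2)" using t by (intro mult_left_mono) (auto simp: power_divide)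
    then show ?thesis using s by (simp add: field_simps)
  qed
  \<comment> \<open>The members of each pair are exchanged by y to 1 - y, which preserves y (1 -
    y).\<close>
  consider "y = x \<or> y = 1 - x" | "y = x / (x - 1) \<or> y = 1 / (1 - x)" | "y = 1 / x \<or> y = (x - 1) / x"
    using y by blast
  then show ?thesis
  proof cases
    case 1
    then have "norm (y * (1 - y)) = t * s" by (auto simp: t_def s_def norm_mult)
    also have "\<dots> \<le> t * 16" using s t by (intro mult_left_mono) auto
    finally show ?thesis using bound by simp
  next
    case 2
    then have "y * (1 - y) = - (x / (1 - x)\<^sup>2)"
    proof
      assume y: "y = x / (x - 1)"
      then have y': "1 - y = - 1 / (x - 1)" using x1 by (simp add: field_simps)
      have "y * (1 - y) = x / (x - 1) * (- 1 / (x - 1))" unfolding y' unfolding y ..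
      then show ?thesis unfolding power2_commute[of 1 x] by (simp add: power2_eq_square)
    next
      assume y: "y = 1 / (1 - x)"
      then have "1 - y = - x / (1 - x)" using x1 by (simp add: field_simps)
      then show ?thesis using y x1 by (simp add: power2_eq_square)
    qed
    then have "norm (y * (1 - y)) = t / s\<^sup>2"
      by (simp add: t_def s_def norm_divide norm_power)
    then show ?thesis using bound ts by simp
  next
    case 3
    then have "y * (1 - y) = (x - 1) / x\<^sup>2"
    proof
      assume y: "y = 1 / x"
      then have "1 - y = (x - 1) / x" using x by (simp add: field_simps)
      then show ?thesis using y by (simp add: power2_eq_square)
    next
      assume y: "y = (x - 1) / x"
      then have "1 - y = 1 / x" using x by (simp add: field_simps)
      then show ?thesis using y by (simp add: power2_eq_square)
    qed
    then have "norm (y * (1 - y)) = s / t\<^sup>2"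
      by (simp add: t_def s_def norm_divide norm_power norm_minus_commute)
    also have "\<dots> \<le> (3/2) / t\<^sup>2" using s t by (intro divide_right_mono) auto
    \<comment> \<open>Rounding 3/2 up to 2 gives exactly 16 t (1 / (2 t))^3; the constant 16 of the
      statement fits this case.\<close>
    also have "\<dots> \<le> 2 / t\<^sup>2" by (intro divide_right_mono) auto
    also have "\<dots> = 16 * t * (1 / (2 * t)) ^ 3"
      using t by (simp add: power_divide power_mult_distrib power2_eq_square power3_eq_cube)
    also have "\<dots> \<le> 16 * t * (1 + norm y) ^ 3"
    proof (intro mult_left_mono power_mono)
      have "norm y = 1 / t \<or> norm y = s / t" using 3 by (auto simp: t_def s_def norm_divide norm_minus_commute)
      moreover have "1 / (2 * t) \<le> 1 / t" "1 / (2 * t) \<le> s / t" using t s by (auto simp: field_simps)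
      ultimately show "1 / (2 * t) \<le> 1 + norm y" by auto
    qed (use t in auto)
    finally show ?thesis by (simp add: t_def)
  qed
qed

text \<open>The function lam (1 - lam) tends to 0 at the cusps where \<open>lam\<close> tends to 0
  or 1, and where \<open>lam\<close> is infinite its growth is permitted. A power of it therefore
  clears the pole of f at any cusp.\<close>

lemma lam_denominator_cusp:
  assumes "meromorphic_at_cusps f" and A: "det A = 1"
  shows "\<exists>y q. lam_denominator f (moebius A ` {\<tau>. Im \<tau> > y}) q"
proof -
  obtain h y F where h: "h > (0::nat)" "F meromorphic_on {0}"
    "\<And>\<tau>. Im \<tau> > y \<Longrightarrow> f (moebius A \<tau>) = F (exp (2 * of_real pi * \<i> * \<tau> / of_nat h))"
  proof -
    have "\<exists>h::nat. h > 0 \<and> (\<exists>F. F meromorphic_on {0} \<and>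
        (\<exists>y>0. \<forall>\<tau>. Im \<tau> > y \<longrightarrow> f (moebius A \<tau>) = F (exp (2 * of_real pi * \<i> * \<tau> / of_nat h))))"
      using assms unfolding meromorphic_at_cusps_def SL2Z_def by simp
    then show ?thesis using that by blast
  qed
  obtain n B where nB: "\<forall>\<^sub>F w in at 0. norm (F w) * norm (w - 0) ^ n \<le> B"
    using meromorphic_growth[OF h(2)] by blast
  define s where "s = (\<lambda>\<tau>. exp (2 * of_real pi * \<i> * \<tau> / of_nat h))"
  have "(s \<longlongrightarrow> 0) at_ii_inf"
  proof -
    have "2 * pi / of_nat h > 0" using h by simp
    moreover have "s = (\<lambda>\<tau>. exp (\<i> * of_real (2 * pi / of_nat h) * \<tau>))"
      by (auto simp: s_def fun_eq_iff mult_ac)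
    ultimately show ?thesis using tendsto_exp_at_ii_inf by metis
  qed
  then have "filterlim s (at 0) at_ii_inf" by (auto simp: filterlim_at s_def)
  then have e1: "\<forall>\<^sub>F \<tau> in at_ii_inf. norm (F (s \<tau>)) * norm (s \<tau>) ^ n \<le> B"
    using eventually_compose_filterlim[OF nB] by simp
  \<comment> \<open>The exponent is 2 n because |s|^n has to be dominated from below:
    \<open>norm (nome \<tau>) ^ 2\<close> is at most \<open>norm (s \<tau>)\<close>.\<close>
  define q :: "complex poly" where "q = ([:0, 1:] * [:1, -1:]) ^ (2 * n)"
  have q: "poly q x = (x * (1 - x)) ^ (2 * n)" for x
    by (simp add: q_def poly_power)
  have e2: "\<forall>\<^sub>F \<tau> in at_ii_inf. norm (lam \<tau>) < 1/2"
    using order_tendstoD(2)[OF tendsto_norm[OF lam_tendsto], of "1/2"] by simp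
  \<comment> \<open>512 is 16 * 32, from \<open>anharmonic_bound\<close> and
    \<open>lam_nome_bounds\<close>.\<close>
  have "\<forall>\<^sub>F \<tau> in at_ii_inf. norm (f (moebius A \<tau>) * poly q (lam (moebius A \<tau>))) \<le>
     \<bar>B\<bar> * 512 ^ (2 * n) * (1 + norm (lam (moebius A \<tau>))) ^ (6 * n)"
    using e1 e2 lam_nome_bounds eventually_at_ii_inf_gt[of "max y 0"]
  proof eventually_elim
    case (elim \<tau>)
    define v where "v = lam (moebius A \<tau>)"
    have "norm (nome \<tau>) ^ 2 \<le> norm (s \<tau>)"
    proof -
      have "norm (nome \<tau>) ^ 2 = exp (- 2 * pi * Im \<tau>)"
        by (simp add: norm_nome flip: exp_of_nat_mult)
      also have "\<dots> \<le> exp (- 2 * pi * Im \<tau> / of_nat h)"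
      proof -
        have "2 * pi * Im \<tau> / of_nat h \<le> 2 * pi * Im \<tau> / 1"
          using h(1) elim by (intro divide_left_mono) auto
        then show ?thesis by simp
      qed
      also have "\<dots> = norm (s \<tau>)" by (simp add: s_def)
      finally show ?thesis .
    qed
    then have nn: "norm (nome \<tau>) ^ (2 * n) \<le> norm (s \<tau>) ^ n"
      unfolding power_mult by (intro power_mono) auto
    have "v \<in> {lam \<tau>, lam \<tau> / (lam \<tau> - 1), 1 - lam \<tau>, 1 / lam \<tau>, 1 / (1 - lam \<tau>), (lam \<tau> - 1) / lam \<tau>}"
      using lam_moebius[OF A, of \<tau>] elim by (auto simp: v_def)
    then have "norm (v * (1 - v)) \<le> 16 * norm (lam \<tau>) * (1 + norm v) ^ 3"
      using lam_nonzero[of \<tau>] elim by (intro anharmonic_bound) auto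
    also have "\<dots> \<le> 16 * (32 * norm (nome \<tau>)) * (1 + norm v) ^ 3"
      using elim by (intro mult_right_mono mult_left_mono) auto
    finally have "norm (v * (1 - v)) ^ (2 * n) \<le> (512 * norm (nome \<tau>) * (1 + norm v) ^ 3) ^ (2 * n)"
      by (intro power_mono) auto
    also have "\<dots> = 512 ^ (2 * n) * norm (nome \<tau>) ^ (2 * n) * (1 + norm v) ^ (6 * n)"
      by (simp add: power_mult_distrib flip: power_mult)
    also have "\<dots> \<le> 512 ^ (2 * n) * norm (s \<tau>) ^ n * (1 + norm v) ^ (6 * n)"
      by (intro mult_right_mono mult_left_mono nn) auto
    finally have V: "norm (poly q v) \<le> 512 ^ (2 * n) * norm (s \<tau>) ^ n * (1 + norm v) ^ (6 * n)"
      by (simp add: q norm_power)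
    have "norm (f (moebius A \<tau>) * poly q v) = norm (F (s \<tau>)) * norm (poly q v)"
      using h(3)[of \<tau>] elim by (simp add: s_def norm_mult)
    also have "\<dots> \<le> norm (F (s \<tau>)) * (512 ^ (2 * n) * norm (s \<tau>) ^ n * (1 + norm v) ^ (6 * n))"
      by (intro mult_left_mono V) auto
    also have "\<dots> = (norm (F (s \<tau>)) * norm (s \<tau>) ^ n) * (512 ^ (2 * n) * (1 + norm v) ^ (6 * n))"
      by (simp add: mult_ac)
    also have "\<dots> \<le> \<bar>B\<bar> * (512 ^ (2 * n) * (1 + norm v) ^ (6 * n))"
      using elim by (intro mult_right_mono) auto
    finally show ?case by (simp add: v_def mult_ac)
  qed
  then obtain y' where y': "\<And>\<tau>. Im \<tau> > y' \<Longrightarrow> norm (f (moebius A \<tau>) * poly q (lam (moebius A \<tau>))) \<le>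
     \<bar>B\<bar> * 512 ^ (2 * n) * (1 + norm (lam (moebius A \<tau>))) ^ (6 * n)"
    unfolding eventually_at_ii_inf by blast
  have "q \<noteq> 0" by (auto simp: q_def)
  moreover have "\<forall>\<tau>\<in>moebius A ` {\<tau>. Im \<tau> > y'}. norm (f \<tau> * poly q (lam \<tau>)) \<le> \<bar>B\<bar> * 512 ^ (2 * n) * (1 + norm (lam \<tau>)) ^ (6 * n)"
    using y' by auto
  moreover have "\<bar>B\<bar> * 512 ^ (2 * n) \<ge> 0" by simp
  ultimately have "lam_denominator f (moebius A ` {\<tau>. Im \<tau> > y'}) q"
    unfolding lam_denominator_def by blast
  then show ?thesis by blast
qed

text \<open>Each translate of the strip lies in a cusp neighbourhood together with a compact part,
  and finitely many local denominators serve the compact part. Invariance of f and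
  \<open>lam\<close> spreads the estimate to the whole half plane.\<close>

lemma lam_denominator_exists:
  assumes f: "f nicely_meromorphic_on upper_half_plane" "Gamma2_invariant f" "meromorphic_at_cusps f"
  shows "\<exists>q. lam_denominator f upper_half_plane q"
proof -
  obtain R where R: "finite R" "\<And>A. A \<in> R \<Longrightarrow> det A = 1"
    "\<And>B. det B = 1 \<Longrightarrow> \<exists>A\<in>R. \<exists>g\<in>Gamma2. B = g ** A"
    using finite_representatives by blast
  define D where "D = {\<tau>. \<bar>Re \<tau>\<bar> \<le> 1/2 \<and> 1/2 \<le> Im \<tau>}"
  have "\<exists>q. lam_denominator f (moebius A ` D) q" if A: "A \<in> R" for A
  proof -
    obtain y q where q: "lam_denominator f (moebius A ` {\<tau>. Im \<tau> > y}) q"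
      using lam_denominator_cusp[OF f(3) R(2)[OF A]] by blast
    define K where "K = {\<tau>. \<bar>Re \<tau>\<bar> \<le> 1/2 \<and> 1/2 \<le> Im \<tau> \<and> Im \<tau> \<le> y}"
    have KH: "K \<subseteq> upper_half_plane" by (auto simp: K_def)
    have cK: "compact (moebius A ` K)"
    proof (rule compact_continuous_image)
      show "continuous_on K (moebius A)"
        using holomorphic_on_imp_continuous_on[OF holomorphic_on_moebius[OF R(2)[OF A]]] KH
        by (rule continuous_on_subset)
      show "compact K" unfolding K_def by (rule compact_strip)
    qed
    have "Im z > 0" if "z \<in> moebius A ` K" for z
      using that KH Im_moebius_pos[OF _ R(2)[OF A]] by auto
    then have "\<exists>U q. open U \<and> z \<in> U \<and> lam_denominator f U q" if "z \<in> moebius A ` K" for z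
      using lam_denominator_local[OF f(1)] that by blast
    then obtain U Q where U: "\<And>z. z \<in> moebius A ` K \<Longrightarrow> open (U z) \<and> z \<in> U z \<and> lam_denominator f (U z) (Q z)"
      by metis
    then have "\<And>z. z \<in> moebius A ` K \<Longrightarrow> open (U z)" "moebius A ` K \<subseteq> (\<Union>z\<in>moebius A ` K. U z)"
      by blast+
    then obtain I where I: "I \<subseteq> moebius A ` K" "finite I" "moebius A ` K \<subseteq> (\<Union>z\<in>I. U z)"
      by (rule compactE_image[OF cK])
    obtain q' where q': "lam_denominator f (\<Union>z\<in>I. U z) q'"
      using lam_denominator_UN[OF I(2), of f U] U I(1) by blast
    have "moebius A ` D \<subseteq> moebius A ` {\<tau>. Im \<tau> > y} \<union> (\<Union>z\<in>I. U z)"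
      using I(3) by (force simp: D_def K_def)
    then show ?thesis using lam_denominator_subset[OF lam_denominator_Un[OF q q']] by blast
  qed
  then obtain q where q: "lam_denominator f (\<Union>A\<in>R. moebius A ` D) q"
    using lam_denominator_UN[OF R(1), of f "\<lambda>A. moebius A ` D"] by blast
  then obtain C m where C: "q \<noteq> 0" "C \<ge> 0" "\<And>A \<tau>. A \<in> R \<Longrightarrow> \<tau> \<in> D \<Longrightarrow>
      norm (f (moebius A \<tau>) * poly q (lam (moebius A \<tau>))) \<le> C * (1 + norm (lam (moebius A \<tau>))) ^ m"
    unfolding lam_denominator_def by blast
  have "norm (f \<tau> * poly q (lam \<tau>)) \<le> C * (1 + norm (lam \<tau>)) ^ m" if \<tau>: "\<tau> \<in> upper_half_plane" for \<tau>
  proof -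
    obtain g A \<tau>' where *: "g \<in> Gamma2" "A \<in> R" "\<tau> = moebius g (moebius A \<tau>')" "\<bar>Re \<tau>'\<bar> \<le> 1/2" "Im \<tau>' \<ge> 1/2"
      using Gamma2_decomposition[OF R(3,2), of \<tau>] \<tau> by auto
    have "Im (moebius A \<tau>') > 0" using * R(2) by (intro Im_moebius_pos) auto
    then have "f \<tau> = f (moebius A \<tau>')" "lam \<tau> = lam (moebius A \<tau>')"
      using f(2) lam_invariant *(1) unfolding *(3) Gamma2_invariant_def by blast+
    then show ?thesis using C(3)[of A \<tau>'] * by (simp add: D_def)
  qed
  then show ?thesis using C unfolding lam_denominator_def by blast
qed

section \<open>Removal of the cleared singularities\<close>

lemma filterlim_moebius_at:
  assumes "det A = 1" "Im z > 0"
  shows "filterlim (moebius A) (at (moebius A z)) (at z)"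
  unfolding filterlim_at
proof
  have "isCont (moebius A) z"
    using holomorphic_on_imp_continuous_on[OF holomorphic_on_moebius[OF assms(1)]] assms(2)
      open_upper_half_plane by (simp add: continuous_on_eq_continuous_at)
  then show "(moebius A \<longlongrightarrow> moebius A z) (at z)" by (simp add: isCont_def)
  have inj: "moebius (adj A) (moebius A w) = w" if "Im w > 0" for w
    using moebius_mult[OF that, of "adj A" A] assms(1) by (simp add: adj_mult)
  have "\<forall>\<^sub>F w in at z. w \<in> upper_half_plane - {z}"
    using eventually_at_in_open[OF open_upper_half_plane] assms(2) by simp
  then show "\<forall>\<^sub>F w in at z. moebius A w \<in> UNIV \<and> moebius A w \<noteq> moebius A z"
  proof eventually_elim
    case (elim w)
    have "moebius A w \<noteq> moebius A z"
      using inj[of w] inj[OF assms(2)] elim by auto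
    then show ?case by simp
  qed
qed

text \<open>The identity is claimed where f is analytic, since at a pole f is 0 by convention while
  p(lam) need not vanish. After multiplication by the denominator the growth is polynomial in
  \<open>lam\<close>, so the singularities are removable and the extension is a polynomial in
  \<open>lam\<close>.\<close>

lemma modular_function_rational_in_lam:
  assumes f: "f nicely_meromorphic_on upper_half_plane" "Gamma2_invariant f" "meromorphic_at_cusps f"
  shows "\<exists>p q. q \<noteq> 0 \<and> (\<forall>\<tau>. Im \<tau> > 0 \<longrightarrow> f analytic_on {\<tau>} \<longrightarrow> f \<tau> * poly q (lam \<tau>) = poly p (lam \<tau>))"
proof -
  obtain q C m where q: "q \<noteq> 0" and C: "C \<ge> 0"
    "\<And>\<tau>. Im \<tau> > 0 \<Longrightarrow> norm (f \<tau> * poly q (lam \<tau>)) \<le> C * (1 + norm (lam \<tau>)) ^ m"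
    using lam_denominator_exists[OF f] unfolding lam_denominator_def by blast
  define h where "h = (\<lambda>\<tau>. f \<tau> * poly q (lam \<tau>))"
  define h' where "h' = remove_sings h"
  have UHP_at: "\<forall>\<^sub>F w in at z. Im w > 0" if "Im z > 0" for z
    using eventually_at_in_open'[OF open_upper_half_plane, of z] that by simp
  have ana_q: "(\<lambda>\<tau>. poly q (lam \<tau>)) analytic_on {z}" if "Im z > 0" for z
  proof -
    have "(\<lambda>\<tau>. poly q (lam \<tau>)) holomorphic_on upper_half_plane"
      by (intro holomorphic_intros holomorphic_on_lam)
    then show ?thesis using that
      by (intro holomorphic_on_imp_analytic_at[OF _ open_upper_half_plane]) auto
  qed
  have mero: "h meromorphic_on {z}" if "Im z > 0" for z
  proof -
    have "f meromorphic_on {z}"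
      using f(1) that meromorphic_on_subset unfolding nicely_meromorphic_on_def by blast
    then show ?thesis
      unfolding h_def using analytic_on_imp_meromorphic_on[OF ana_q[OF that]] by (rule meromorphic_on_mult)
  qed
  have lamt: "((\<lambda>w. C * (1 + norm (lam w)) ^ m) \<longlongrightarrow> C * (1 + norm (lam z)) ^ m) (at z)" if "Im z > 0" for z
  proof -
    have "isCont lam z"
      using holomorphic_on_imp_continuous_on[OF holomorphic_on_lam] open_upper_half_plane that
      by (simp add: continuous_on_eq_continuous_at)
    then show ?thesis by (auto simp: isCont_def intro!: tendsto_intros)
  qed
  have lim: "(h \<longlongrightarrow> h' z) (at z)" if z: "Im z > 0" for z
  proof -
    have "\<forall>\<^sub>F w in at z. C * (1 + norm (lam w)) ^ m < C * (1 + norm (lam z)) ^ m + 1"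
      using order_tendstoD(2)[OF lamt[OF z]] by simp
    then have "\<forall>\<^sub>F w in at z. norm (h w) \<le> C * (1 + norm (lam z)) ^ m + 1"
      using UHP_at[OF z]
    proof eventually_elim
      case (elim w)
      then show ?case using C(2)[of w] by (simp add: h_def)
    qed
    then have "\<not> is_pole h z" by (rule bounded_imp_not_is_pole)
    then obtain c where "(h \<longlongrightarrow> c) (at z)"
      using meromorphic_on_not_essential[OF mero[OF z]] by (auto simp: not_essential_def)
    then show ?thesis unfolding h'_def by (metis remove_sings_eqI)
  qed
  have "h' analytic_on {z}" if "Im z > 0" for z
    unfolding h'_def
    by (rule remove_sings_analytic_at[OF meromorphic_on_isolated_singularity[OF mero] lim]) (use that in auto)
  then have "h' analytic_on upper_half_plane"
    by (subst analytic_on_analytic_at) auto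
  then have "h' holomorphic_on upper_half_plane" by (rule analytic_imp_holomorphic)
  moreover have "norm (h' z) \<le> C * (1 + norm (lam z)) ^ m" if z: "Im z > 0" for z
  proof (rule tendsto_le[OF _ lamt[OF z] tendsto_norm[OF lim[OF z]]])
    show "\<forall>\<^sub>F w in at z. norm (h w) \<le> C * (1 + norm (lam w)) ^ m"
      using UHP_at[OF z] by eventually_elim (use C in \<open>simp add: h_def\<close>)
  qed auto
  \<comment> \<open>Invariance passes from \<open>h\<close> to its extension as a limit, because
    \<open>moebius g\<close> respects punctured neighbourhoods.\<close>
  moreover have "Gamma2_invariant h'"
    unfolding Gamma2_invariant_def
  proof (intro ballI allI impI)
    fix g z assume g: "g \<in> Gamma2" and z: "Im z > 0"
    note det = Gamma2_det[OF g]
    have "((\<lambda>w. h (moebius g w)) \<longlongrightarrow> h' (moebius g z)) (at z)"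
      by (rule filterlim_compose[OF lim[OF Im_moebius_pos[OF z det]] filterlim_moebius_at[OF det z]])
    moreover have "\<forall>\<^sub>F w in at z. h (moebius g w) = h w"
      using UHP_at[OF z] by eventually_elim (use f(2) lam_invariant g in \<open>simp add: h_def Gamma2_invariant_def\<close>)
    ultimately have "(h \<longlongrightarrow> h' (moebius g z)) (at z)" by (simp add: tendsto_cong)
    then show "h' (moebius g z) = h' z" using lim[OF z] tendsto_unique by (metis at_neq_bot)
  qed
  ultimately obtain p where p: "\<And>\<tau>. Im \<tau> > 0 \<Longrightarrow> h' \<tau> = poly p (lam \<tau>)"
    using polynomial_in_lam by meson
  show ?thesis
  proof (rule exI[of _ p], rule exI[of _ q], intro conjI allI impI q)
    fix \<tau> :: complex assume \<tau>: "Im \<tau> > 0" and "f analytic_on {\<tau>}"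
    then have "h analytic_on {\<tau>}" unfolding h_def by (intro analytic_on_mult ana_q[OF \<tau>])
    then have "h' \<tau> = h \<tau>" unfolding h'_def by simp
    then show "f \<tau> * poly q (lam \<tau>) = poly p (lam \<tau>)" using p[OF \<tau>] by (simp add: h_def)
  qed
qed

section \<open>The Weber kernel group\<close>

definition uq :: "int \<Rightarrow> int \<Rightarrow> complex \<Rightarrow> complex" where
  "uq c d x = (if even c then - 4096 * x ^ 2 / odd_prod (x\<^sup>2) ^ 24
     else if even d then - (odd_prod x ^ 24) / x else odd_prod (- x) ^ 24 / x)"

lemma weber8_cubed:
  assumes "Im \<tau> > 0"
  shows "weber8 c d \<tau> ^ 3 = uq c d (nome \<tau>)"
proof -
  have p: "(x ^ 8) ^ 3 = x ^ 24" "nome3 \<tau> ^ 6 = nome \<tau> ^ 2" for x :: complex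
    by (simp_all flip: nome3_cubed power_mult)
  have "weber8 c d \<tau> = (if even c then - 16 * nome3 \<tau> ^ 2 / odd_prod ((nome \<tau>)\<^sup>2) ^ 8
      else if even d then - (odd_prod (nome \<tau>) ^ 8 / nome3 \<tau>) else odd_prod (- nome \<tau>) ^ 8 / nome3 \<tau>)"
    using assms by (simp add: weber8_def weber_u0_power8 weber_u1_power8 weber_u2_power8)
  then show ?thesis
    by (simp add: uq_def power_divide power_mult_distrib nome3_cubed p)
qed

lemma weber_u_power24:
  "weber_u0 \<tau> ^ 24 = weber8 1 1 \<tau> ^ 3" "weber_u1 \<tau> ^ 24 = weber8 1 0 \<tau> ^ 3"
  "weber_u2 \<tau> ^ 24 = weber8 0 1 \<tau> ^ 3"
  by (simp_all add: weber8_def flip: power_mult)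

lemma weber8_cubed_moebius:
  assumes "det A = 1" "Im \<tau> > 0" "odd c \<or> odd d"
  shows "weber8 c d (moebius A \<tau>) ^ 3 =
     weber8 (c * A $ 1 $ 1 + d * A $ 2 $ 1) (c * A $ 1 $ 2 + d * A $ 2 $ 2) \<tau> ^ 3"
  using weber8_moebius[OF assms(1,2)] assms(3) by (auto simp: power_mult_distrib)

text \<open>These limits tell the three 24th powers apart.\<close>

lemma weber8_cubed_tendsto:
  "((\<lambda>\<tau>. weber8 c d \<tau> ^ 3 * nome \<tau>) \<longlongrightarrow> (if even c then 0 else if even d then - 1 else 1)) at_ii_inf"
proof -
  have "((\<lambda>\<tau>. odd_prod ((nome \<tau>)\<^sup>2)) \<longlongrightarrow> 1) at_ii_inf"
    using tendsto_power[OF tendsto_nome, of 2] by (intro tendsto_odd_prod) simp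
  then have "((\<lambda>\<tau>. - 4096 * nome \<tau> ^ 2 / odd_prod ((nome \<tau>)\<^sup>2) ^ 24 * nome \<tau>) \<longlongrightarrow> - 4096 * 0 ^ 2 / 1 ^ 24 * 0) at_ii_inf"
    by (intro tendsto_intros tendsto_nome) auto
  moreover have "((\<lambda>\<tau>. odd_prod (- nome \<tau>) ^ 24) \<longlongrightarrow> 1 ^ 24) at_ii_inf"
    using tendsto_minus[OF tendsto_nome] by (intro tendsto_power tendsto_odd_prod) simp
  moreover have "((\<lambda>\<tau>. - (odd_prod (nome \<tau>) ^ 24)) \<longlongrightarrow> - (1 ^ 24)) at_ii_inf"
    by (intro tendsto_minus tendsto_power tendsto_odd_prod tendsto_nome)
  ultimately have "((\<lambda>\<tau>. uq c d (nome \<tau>) * nome \<tau>) \<longlongrightarrow> (if even c then 0 else if even d then - 1 else 1)) at_ii_inf"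
    by (auto simp: uq_def)
  moreover have "\<forall>\<^sub>F \<tau> in at_ii_inf. uq c d (nome \<tau>) * nome \<tau> = weber8 c d \<tau> ^ 3 * nome \<tau>"
    using eventually_at_ii_inf_gt[of 0] by eventually_elim (simp add: weber8_cubed)
  ultimately show ?thesis by (simp only: tendsto_cong)
qed

lemma at_ii_inf_neq_bot: "at_ii_inf \<noteq> bot"
proof
  assume "at_ii_inf = bot"
  then have "eventually (\<lambda>_. False) at_ii_inf" by simp
  then obtain y where y: "\<And>\<tau>. Im \<tau> > y \<Longrightarrow> False" unfolding eventually_at_ii_inf by blast
  show False by (rule y[of "Complex 0 (y + 1)"]) simp
qed

lemma weber8_cubed_eqD:
  assumes "\<And>\<tau>. Im \<tau> > 0 \<Longrightarrow> weber8 c d \<tau> ^ 3 = weber8 c' d' \<tau> ^ 3"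
  shows "(if even c then 0 else if even d then - 1 else 1) =
     (if even c' then 0 else if even d' then - 1 else (1::complex))"
proof (rule tendsto_unique[OF at_ii_inf_neq_bot weber8_cubed_tendsto[of c d]])
  have "\<forall>\<^sub>F \<tau> in at_ii_inf. weber8 c d \<tau> ^ 3 * nome \<tau> = weber8 c' d' \<tau> ^ 3 * nome \<tau>"
    using eventually_at_ii_inf_gt[of 0] by eventually_elim (simp add: assms)
  then show "((\<lambda>\<tau>. weber8 c d \<tau> ^ 3 * nome \<tau>) \<longlongrightarrow> (if even c' then 0 else if even d' then - 1 else 1)) at_ii_inf"
    using weber8_cubed_tendsto[of c' d'] by (simp only: tendsto_cong)
qed

text \<open>A acts on the 24th powers through right multiplication of row vectors modulo 2. If the
  functions of (0, 1) and (1, 0) are kept, the lower left entry is even and the first row is (1, 0)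
  modulo 2; the determinant makes the last entry odd.\<close>

lemma Gamma2_iff_fixes_weber:
  assumes A: "det A = 1"
  shows "A \<in> Gamma2 \<longleftrightarrow> (\<forall>u\<in>{weber_u0, weber_u1, weber_u2}. \<forall>\<tau>. Im \<tau> > 0 \<longrightarrow> u (moebius A \<tau>) ^ 24 = u \<tau> ^ 24)"
    (is "_ \<longleftrightarrow> ?fix")
proof
  assume "A \<in> Gamma2"
  then have "weber8 (c * A $ 1 $ 1 + d * A $ 2 $ 1) (c * A $ 1 $ 2 + d * A $ 2 $ 2) = weber8 c d" for c d
    by (intro weber8_cong) (auto simp: Gamma2_def)
  then show ?fix
    using weber8_cubed_moebius[OF A] by (auto simp: weber_u_power24)
next
  assume ?fix
  then have "weber8 0 1 \<tau> ^ 3 = weber8 (A $ 2 $ 1) (A $ 2 $ 2) \<tau> ^ 3"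
    "weber8 1 0 \<tau> ^ 3 = weber8 (A $ 1 $ 1) (A $ 1 $ 2) \<tau> ^ 3" if "Im \<tau> > 0" for \<tau>
    using that weber8_cubed_moebius[OF A that, of 0 1] weber8_cubed_moebius[OF A that, of 1 0]
    by (auto simp: weber_u_power24)
  then have "even (A $ 2 $ 1)" "odd (A $ 1 $ 1) \<and> even (A $ 1 $ 2)"
    using weber8_cubed_eqD[of 0 1 "A $ 2 $ 1" "A $ 2 $ 2"] weber8_cubed_eqD[of 1 0 "A $ 1 $ 1" "A $ 1 $ 2"]
    by (auto split: if_splits)
  moreover have "odd (A $ 1 $ 1 * A $ 2 $ 2 - A $ 1 $ 2 * A $ 2 $ 1)" using A by (simp add: det_2)
  ultimately show "A \<in> Gamma2" using A by (auto simp: Gamma2_def)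
qed

section \<open>Passage to cosets in PSL2(Z)\<close>

lemma coset_SL2Z: "{mat 1, - mat 1} #>\<^bsub>SL2Z\<^esub> A = {A, - A}"
proof -
  have "(- mat 1 :: int ^ 2 ^ 2) ** A = - A" by (simp add: mat2_eq_iff)
  then show ?thesis by (auto simp: r_coset_def SL2Z_def)
qed

lemma principal_congruence_2: "principal_congruence 2 = (\<lambda>A. {A, - A}) ` Gamma2"
proof -
  have "A \<in> carrier SL2Z \<and> (\<forall>i j. [A $ i $ j = mat 1 $ i $ j] (mod int 2)) \<longleftrightarrow> A \<in> Gamma2" for A
    by (auto simp: SL2Z_def Gamma2_def forall_2 cong_def even_iff_mod_2_eq_zero odd_iff_mod_2_eq_one)
  then show ?thesis unfolding principal_congruence_def coset_SL2Z by auto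
qed

lemma weber_kernel_1: "weber_kernel 1 = principal_congruence 2"
proof -
  have "carrier PSL2Z = (\<lambda>A. {A, - A}) ` {A. det A = 1}"
    by (auto simp: PSL2Z_def FactGroup_def RCOSETS_def coset_SL2Z) (auto simp: SL2Z_def)
  then have "weber_kernel 1 = (\<lambda>A. {A, - A}) ` {A. det A = 1 \<and>
      (\<forall>u\<in>{weber_u0, weber_u1, weber_u2}. \<forall>\<tau>. Im \<tau> > 0 \<longrightarrow> u (moebius A \<tau>) ^ 24 = u \<tau> ^ 24)}"
    unfolding weber_kernel_def by (auto simp: moebius_uminus)
  also have "{A. det A = 1 \<and>
      (\<forall>u\<in>{weber_u0, weber_u1, weber_u2}. \<forall>\<tau>. Im \<tau> > 0 \<longrightarrow> u (moebius A \<tau>) ^ 24 = u \<tau> ^ 24)} = Gamma2"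
    using Gamma2_iff_fixes_weber Gamma2_det by blast
  finally show ?thesis by (simp add: principal_congruence_2)
qed

section \<open>Homogeneous polynomials\<close>

lemma finite_exponents: "finite {m :: 4 \<Rightarrow> nat. (\<Sum>i\<in>UNIV. m i) = d}"
proof (rule finite_subset)
  show "{m :: 4 \<Rightarrow> nat. (\<Sum>i\<in>UNIV. m i) = d} \<subseteq> (\<Pi>\<^sub>E i\<in>UNIV. {..d})"
    by (auto intro!: member_le_sum)
qed (auto intro: finite_PiE)

lemma homogeneous_poly_monomial:
  assumes "(\<Sum>i\<in>UNIV. m i) = d"
  shows "homogeneous_poly d (\<lambda>x. a * (\<Prod>i\<in>UNIV. (x $ i) ^ m i))"
  unfolding homogeneous_poly_def
proof (intro exI[of _ "\<lambda>m'. if m' = m then a else 0"] ext)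
  fix x :: "complex ^ 4"
  have "(\<Sum>m' | (\<Sum>i\<in>UNIV. m' i) = d. (if m' = m then a else 0) * (\<Prod>i\<in>UNIV. (x $ i) ^ m' i)) =
    (\<Sum>m' | (\<Sum>i\<in>UNIV. m' i) = d. if m' = m then a * (\<Prod>i\<in>UNIV. (x $ i) ^ m' i) else 0)"
    by (intro sum.cong) auto
  also have "\<dots> = a * (\<Prod>i\<in>UNIV. (x $ i) ^ m i)"
    using assms finite_exponents by (subst sum.delta) auto
  finally show "a * (\<Prod>i\<in>UNIV. (x $ i) ^ m i) =
     (\<Sum>m' | (\<Sum>i\<in>UNIV. m' i) = d. (if m' = m then a else 0) * (\<Prod>i\<in>UNIV. (x $ i) ^ m' i))" ..
qed

lemma homogeneous_poly_0: "homogeneous_poly d (\<lambda>_. 0)"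
  unfolding homogeneous_poly_def by (intro exI[of _ "\<lambda>_. 0"]) simp

lemma homogeneous_poly_add:
  assumes "homogeneous_poly d p" "homogeneous_poly d q"
  shows "homogeneous_poly d (\<lambda>x. p x + q x)"
proof -
  obtain a b where "p = (\<lambda>x. \<Sum>m | (\<Sum>i\<in>UNIV. m i) = d. a m * (\<Prod>i\<in>UNIV. (x $ i) ^ m i))"
    "q = (\<lambda>x. \<Sum>m | (\<Sum>i\<in>UNIV. m i) = d. b m * (\<Prod>i\<in>UNIV. (x $ i) ^ m i))"
    using assms unfolding homogeneous_poly_def by blast
  then show ?thesis
    unfolding homogeneous_poly_def by (intro exI[of _ "\<lambda>m. a m + b m"]) (simp add: sum.distrib distrib_right)
qed

lemma homogeneous_poly_sum:
  "(\<And>i. i \<in> I \<Longrightarrow> homogeneous_poly d (p i)) \<Longrightarrow> homogeneous_poly d (\<lambda>x. \<Sum>i\<in>I. p i x)"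
  by (induction I rule: infinite_finite_induct) (auto intro: homogeneous_poly_0 homogeneous_poly_add)

lemma homogeneous_poly_mult:
  assumes "homogeneous_poly d p" "homogeneous_poly e q"
  shows "homogeneous_poly (d + e) (\<lambda>x. p x * q x)"
proof -
  obtain a b where p: "p = (\<lambda>x. \<Sum>m | (\<Sum>i\<in>UNIV. m i) = d. a m * (\<Prod>i\<in>UNIV. (x $ i) ^ m i))"
    and q: "q = (\<lambda>x. \<Sum>m | (\<Sum>i\<in>UNIV. m i) = e. b m * (\<Prod>i\<in>UNIV. (x $ i) ^ m i))"
    using assms unfolding homogeneous_poly_def by blast
  have "homogeneous_poly (d + e) (\<lambda>x. \<Sum>m | (\<Sum>i\<in>UNIV. m i) = d. \<Sum>m' | (\<Sum>i\<in>UNIV. m' i) = e.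
      a m * b m' * (\<Prod>i\<in>UNIV. (x $ i) ^ (m i + m' i)))"
    by (intro homogeneous_poly_sum homogeneous_poly_monomial) (auto simp: sum.distrib)
  moreover have "(\<lambda>x. p x * q x) = (\<lambda>x. \<Sum>m | (\<Sum>i\<in>UNIV. m i) = d. \<Sum>m' | (\<Sum>i\<in>UNIV. m' i) = e.
      a m * b m' * (\<Prod>i\<in>UNIV. (x $ i) ^ (m i + m' i)))"
    unfolding p q sum_product power_add prod.distrib by (simp only: mult_ac)
  ultimately show ?thesis by simp
qed

lemma homogeneous_poly_const: "homogeneous_poly 0 (\<lambda>_. c)"
  using homogeneous_poly_monomial[of "\<lambda>_. 0" 0 c] by simp

lemma homogeneous_poly_cmult: "homogeneous_poly d p \<Longrightarrow> homogeneous_poly d (\<lambda>x. c * p x)"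
  using homogeneous_poly_mult[OF homogeneous_poly_const] by fastforce

lemma homogeneous_poly_coord: "homogeneous_poly 1 (\<lambda>x. x $ k)"
proof -
  have "homogeneous_poly 1 (\<lambda>x. 1 * (\<Prod>i\<in>UNIV. (x $ i) ^ (if i = k then 1 else 0)))"
    by (rule homogeneous_poly_monomial) simp
  moreover have "(\<Prod>i\<in>UNIV. (x $ i) ^ (if i = k then 1 else 0)) = x $ k" for x :: "complex ^ 4"
  proof -
    have "(\<Prod>i\<in>UNIV. (x $ i) ^ (if i = k then 1 else 0)) = (\<Prod>i\<in>UNIV. if i = k then x $ i else 1)"
      by (intro prod.cong) auto
    then show ?thesis by simp
  qed
  ultimately show ?thesis by simp
qed

lemma homogeneous_poly_scale:
  assumes "homogeneous_poly d p"
  shows "p (c *s x) = c ^ d * p x"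
proof -
  obtain a where p: "p = (\<lambda>x. \<Sum>m | (\<Sum>i\<in>UNIV. m i) = d. a m * (\<Prod>i\<in>UNIV. (x $ i) ^ m i))"
    using assms unfolding homogeneous_poly_def by blast
  show ?thesis
    unfolding p sum_distrib_left
    by (intro sum.cong refl) (auto simp: power_mult_distrib prod.distrib power_sum)
qed

text \<open>An induction principle for polynomial expressions: holomorphy or meromorphy of p along a
  moving point follows from that of the coordinates.\<close>

lemma homogeneous_poly_closed:
  assumes hom: "homogeneous_poly d p" and x: "\<And>i. P (\<lambda>t. x t $ i)"
    and const: "\<And>c. P (\<lambda>_. c)" and add: "\<And>f g. P f \<Longrightarrow> P g \<Longrightarrow> P (\<lambda>t. f t + g t)"
    and mult: "\<And>f g. P f \<Longrightarrow> P g \<Longrightarrow> P (\<lambda>t. f t * g t)"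
  shows "P (\<lambda>t. p (x t))"
proof -
  obtain a where p: "p = (\<lambda>x. \<Sum>m | (\<Sum>i\<in>UNIV. m i) = d. a m * (\<Prod>i\<in>UNIV. (x $ i) ^ m i))"
    using hom unfolding homogeneous_poly_def by blast
  have pow: "P (\<lambda>t. f t ^ n)" if "P f" for f n
    by (induction n) (auto intro: const mult that)
  have prod: "P (\<lambda>t. \<Prod>i\<in>I. f i t)" if "\<And>i. P (f i)" for f and I :: "4 set"
    by (induction I rule: infinite_finite_induct) (auto intro: const mult that)
  have sum: "P (\<lambda>t. \<Sum>i\<in>I. f i t)" if "\<And>i. P (f i)" for f and I :: "(4 \<Rightarrow> nat) set"
    by (induction I rule: infinite_finite_induct) (auto intro: const add that)
  show ?thesis unfolding p by (intro sum mult const prod pow x)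
qed

section \<open>The function field of the Weber curve\<close>

definition weber_point :: "complex \<Rightarrow> complex ^ 4" where
  "weber_point = weber_map 1"

definition weber_cubic :: "(complex ^ 4) set set" where
  "weber_cubic = weber_curve 1"

lemma vector_4 [simp]:
  "(vector [w, x, y, z] :: 'a::zero ^ 4) $ 1 = w" "(vector [w, x, y, z] :: 'a::zero ^ 4) $ 2 = x"
  "(vector [w, x, y, z] :: 'a::zero ^ 4) $ 3 = y" "(vector [w, x, y, z] :: 'a::zero ^ 4) $ 4 = z"
  unfolding vector_def by simp_all

lemma weber_map_1: "weber_point \<tau> = vector [weber8 1 1 \<tau> ^ 3, weber8 1 0 \<tau> ^ 3, weber8 0 1 \<tau> ^ 3, 1]"
  by (simp add: weber_point_def weber_map_def weber_u_power24)

lemma weber_cubic_eq: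
  "weber_cubic = zariski_closure ((\<lambda>\<tau>. proj_point (weber_point \<tau>)) ` upper_half_plane)"
  by (simp add: weber_cubic_def weber_point_def weber_curve_def)

lemma holomorphic_on_poly_weber_map:
  assumes "homogeneous_poly d p"
  shows "(\<lambda>\<tau>. p (weber_point \<tau>)) holomorphic_on upper_half_plane"
  using assms
proof (rule homogeneous_poly_closed)
  show "(\<lambda>\<tau>. weber_point \<tau> $ i) holomorphic_on upper_half_plane" for i
    using exhaust_4[of i]
    by (auto simp: weber_map_1 vector_4 intro!: holomorphic_intros holomorphic_on_weber8)
qed (auto intro: holomorphic_intros)

text \<open>The closure is cut out by exactly those homogeneous polynomials that vanish on the
  image. Questions about functions on the curve thus become questions about functions of \<tau>, and
  the equations of the curve do not enter.\<close>

lemma weber_curve_vanishing: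
  assumes "homogeneous_poly d p"
  shows "(\<forall>P\<in>weber_cubic. \<forall>x\<in>P. p x = 0) \<longleftrightarrow> (\<forall>\<tau>. Im \<tau> > 0 \<longrightarrow> p (weber_point \<tau>) = 0)"
proof
  assume *: "\<forall>P\<in>weber_cubic. \<forall>x\<in>P. p x = 0"
  show "\<forall>\<tau>. Im \<tau> > 0 \<longrightarrow> p (weber_point \<tau>) = 0"
  proof (intro allI impI)
    fix \<tau> :: complex assume "Im \<tau> > 0"
    have "weber_point \<tau> $ 4 = 1" by (simp add: weber_map_1 vector_4)
    then have "weber_point \<tau> \<noteq> 0" by auto
    then have "proj_point (weber_point \<tau>) \<in> weber_cubic"
      using \<open>Im \<tau> > 0\<close> unfolding weber_cubic_eq zariski_closure_def projective_space3_def by blast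
    moreover have "weber_point \<tau> \<in> proj_point (weber_point \<tau>)"
      unfolding proj_point_def by (auto intro!: exI[of _ 1])
    ultimately show "p (weber_point \<tau>) = 0" using * by blast
  qed
next
  assume *: "\<forall>\<tau>. Im \<tau> > 0 \<longrightarrow> p (weber_point \<tau>) = 0"
  have "\<forall>Q\<in>(\<lambda>\<tau>. proj_point (weber_point \<tau>)) ` upper_half_plane. \<forall>x\<in>Q. p x = 0"
    using * by (auto simp: proj_point_def homogeneous_poly_scale[OF assms])
  then show "\<forall>P\<in>weber_cubic. \<forall>x\<in>P. p x = 0"
    using assms unfolding weber_cubic_eq zariski_closure_def by blast
qed

lemma fractions_weber_curve:
  "(p, q) \<in> fractions weber_cubic \<longleftrightarrow>
     (\<exists>d. homogeneous_poly d p \<and> homogeneous_poly d q \<and> (\<exists>\<tau>. Im \<tau> > 0 \<and> q (weber_point \<tau>) \<noteq> 0))"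
proof -
  have "(\<exists>P\<in>weber_cubic. \<exists>x\<in>P. q x \<noteq> 0) \<longleftrightarrow> (\<exists>\<tau>. Im \<tau> > 0 \<and> q (weber_point \<tau>) \<noteq> 0)" if "homogeneous_poly d q" for d
    using weber_curve_vanishing[OF that] by blast
  then show ?thesis
    unfolding fractions_def mem_Collect_eq prod.case by blast
qed

lemma eventually_poly_weber_map_nonzero:
  assumes "(p, q) \<in> fractions weber_cubic" "Im z > 0"
  shows "\<forall>\<^sub>F w in at z. q (weber_point w) \<noteq> 0 \<and> Im w > 0"
proof -
  obtain d \<tau> where "homogeneous_poly d q" "Im \<tau> > 0" "q (weber_point \<tau>) \<noteq> 0"
    using assms fractions_weber_curve by blast
  then show ?thesis
    using non_zero_neighbour_alt[OF holomorphic_on_poly_weber_map open_upper_half_plane connected_upper_half_plane, of d q z \<tau>]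
      assms(2) by simp
qed

text \<open>This takes the place of irreducibility of the curve: on a connected domain nonzero
  holomorphic functions have isolated zeros, so two of them are nonzero at a common point.\<close>

lemma fractions_mult_nonzero:
  assumes "(p, q) \<in> fractions weber_cubic" "(p', q') \<in> fractions weber_cubic"
  shows "\<exists>\<tau>. Im \<tau> > 0 \<and> q (weber_point \<tau>) * q' (weber_point \<tau>) \<noteq> 0"
proof -
  have "\<forall>\<^sub>F w in at \<i>. (q (weber_point w) \<noteq> 0 \<and> Im w > 0) \<and> (q' (weber_point w) \<noteq> 0 \<and> Im w > 0)"
    by (intro eventually_conj eventually_poly_weber_map_nonzero[OF assms(1)] eventually_poly_weber_map_nonzero[OF assms(2)]) auto
  then have "\<exists>w. (q (weber_point w) \<noteq> 0 \<and> Im w > 0) \<and> (q' (weber_point w) \<noteq> 0 \<and> Im w > 0)"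
    by (rule eventually_happens'[OF at_neq_bot])
  then show ?thesis by auto
qed

lemma fractions_multI:
  assumes "(p, q) \<in> fractions weber_cubic" "(p', q') \<in> fractions weber_cubic"
  shows "(\<lambda>x. p x * p' x, \<lambda>x. q x * q' x) \<in> fractions weber_cubic"
  using assms fractions_mult_nonzero[OF assms] homogeneous_poly_mult
  unfolding fractions_weber_curve by blast

lemma fractions_addI:
  assumes "(p, q) \<in> fractions weber_cubic" "(p', q') \<in> fractions weber_cubic"
  shows "(\<lambda>x. p x * q' x + p' x * q x, \<lambda>x. q x * q' x) \<in> fractions weber_cubic"
proof -
  obtain d e where hom: "homogeneous_poly d p" "homogeneous_poly d q" "homogeneous_poly e p'" "homogeneous_poly e q'"
    using assms unfolding fractions_weber_curve by blast
  have "homogeneous_poly (d + e) (\<lambda>x. p x * q' x + p' x * q x)"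
    using homogeneous_poly_mult[OF hom(1,4)] homogeneous_poly_mult[OF hom(3,2)]
    by (auto intro: homogeneous_poly_add simp: add.commute)
  then show ?thesis
    using fractions_mult_nonzero[OF assms] homogeneous_poly_mult[OF hom(2,4)]
    unfolding fractions_weber_curve by blast
qed

lemma fractions_const: "(\<lambda>_. c, \<lambda>_. 1) \<in> fractions weber_cubic"
  unfolding fractions_weber_curve
  by (intro exI[of _ 0] conjI homogeneous_poly_const exI[of _ \<i>]) auto

section \<open>Pullback of fractions to the upper half plane\<close>

definition pullback :: "(complex ^ 4 \<Rightarrow> complex) \<Rightarrow> (complex ^ 4 \<Rightarrow> complex) \<Rightarrow> complex \<Rightarrow> complex" where
  "pullback p q = normalise_mero (\<lambda>\<tau>. p (weber_point \<tau>) / q (weber_point \<tau>))"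

lemma analytic_poly_weber_map:
  assumes "homogeneous_poly d p" "Im \<tau> > 0"
  shows "(\<lambda>\<tau>. p (weber_point \<tau>)) analytic_on {\<tau>}"
  using assms(2)
  by (intro holomorphic_on_imp_analytic_at[OF holomorphic_on_poly_weber_map[OF assms(1)] open_upper_half_plane]) auto

lemma pullback_eq:
  assumes "(p, q) \<in> fractions weber_cubic" "Im \<tau> > 0" "q (weber_point \<tau>) \<noteq> 0"
  shows "pullback p q \<tau> = p (weber_point \<tau>) / q (weber_point \<tau>)"
proof -
  obtain d where "homogeneous_poly d p" "homogeneous_poly d q"
    using assms(1) unfolding fractions_weber_curve by blast
  then have "(\<lambda>\<tau>. p (weber_point \<tau>) / q (weber_point \<tau>)) analytic_on {\<tau>}"
    using assms by (intro analytic_on_divide analytic_poly_weber_map) auto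
  then show ?thesis using assms(2) by (simp add: pullback_def normalise_mero_def)
qed

lemma normalise_mero_cong:
  assumes "\<And>z. Im z > 0 \<Longrightarrow> \<forall>\<^sub>F w in at z. f w = g w"
  shows "normalise_mero f = normalise_mero g"
  using assms remove_sings_cong by (auto simp: normalise_mero_def fun_eq_iff)

text \<open>Cross-multiplied, equality on the curve is the vanishing of the homogeneous
  \<open>D\<close>, which can be tested along the parametrisation. Away from isolated zeros of the
  denominators this is equality of the quotients, and normalisation settles the remaining
  points.\<close>

lemma fraction_rel_iff:
  assumes pq: "(p, q) \<in> fractions weber_cubic" and pq': "(p', q') \<in> fractions weber_cubic"
  shows "((p, q), (p', q')) \<in> fraction_rel weber_cubic \<longleftrightarrow> pullback p q = pullback p' q'"
proof -
  obtain d e where hom: "homogeneous_poly d p" "homogeneous_poly d q" "homogeneous_poly e p'" "homogeneous_poly e q'"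
    using assms unfolding fractions_weber_curve by blast
  define D where "D = (\<lambda>x. p x * q' x + (- 1) * (p' x * q x))"
  have D: "homogeneous_poly (d + e) D"
    unfolding D_def
    using homogeneous_poly_mult[OF hom(1,4)] homogeneous_poly_mult[OF hom(3,2)]
    by (intro homogeneous_poly_add homogeneous_poly_cmult) (auto simp: add.commute)
  have ev: "\<forall>\<^sub>F w in at z. q (weber_point w) \<noteq> 0 \<and> q' (weber_point w) \<noteq> 0 \<and> Im w > 0" if "Im z > 0" for z
    using eventually_poly_weber_map_nonzero[OF pq that] eventually_poly_weber_map_nonzero[OF pq' that]
    by eventually_elim simp
  have "((p, q), (p', q')) \<in> fraction_rel weber_cubic \<longleftrightarrow> (\<forall>P\<in>weber_cubic. \<forall>x\<in>P. D x = 0)"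
    using assms by (simp add: fraction_rel_def D_def)
  also have "\<dots> \<longleftrightarrow> (\<forall>\<tau>. Im \<tau> > 0 \<longrightarrow> D (weber_point \<tau>) = 0)"
    by (rule weber_curve_vanishing[OF D])
  also have "\<dots> \<longleftrightarrow> pullback p q = pullback p' q'"
  proof
    assume 0: "\<forall>\<tau>. Im \<tau> > 0 \<longrightarrow> D (weber_point \<tau>) = 0"
    have "\<forall>\<^sub>F w in at z. p (weber_point w) / q (weber_point w) = p' (weber_point w) / q' (weber_point w)" if "Im z > 0" for z
      using ev[OF that]
    proof eventually_elim
      case (elim w)
      then have "p (weber_point w) * q' (weber_point w) = p' (weber_point w) * q (weber_point w)" using 0 by (simp add: D_def)
      then show ?case using elim by (simp add: frac_eq_eq)
    qed
    then show "pullback p q = pullback p' q'"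
      unfolding pullback_def by (rule normalise_mero_cong)
  next
    assume eq: "pullback p q = pullback p' q'"
    show "\<forall>\<tau>. Im \<tau> > 0 \<longrightarrow> D (weber_point \<tau>) = 0"
    proof (rule ccontr)
      assume "\<not> ?thesis"
      then obtain \<tau> where "Im \<tau> > 0" "D (weber_point \<tau>) \<noteq> 0" by blast
      then have "\<forall>\<^sub>F w in at \<i>. D (weber_point w) \<noteq> 0 \<and> w \<in> upper_half_plane"
        by (intro non_zero_neighbour_alt[OF holomorphic_on_poly_weber_map[OF D] open_upper_half_plane connected_upper_half_plane, of _ \<tau>]) auto
      moreover have "\<forall>\<^sub>F w in at \<i>. q (weber_point w) \<noteq> 0 \<and> q' (weber_point w) \<noteq> 0 \<and> Im w > 0"
        by (rule ev) simp
      ultimately have "\<forall>\<^sub>F w in at \<i>. False"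
      proof eventually_elim
        case (elim w)
        then have "p (weber_point w) / q (weber_point w) = p' (weber_point w) / q' (weber_point w)"
          using eq pullback_eq[OF pq, of w] pullback_eq[OF pq', of w] by simp
        then have "D (weber_point w) = 0" using elim by (simp add: D_def frac_eq_eq)
        then show False using elim by simp
      qed
      then show False by simp
    qed
  qed
  finally show ?thesis .
qed

text \<open>Classes of fractions are fibres of \<open>pullback\<close>; this makes the operations of
  the function field independent of representatives.\<close>

lemma rat_fun_eq:
  assumes "(p, q) \<in> fractions weber_cubic"
  shows "rat_fun weber_cubic p q = {(p', q') \<in> fractions weber_cubic. pullback p' q' = pullback p q}"
proof -
  have "((p, q), (p', q')) \<in> fraction_rel weber_cubic \<Longrightarrow> (p', q') \<in> fractions weber_cubic" for p' q'
    by (simp add: fraction_rel_def)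
  then show ?thesis unfolding rat_fun_def using fraction_rel_iff[OF assms] by fastforce
qed

lemma rat_fun_eq_iff:
  assumes "(p, q) \<in> fractions weber_cubic" "(p', q') \<in> fractions weber_cubic"
  shows "rat_fun weber_cubic p q = rat_fun weber_cubic p' q' \<longleftrightarrow> pullback p q = pullback p' q'"
proof
  assume "rat_fun weber_cubic p q = rat_fun weber_cubic p' q'"
  moreover have "(p, q) \<in> rat_fun weber_cubic p q" using assms by (simp add: rat_fun_eq)
  ultimately show "pullback p q = pullback p' q'" using assms by (simp add: rat_fun_eq)
qed (simp add: rat_fun_eq assms)

lemma pullback_mult:
  assumes "(p, q) \<in> fractions weber_cubic" "(p', q') \<in> fractions weber_cubic"
  shows "pullback (\<lambda>x. p x * p' x) (\<lambda>x. q x * q' x) = normalise_mero (\<lambda>\<tau>. pullback p q \<tau> * pullback p' q' \<tau>)"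
  unfolding pullback_def[of "\<lambda>x. p x * p' x"]
proof (rule normalise_mero_cong)
  fix z :: complex assume "Im z > 0"
  from eventually_poly_weber_map_nonzero[OF assms(1) this] eventually_poly_weber_map_nonzero[OF assms(2) this]
  show "\<forall>\<^sub>F w in at z. p (weber_point w) * p' (weber_point w) / (q (weber_point w) * q' (weber_point w)) = pullback p q w * pullback p' q' w"
    by eventually_elim (simp add: pullback_eq assms)
qed

lemma pullback_add:
  assumes "(p, q) \<in> fractions weber_cubic" "(p', q') \<in> fractions weber_cubic"
  shows "pullback (\<lambda>x. p x * q' x + p' x * q x) (\<lambda>x. q x * q' x) = normalise_mero (\<lambda>\<tau>. pullback p q \<tau> + pullback p' q' \<tau>)"
  unfolding pullback_def[of "\<lambda>x. p x * q' x + p' x * q x"]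
proof (rule normalise_mero_cong)
  fix z :: complex assume "Im z > 0"
  from eventually_poly_weber_map_nonzero[OF assms(1) this] eventually_poly_weber_map_nonzero[OF assms(2) this]
  show "\<forall>\<^sub>F w in at z. (p (weber_point w) * q' (weber_point w) + p' (weber_point w) * q (weber_point w)) / (q (weber_point w) * q' (weber_point w)) =
      pullback p q w + pullback p' q' w"
    by eventually_elim (simp add: pullback_eq assms add_frac_eq)
qed

section \<open>Pullbacks are modular functions\<close>

lemma normalise_mero_nicely_meromorphic:
  assumes "f meromorphic_on upper_half_plane"
  shows "normalise_mero f nicely_meromorphic_on upper_half_plane"
proof -
  have nm: "remove_sings f nicely_meromorphic_on upper_half_plane"
    using assms by (rule remove_sings_nicely_meromorphic)
  have ev: "\<forall>\<^sub>F w in at z. normalise_mero f w = remove_sings f w" if "z \<in> upper_half_plane" for z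
    using eventually_at_in_open'[OF open_upper_half_plane that]
    by eventually_elim (simp add: normalise_mero_def)
  have "normalise_mero f meromorphic_on upper_half_plane \<longleftrightarrow> remove_sings f meromorphic_on upper_half_plane"
    by (rule meromorphic_on_cong) (use ev in auto)
  moreover have "(is_pole (normalise_mero f) z \<and> normalise_mero f z = 0) \<or> normalise_mero f \<midarrow>z\<rightarrow> normalise_mero f z"
    if z: "z \<in> upper_half_plane" for z
  proof -
    have "normalise_mero f z = remove_sings f z" using z by (simp add: normalise_mero_def)
    moreover have "is_pole (normalise_mero f) z \<longleftrightarrow> is_pole (remove_sings f) z"
      by (rule is_pole_cong[OF ev[OF z] refl])
    moreover have "normalise_mero f \<midarrow>z\<rightarrow> c \<longleftrightarrow> remove_sings f \<midarrow>z\<rightarrow> c" for c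
      by (rule tendsto_cong[OF ev[OF z]])
    ultimately show ?thesis
      using nm z unfolding nicely_meromorphic_on_def by auto
  qed
  ultimately show ?thesis using nm unfolding nicely_meromorphic_on_def by blast
qed

lemma weber_map_Gamma2: "A \<in> Gamma2 \<Longrightarrow> Im \<tau> > 0 \<Longrightarrow> weber_point (moebius A \<tau>) = weber_point \<tau>"
  using Gamma2_iff_fixes_weber[OF Gamma2_det] by (simp add: weber_point_def weber_map_def)

lemma filtermap_moebius_at:
  assumes "det A = 1" "Im z > 0"
  shows "filtermap (moebius A) (at z) = at (moebius A z)"
proof (rule filtermap_fun_inverse)
  show "filterlim (moebius A) (at (moebius A z)) (at z)"
    by (rule filterlim_moebius_at[OF assms])
  have "moebius (adj A) (moebius A z) = z"
    using moebius_mult[of z "adj A" A] assms by (simp add: adj_mult)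
  then show "filterlim (moebius (adj A)) (at z) (at (moebius A z))"
    using filterlim_moebius_at[of "adj A" "moebius A z"] Im_moebius_pos[of z A] assms by simp
  have "\<forall>\<^sub>F w in at (moebius A z). w \<in> upper_half_plane"
    by (rule eventually_at_in_open'[OF open_upper_half_plane]) (use Im_moebius_pos assms in auto)
  then show "\<forall>\<^sub>F w in at (moebius A z). moebius A (moebius (adj A) w) = w"
    by eventually_elim (use moebius_mult[of _ A "adj A"] assms in \<open>simp add: adj_mult\<close>)
qed

text \<open>Normalisation is decided on punctured neighbourhoods, and \<open>moebius A\<close> maps
  these onto each other, so the invariance of the quotient survives it.\<close>

lemma pullback_invariant:
  assumes "A \<in> Gamma2" "Im z > 0"
  shows "pullback p q (moebius A z) = pullback p q z"
proof -
  define k where "k = (\<lambda>\<tau>. p (weber_point \<tau>) / q (weber_point \<tau>))"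
  note det = Gamma2_det[OF assms(1)]
  have "remove_sings k (moebius A z) = remove_sings (k \<circ> moebius A) z"
    using remove_sings_compose[OF filtermap_moebius_at[OF det assms(2)], of k] by simp
  also have "\<dots> = remove_sings k z"
  proof (rule remove_sings_cong[OF _ refl])
    have "\<forall>\<^sub>F w in at z. w \<in> upper_half_plane"
      by (rule eventually_at_in_open'[OF open_upper_half_plane]) (use assms in auto)
    then show "\<forall>\<^sub>F w in at z. (k \<circ> moebius A) w = k w"
      by eventually_elim (simp add: k_def weber_map_Gamma2 assms)
  qed
  finally show ?thesis
    using assms(2) Im_moebius_pos[OF assms(2) det] by (simp add: pullback_def normalise_mero_def k_def)
qed

text \<open>After composition with A the coordinates are functions \<open>uq\<close> of the nome,
  meromorphic at 0. The nome is exp (2 \<pi> i \<tau> / 2), so h = 2 serves every cusp.\<close>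

lemma pullback_meromorphic_at_cusps:
  assumes pq: "(p, q) \<in> fractions weber_cubic"
  shows "meromorphic_at_cusps (pullback p q)"
  unfolding meromorphic_at_cusps_def
proof
  fix A assume "A \<in> carrier SL2Z"
  then have A: "det A = 1" by (simp add: SL2Z_def)
  obtain d where hom: "homogeneous_poly d p" "homogeneous_poly d q"
    using pq unfolding fractions_weber_curve by blast
  define V :: "complex \<Rightarrow> complex ^ 4" where "V = (\<lambda>x. vector
    [uq (A $ 1 $ 1 + A $ 2 $ 1) (A $ 1 $ 2 + A $ 2 $ 2) x, uq (A $ 1 $ 1) (A $ 1 $ 2) x,
     uq (A $ 2 $ 1) (A $ 2 $ 2) x, 1])"
  have V: "weber_point (moebius A \<tau>) = V (nome \<tau>)" if "Im \<tau> > 0" for \<tau>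
    using that weber8_cubed_moebius[OF A that]
    by (simp add: weber_map_1 V_def weber8_cubed[symmetric])
  have ana: "odd_prod analytic_on {0}" "(\<lambda>x. odd_prod (- x)) analytic_on {0}" "(\<lambda>x. odd_prod (x\<^sup>2)) analytic_on {0}"
  proof -
    show "odd_prod analytic_on {0}"
      by (rule holomorphic_on_imp_analytic_at[OF holomorphic_on_odd_prod]) auto
    show "(\<lambda>x. odd_prod (- x)) analytic_on {0}"
      by (rule holomorphic_on_imp_analytic_at[where A = "ball 0 1"])
         (auto intro!: holomorphic_on_odd_prod' holomorphic_intros)
    show "(\<lambda>x. odd_prod (x\<^sup>2)) analytic_on {0}"
      by (rule holomorphic_on_imp_analytic_at[where A = "ball 0 1"])
         (auto intro!: holomorphic_on_odd_prod' holomorphic_intros norm_power2_less_1)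
  qed
  have uq: "uq c d meromorphic_on {0}" for c d
  proof -
    have "(\<lambda>x. - 4096 * x ^ 2 / odd_prod (x\<^sup>2) ^ 24) meromorphic_on {0}"
      "(\<lambda>x. - (odd_prod x ^ 24) / x) meromorphic_on {0}"
      "(\<lambda>x. odd_prod (- x) ^ 24 / x) meromorphic_on {0}"
      by (intro meromorphic_intros analytic_on_imp_meromorphic_on ana; simp)+
    then show ?thesis by (cases "even c"; cases "even d") (simp_all add: uq_def[abs_def])
  qed
  have poly: "(\<lambda>x. r (V x)) meromorphic_on {0}" if "homogeneous_poly d r" for r
    using that
  proof (rule homogeneous_poly_closed)
    show "(\<lambda>x. V x $ i) meromorphic_on {0}" for i
      using exhaust_4[of i] by (auto simp: V_def vector_4 uq)
  qed (auto intro: meromorphic_intros)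
  define F where "F = (\<lambda>x. p (V x) / q (V x))"
  \<comment> \<open>If \<open>q (V x)\<close> vanished for all small nonzero x, then q would vanish
    along the parametrisation on an open set, against the isolation of its zeros.\<close>
  have "\<exists>\<^sub>F x in at 0. q (V x) \<noteq> 0"
  proof (rule ccontr)
    assume "\<not> ?thesis"
    then have "\<forall>\<^sub>F x in at 0. q (V x) = 0" by (simp add: frequently_def)
    then have "\<forall>\<^sub>F \<tau> in at_ii_inf. q (V (nome \<tau>)) = 0"
      by (rule eventually_compose_filterlim[OF _ filterlim_nome])
    then obtain y where y: "\<And>\<tau>. Im \<tau> > y \<Longrightarrow> q (V (nome \<tau>)) = 0"
      unfolding eventually_at_ii_inf by blast
    define z where "z = Complex 0 (\<bar>y\<bar> + 1)"
    have "Im z = \<bar>y\<bar> + 1" by (simp add: z_def)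
    then have z: "Im z > 0" "Im z > y" by linarith+
    have "\<forall>\<^sub>F w in at (moebius A z). q (weber_point w) \<noteq> 0 \<and> Im w > 0"
      by (rule eventually_poly_weber_map_nonzero[OF pq Im_moebius_pos[OF z(1) A]])
    then have "\<forall>\<^sub>F w in at z. q (weber_point (moebius A w)) \<noteq> 0 \<and> Im (moebius A w) > 0"
      by (rule eventually_compose_filterlim[OF _ filterlim_moebius_at[OF A z(1)]])
    moreover have "\<forall>\<^sub>F w in at z. w \<in> {w. Im w > max y 0}"
      by (rule eventually_at_in_open'[OF open_halfspace_Im_gt]) (use z in auto)
    ultimately have "\<forall>\<^sub>F w in at z. False"
      by eventually_elim (use V y in auto)
    then show False by simp
  qed
  then have "\<forall>\<^sub>F x in at 0. q (V x) \<noteq> 0"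
    by (intro non_zero_neighbour meromorphic_on_isolated_singularity meromorphic_on_not_essential poly hom)
  then have "\<forall>\<^sub>F \<tau> in at_ii_inf. q (V (nome \<tau>)) \<noteq> 0"
    by (rule eventually_compose_filterlim[OF _ filterlim_nome])
  then obtain y where y: "\<And>\<tau>. Im \<tau> > y \<Longrightarrow> q (V (nome \<tau>)) \<noteq> 0"
    unfolding eventually_at_ii_inf by blast
  show "\<exists>h::nat. h > 0 \<and> (\<exists>F. F meromorphic_on {0} \<and> (\<exists>y>0. \<forall>\<tau>. Im \<tau> > y \<longrightarrow>
      pullback p q (moebius A \<tau>) = F (exp (2 * of_real pi * \<i> * \<tau> / of_nat h))))"
  proof (intro exI[of _ "2::nat"] conjI exI[of _ F] exI[of _ "\<bar>y\<bar> + 1"] allI impI)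
    show "F meromorphic_on {0}" unfolding F_def by (intro meromorphic_on_divide poly hom)
    fix \<tau> assume "Im \<tau> > \<bar>y\<bar> + 1"
    then have \<tau>: "Im \<tau> > 0" "Im \<tau> > y" by linarith+
    have "exp (2 * of_real pi * \<i> * \<tau> / of_nat 2) = nome \<tau>"
      unfolding nome_def by (rule arg_cong[of _ _ exp]) simp
    then show "pullback p q (moebius A \<tau>) = F (exp (2 * of_real pi * \<i> * \<tau> / of_nat 2))"
      using pullback_eq[OF pq Im_moebius_pos[OF \<tau>(1) A]] y[OF \<tau>(2)] V[OF \<tau>(1)] by (simp add: F_def)
  qed auto
qed

lemma pullback_in_modular_function_field:
  assumes "(p, q) \<in> fractions weber_cubic"
  shows "pullback p q \<in> carrier (modular_function_field (principal_congruence 2))"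
proof -
  obtain d where hom: "homogeneous_poly d p" "homogeneous_poly d q"
    using assms unfolding fractions_weber_curve by blast
  have "(\<lambda>\<tau>. p (weber_point \<tau>) / q (weber_point \<tau>)) meromorphic_on upper_half_plane"
    using holomorphic_on_poly_weber_map hom open_upper_half_plane
    by (intro meromorphic_on_divide analytic_on_imp_meromorphic_on) (auto simp: analytic_on_open)
  then have "pullback p q nicely_meromorphic_on upper_half_plane"
    unfolding pullback_def by (rule normalise_mero_nicely_meromorphic)
  moreover have "pullback p q \<tau> = 0" if "\<tau> \<notin> upper_half_plane" for \<tau>
    using that by (simp add: pullback_def normalise_mero_def)
  ultimately show ?thesis
    using pullback_meromorphic_at_cusps[OF assms] pullback_invariant
    by (auto simp: modular_function_field_def principal_congruence_2 moebius_uminus)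
qed

section \<open>Polynomials in lambda as rational functions on the curve\<close>

text \<open>The parametrisation of the curve has a node, the point where all coordinates are 16;
  \<open>lam\<close> is, up to sign, the slope of the line joining a point of the curve to the node.\<close>

lemma lam_rational:
  assumes \<tau>: "Im \<tau> > 0"
  shows "lam \<tau> * (weber_point \<tau> $ 1 - 16 * weber_point \<tau> $ 4) = 16 * weber_point \<tau> $ 4 - weber_point \<tau> $ 3"
proof -
  define a where "a = weber8 1 1 \<tau>"
  define x where "x = lam \<tau>"
  have 1: "weber8 0 1 \<tau> = - x * a" "weber8 1 0 \<tau> = (x - 1) * a"
    using weber8_eq_lam[OF \<tau>] by (auto simp: a_def x_def)
  have "a ^ 3 * x * (1 - x) = a * ((x - 1) * a) * (- x * a)"
    by (simp add: power3_eq_cube algebra_simps)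
  also have "\<dots> = 16"
    using weber_product[OF \<tau>] 1 by (simp add: a_def weber8_def)
  finally have 16: "16 = a ^ 3 * x * (1 - x)" ..
  \<comment> \<open>The claim amounts to a^3 (x - x^3) = 16 (1 + x), the product relation times 1 +
    x.\<close>
  have "x * (a ^ 3 - 16 * 1) = 16 * 1 - (- x * a) ^ 3"
    unfolding 16 by (simp add: power3_eq_cube algebra_simps)
  then show ?thesis
    unfolding weber_map_1 vector_4 1 a_def x_def .
qed

text \<open>In the multiplied-out form the relation also makes sense at zeros of q, so products and
  sums need no exceptional points.\<close>

definition rational_on_curve :: "(complex \<Rightarrow> complex) \<Rightarrow> bool" where
  "rational_on_curve h \<longleftrightarrow> (\<exists>p q. (p, q) \<in> fractions weber_cubic \<and>
     (\<forall>\<tau>. Im \<tau> > 0 \<longrightarrow> h \<tau> * q (weber_point \<tau>) = p (weber_point \<tau>)))"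

lemma rational_on_curve_const: "rational_on_curve (\<lambda>_. c)"
  unfolding rational_on_curve_def using fractions_const[of c] by force

lemma rational_on_curve_mult:
  assumes "rational_on_curve g" "rational_on_curve h"
  shows "rational_on_curve (\<lambda>\<tau>. g \<tau> * h \<tau>)"
proof -
  obtain p q p' q' where pq: "(p, q) \<in> fractions weber_cubic" "(p', q') \<in> fractions weber_cubic"
    "\<And>\<tau>. Im \<tau> > 0 \<Longrightarrow> g \<tau> * q (weber_point \<tau>) = p (weber_point \<tau>)" "\<And>\<tau>. Im \<tau> > 0 \<Longrightarrow> h \<tau> * q' (weber_point \<tau>) = p' (weber_point \<tau>)"
    using assms unfolding rational_on_curve_def by blast
  have "g \<tau> * h \<tau> * (q (weber_point \<tau>) * q' (weber_point \<tau>)) = p (weber_point \<tau>) * p' (weber_point \<tau>)" if "Im \<tau> > 0" for \<tau>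
    using pq(3,4)[OF that, symmetric] by (simp add: mult_ac)
  then show ?thesis unfolding rational_on_curve_def using fractions_multI[OF pq(1,2)] by fast
qed

lemma rational_on_curve_add:
  assumes "rational_on_curve g" "rational_on_curve h"
  shows "rational_on_curve (\<lambda>\<tau>. g \<tau> + h \<tau>)"
proof -
  obtain p q p' q' where pq: "(p, q) \<in> fractions weber_cubic" "(p', q') \<in> fractions weber_cubic"
    "\<And>\<tau>. Im \<tau> > 0 \<Longrightarrow> g \<tau> * q (weber_point \<tau>) = p (weber_point \<tau>)" "\<And>\<tau>. Im \<tau> > 0 \<Longrightarrow> h \<tau> * q' (weber_point \<tau>) = p' (weber_point \<tau>)"
    using assms unfolding rational_on_curve_def by blast
  have "(g \<tau> + h \<tau>) * (q (weber_point \<tau>) * q' (weber_point \<tau>)) = p (weber_point \<tau>) * q' (weber_point \<tau>) + p' (weber_point \<tau>) * q (weber_point \<tau>)" if "Im \<tau> > 0" for \<tau>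
    using pq(3,4)[OF that, symmetric] by (simp add: algebra_simps)
  then show ?thesis unfolding rational_on_curve_def using fractions_addI[OF pq(1,2)] by fast
qed

lemma rational_on_curve_lam: "rational_on_curve lam"
proof -
  define p where "p = (\<lambda>x :: complex ^ 4. 16 * x $ 4 + (- 1) * x $ 3)"
  define q where "q = (\<lambda>x :: complex ^ 4. x $ 1 + (- 16) * x $ 4)"
  have hom: "homogeneous_poly 1 p" "homogeneous_poly 1 q"
    unfolding p_def q_def
    by (intro homogeneous_poly_add homogeneous_poly_cmult homogeneous_poly_coord)+
  have eq: "lam \<tau> * q (weber_point \<tau>) = p (weber_point \<tau>)" if "Im \<tau> > 0" for \<tau>
    using lam_rational[OF that] by (simp add: p_def q_def)
  \<comment> \<open>Otherwise \<open>weber_u0\<close> ^ 24 would be the constant 16; but its product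
    with the nome tends to 1 instead of 0.\<close>
  have "\<exists>\<tau>. Im \<tau> > 0 \<and> q (weber_point \<tau>) \<noteq> 0"
  proof (rule ccontr)
    assume *: "\<not> ?thesis"
    have e: "16 * nome \<tau> = weber8 1 1 \<tau> ^ 3 * nome \<tau>" if "Im \<tau> > 0" for \<tau>
      using * that by (simp add: q_def weber_map_1 vector_4)
    have "\<forall>\<^sub>F \<tau> in at_ii_inf. 16 * nome \<tau> = weber8 1 1 \<tau> ^ 3 * nome \<tau>"
      using eventually_at_ii_inf_gt[of 0] by eventually_elim (rule e)
    moreover have "((\<lambda>\<tau>. 16 * nome \<tau>) \<longlongrightarrow> 16 * 0) at_ii_inf"
      by (intro tendsto_intros tendsto_nome)
    ultimately have "((\<lambda>\<tau>. weber8 1 1 \<tau> ^ 3 * nome \<tau>) \<longlongrightarrow> 16 * 0) at_ii_inf"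
      by (simp only: tendsto_cong)
    then show False
      using tendsto_unique[OF at_ii_inf_neq_bot _ weber8_cubed_tendsto[of 1 1]] by force
  qed
  then have "(p, q) \<in> fractions weber_cubic"
    using hom unfolding fractions_weber_curve by blast
  then show ?thesis using eq unfolding rational_on_curve_def by blast
qed

lemma rational_on_curve_poly_lam: "rational_on_curve (\<lambda>\<tau>. poly p (lam \<tau>))"
proof (induction p)
  case (pCons a p)
  then show ?case
    using rational_on_curve_add[OF rational_on_curve_const[of a] rational_on_curve_mult[OF rational_on_curve_lam]]
    by simp
qed (simp add: rational_on_curve_const)

text \<open>Otherwise \<open>lam\<close> would take finitely many values and so be constant; the
  constant would be the limit 0 at infinity, a value that \<open>lam\<close> omits.\<close>

lemma poly_lam_nonzero:
  assumes "p \<noteq> 0"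
  shows "\<exists>\<tau>. Im \<tau> > 0 \<and> poly p (lam \<tau>) \<noteq> 0"
proof (rule ccontr)
  assume "\<not> ?thesis"
  then have "lam ` upper_half_plane \<subseteq> {x. poly p x = 0}" by auto
  then have "finite (lam ` upper_half_plane)" using poly_roots_finite[OF assms] finite_subset by blast
  then have "lam constant_on upper_half_plane"
    by (intro continuous_finite_range_constant connected_upper_half_plane holomorphic_on_imp_continuous_on holomorphic_on_lam)
  then obtain c where "\<And>\<tau>. Im \<tau> > 0 \<Longrightarrow> lam \<tau> = c"
    unfolding constant_on_def by auto
  then have c: "lam \<tau> = lam \<i>" if "Im \<tau> > 0" for \<tau>
    using that by simp
  have "\<forall>\<^sub>F \<tau> in at_ii_inf. lam \<tau> = lam \<i>"
    using eventually_at_ii_inf_gt[of 0] by eventually_elim (rule c)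
  then have "(lam \<longlongrightarrow> lam \<i>) at_ii_inf" by (rule tendsto_eventually)
  then have "lam \<i> = 0" using tendsto_unique[OF at_ii_inf_neq_bot _ lam_tendsto] by blast
  then show False using lam_nonzero[of \<i>] by simp
qed

text \<open>Write f as P(lam) / Q(lam), with P(lam) = p1 / q1 and Q(lam) = p2 / q2 on the curve. The
  fraction p1 q2 / (q1 p2) agrees with f on punctured neighbourhoods, and both sides are normalised,
  so they agree everywhere, poles included.\<close>

lemma modular_function_is_pullback:
  assumes "f \<in> carrier (modular_function_field (principal_congruence 2))"
  shows "\<exists>p q. (p, q) \<in> fractions weber_cubic \<and> f = pullback p q"
proof -
  have f: "f nicely_meromorphic_on upper_half_plane" "\<And>\<tau>. \<tau> \<notin> upper_half_plane \<Longrightarrow> f \<tau> = 0"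
     "Gamma2_invariant f" "meromorphic_at_cusps f"
    using assms by (auto simp: modular_function_field_def principal_congruence_2 Gamma2_invariant_def)
  obtain P Q where PQ: "Q \<noteq> 0" "\<And>\<tau>. Im \<tau> > 0 \<Longrightarrow> f analytic_on {\<tau>} \<Longrightarrow> f \<tau> * poly Q (lam \<tau>) = poly P (lam \<tau>)"
    using modular_function_rational_in_lam[OF f(1,3,4)] by blast
  obtain p1 q1 p2 q2 where pq: "(p1, q1) \<in> fractions weber_cubic" "(p2, q2) \<in> fractions weber_cubic"
    and eq1: "\<And>\<tau>. Im \<tau> > 0 \<Longrightarrow> poly P (lam \<tau>) * q1 (weber_point \<tau>) = p1 (weber_point \<tau>)"
    and eq2: "\<And>\<tau>. Im \<tau> > 0 \<Longrightarrow> poly Q (lam \<tau>) * q2 (weber_point \<tau>) = p2 (weber_point \<tau>)"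
    using rational_on_curve_poly_lam[of P] rational_on_curve_poly_lam[of Q] unfolding rational_on_curve_def by blast
  obtain d e where hom: "homogeneous_poly d p1" "homogeneous_poly d q1" "homogeneous_poly e p2" "homogeneous_poly e q2"
    using pq unfolding fractions_weber_curve by blast
  have "(\<lambda>\<tau>. poly Q (lam \<tau>)) holomorphic_on upper_half_plane"
    by (intro holomorphic_intros holomorphic_on_lam)
  moreover obtain \<tau>0 where "Im \<tau>0 > 0" "poly Q (lam \<tau>0) \<noteq> 0" using poly_lam_nonzero[OF PQ(1)] by blast
  ultimately have Qnz: "\<forall>\<^sub>F w in at z. poly Q (lam w) \<noteq> 0 \<and> w \<in> upper_half_plane" if "Im z > 0" for z
    using non_zero_neighbour_alt[OF _ open_upper_half_plane connected_upper_half_plane, of _ z \<tau>0] that by auto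
  have ev: "\<forall>\<^sub>F w in at z. q1 (weber_point w) \<noteq> 0 \<and> q2 (weber_point w) \<noteq> 0 \<and> p2 (weber_point w) \<noteq> 0 \<and> Im w > 0" if "Im z > 0" for z
    using eventually_poly_weber_map_nonzero[OF pq(1) that] eventually_poly_weber_map_nonzero[OF pq(2) that] Qnz[OF that]
    by eventually_elim (simp flip: eq2)
  have "\<exists>w. q1 (weber_point w) \<noteq> 0 \<and> q2 (weber_point w) \<noteq> 0 \<and> p2 (weber_point w) \<noteq> 0 \<and> Im w > 0"
    by (rule eventually_happens'[OF at_neq_bot ev[of \<i>]]) simp
  then have frac: "(\<lambda>x. p1 x * q2 x, \<lambda>x. q1 x * p2 x) \<in> fractions weber_cubic"
    using homogeneous_poly_mult[OF hom(1,4)] homogeneous_poly_mult[OF hom(2,3)]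
    unfolding fractions_weber_curve by auto
  have "f z = pullback (\<lambda>x. p1 x * q2 x) (\<lambda>x. q1 x * p2 x) z" for z
  proof (cases "Im z > 0")
    case True
    have mero: "f meromorphic_on {z}"
      using f(1) True meromorphic_on_subset unfolding nicely_meromorphic_on_def by blast
    have "\<forall>\<^sub>F w in at z. f analytic_on {w}"
    proof -
      obtain r where "r > 0" "f analytic_on ball z r - {z}"
        using meromorphic_on_isolated_singularity[OF mero] unfolding isolated_singularity_at_def by blast
      then show ?thesis
        using eventually_at_in_open[OF open_ball, of z z r]
        by (auto elim!: eventually_mono intro: analytic_on_subset)
    qed
    then have "\<forall>\<^sub>F w in at z. f w = p1 (weber_point w) * q2 (weber_point w) / (q1 (weber_point w) * p2 (weber_point w))"
      using ev[OF True]
    proof eventually_elim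
      case (elim w)
      have "f w * p2 (weber_point w) * q1 (weber_point w) = f w * poly Q (lam w) * q2 (weber_point w) * q1 (weber_point w)"
        using eq2[of w] elim by (simp add: mult_ac flip: eq2)
      also have "\<dots> = poly P (lam w) * q2 (weber_point w) * q1 (weber_point w)" using PQ(2)[of w] elim by simp
      also have "\<dots> = p1 (weber_point w) * q2 (weber_point w)" using eq1[of w] elim by (simp add: mult_ac flip: eq1)
      finally show ?case using elim by (simp add: eq_divide_eq mult_ac)
    qed
    then have "remove_sings f z = remove_sings (\<lambda>w. p1 (weber_point w) * q2 (weber_point w) / (q1 (weber_point w) * p2 (weber_point w))) z"
      by (rule remove_sings_cong[OF _ refl])
    moreover have "remove_sings f z = f z"
      using f(1) True unfolding nicely_meromorphic_on_def by auto
    ultimately show ?thesis using True by (simp add: pullback_def normalise_mero_def)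
  next
    case False
    then show ?thesis using f(2) by (simp add: pullback_def normalise_mero_def)
  qed
  then show ?thesis using frac by blast
qed

section \<open>The isomorphism of function fields\<close>

definition curve_iso ::
  "((complex ^ 4 \<Rightarrow> complex) \<times> (complex ^ 4 \<Rightarrow> complex)) set \<Rightarrow> complex \<Rightarrow> complex" where
  "curve_iso C = the_elem ((\<lambda>(p, q). pullback p q) ` C)"

text \<open>\<open>pullback\<close> is constant on each class, so its image there is a singleton
  from which \<open>the_elem\<close> reads off the value.\<close>

lemma curve_iso_rat_fun:
  assumes "(p, q) \<in> fractions weber_cubic"
  shows "curve_iso (rat_fun weber_cubic p q) = pullback p q"
proof -
  have "(\<lambda>(p, q). pullback p q) ` rat_fun weber_cubic p q = {pullback p q}"
    unfolding rat_fun_eq[OF assms] using assms by auto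
  then show ?thesis by (simp add: curve_iso_def)
qed

lemma carrier_function_field:
  "carrier (function_field weber_cubic) =
     {rat_fun weber_cubic p q | p q. (p, q) \<in> fractions weber_cubic}"
  by (auto simp: function_field_def quotient_def rat_fun_def)

text \<open>The operations of \<open>function_field\<close> are unions over all representatives;
  when every choice gives the same class, the union collapses to it.\<close>

lemma rat_fun_representatives:
  assumes pq: "(p, q) \<in> fractions weber_cubic" "(p', q') \<in> fractions weber_cubic"
    and R: "\<And>a b c d. (a, b) \<in> fractions weber_cubic \<Longrightarrow> (c, d) \<in> fractions weber_cubic \<Longrightarrow>
      pullback a b = pullback p q \<Longrightarrow> pullback c d = pullback p' q' \<Longrightarrow> F a b c d = X"
  shows "(\<Union>(a, b)\<in>rat_fun weber_cubic p q. \<Union>(c, d)\<in>rat_fun weber_cubic p' q'. F a b c d) = X"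
proof -
  have "(p, q) \<in> rat_fun weber_cubic p q" "(p', q') \<in> rat_fun weber_cubic p' q'"
    using pq by (auto simp: rat_fun_eq)
  moreover have "F a b c d = X" if "(a, b) \<in> rat_fun weber_cubic p q" "(c, d) \<in> rat_fun weber_cubic p' q'" for a b c d
    using that R pq by (auto simp: rat_fun_eq)
  ultimately show ?thesis by blast
qed

lemma function_field_mult:
  assumes pq: "(p, q) \<in> fractions weber_cubic" "(p', q') \<in> fractions weber_cubic"
  shows "rat_fun weber_cubic p q \<otimes>\<^bsub>function_field weber_cubic\<^esub> rat_fun weber_cubic p' q' =
     rat_fun weber_cubic (\<lambda>x. p x * p' x) (\<lambda>x. q x * q' x)"
  unfolding function_field_def
  by simp (rule rat_fun_representatives[OF pq], simp add: rat_fun_eq_iff fractions_multI pq pullback_mult)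

lemma function_field_add:
  assumes pq: "(p, q) \<in> fractions weber_cubic" "(p', q') \<in> fractions weber_cubic"
  shows "rat_fun weber_cubic p q \<oplus>\<^bsub>function_field weber_cubic\<^esub> rat_fun weber_cubic p' q' =
     rat_fun weber_cubic (\<lambda>x. p x * q' x + p' x * q x) (\<lambda>x. q x * q' x)"
  unfolding function_field_def
  by simp (rule rat_fun_representatives[OF pq], simp add: rat_fun_eq_iff fractions_addI pq pullback_add)

lemma pullback_const: "pullback (\<lambda>_. c) (\<lambda>_. 1) = normalise_mero (\<lambda>_. c)"
  by (simp add: pullback_def)

lemma curve_iso_ring_iso:
  "curve_iso \<in> ring_iso (function_field weber_cubic) (modular_function_field (principal_congruence 2))"
proof (rule ring_iso_memI)
  let ?K = "function_field weber_cubic" and ?M = "modular_function_field (principal_congruence 2)"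
  show "curve_iso x \<in> carrier ?M" if "x \<in> carrier ?K" for x
    using that by (auto simp: carrier_function_field curve_iso_rat_fun pullback_in_modular_function_field)
  show "curve_iso (x \<otimes>\<^bsub>?K\<^esub> y) = curve_iso x \<otimes>\<^bsub>?M\<^esub> curve_iso y" if xy: "x \<in> carrier ?K" "y \<in> carrier ?K" for x y
  proof -
    obtain p q p' q' where pq: "(p, q) \<in> fractions weber_cubic" "(p', q') \<in> fractions weber_cubic"
      "x = rat_fun weber_cubic p q" "y = rat_fun weber_cubic p' q'"
      using xy unfolding carrier_function_field by blast
    have "curve_iso (x \<otimes>\<^bsub>?K\<^esub> y) = pullback (\<lambda>x. p x * p' x) (\<lambda>x. q x * q' x)"
      unfolding pq(3,4) function_field_mult[OF pq(1,2)] by (rule curve_iso_rat_fun[OF fractions_multI[OF pq(1,2)]])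
    then show ?thesis
      by (simp add: pullback_mult[OF pq(1,2)] pq(3,4) curve_iso_rat_fun pq(1,2) modular_function_field_def)
  qed
  show "curve_iso (x \<oplus>\<^bsub>?K\<^esub> y) = curve_iso x \<oplus>\<^bsub>?M\<^esub> curve_iso y" if xy: "x \<in> carrier ?K" "y \<in> carrier ?K" for x y
  proof -
    obtain p q p' q' where pq: "(p, q) \<in> fractions weber_cubic" "(p', q') \<in> fractions weber_cubic"
      "x = rat_fun weber_cubic p q" "y = rat_fun weber_cubic p' q'"
      using xy unfolding carrier_function_field by blast
    have "curve_iso (x \<oplus>\<^bsub>?K\<^esub> y) = pullback (\<lambda>x. p x * q' x + p' x * q x) (\<lambda>x. q x * q' x)"
      unfolding pq(3,4) function_field_add[OF pq(1,2)] by (rule curve_iso_rat_fun[OF fractions_addI[OF pq(1,2)]])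
    then show ?thesis
      by (simp add: pullback_add[OF pq(1,2)] pq(3,4) curve_iso_rat_fun pq(1,2) modular_function_field_def)
  qed
  have "\<one>\<^bsub>?K\<^esub> = rat_fun weber_cubic (\<lambda>_. 1) (\<lambda>_. 1)" by (simp add: function_field_def)
  then show "curve_iso \<one>\<^bsub>?K\<^esub> = \<one>\<^bsub>?M\<^esub>"
    by (simp add: curve_iso_rat_fun fractions_const pullback_const modular_function_field_def)
  show "bij_betw curve_iso (carrier ?K) (carrier ?M)"
  proof (rule bij_betwI')
    show "curve_iso x = curve_iso y \<longleftrightarrow> x = y" if "x \<in> carrier ?K" "y \<in> carrier ?K" for x y
    proof -
      obtain p q p' q' where "(p, q) \<in> fractions weber_cubic" "(p', q') \<in> fractions weber_cubic"
        "x = rat_fun weber_cubic p q" "y = rat_fun weber_cubic p' q'"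
        using \<open>x \<in> carrier ?K\<close> \<open>y \<in> carrier ?K\<close> unfolding carrier_function_field by blast
      then show ?thesis by (simp add: curve_iso_rat_fun rat_fun_eq_iff)
    qed
    show "curve_iso x \<in> carrier ?M" if "x \<in> carrier ?K" for x
      using that by (auto simp: carrier_function_field curve_iso_rat_fun pullback_in_modular_function_field)
    show "\<exists>x\<in>carrier ?K. f = curve_iso x" if "f \<in> carrier ?M" for f
    proof -
      obtain p q where "(p, q) \<in> fractions weber_cubic" "f = pullback p q"
        using modular_function_is_pullback[OF \<open>f \<in> carrier ?M\<close>] by blast
      then show ?thesis
        by (intro bexI[of _ "rat_fun weber_cubic p q"]) (auto simp: curve_iso_rat_fun carrier_function_field)
    qed
  qed
qed

theorem proposition6:
  shows "weber_kernel 1 = principal_congruence 2 \<and>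
         weber_curve_iso 1 (principal_congruence 2)"
proof
  show "weber_kernel 1 = principal_congruence 2" by (rule weber_kernel_1)
  show "weber_curve_iso 1 (principal_congruence 2)"
    unfolding weber_curve_iso_def weber_cubic_def [symmetric] weber_point_def [symmetric]
    by (rule bexI[OF _ curve_iso_ring_iso])
       (auto simp: curve_iso_rat_fun fractions_const pullback_const pullback_def)
qed

end
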